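(* Let $F_1,\dots,F_h\in\mathbb{Z}[x_1,\dots,x_d]$ be nonzero polynomials and $g(x)=\gcd(F_1(x),\dots,F_h(x))$ for $x\in\mathbb{Z}^d$. (a) If $F_1,\dots,F_h$ are not relatively prime in $\mathbb{Q}[x_1,\dots,x_d]$, then $\lambda(\{1\})=0$. (b) If $F_1,\dots,F_h$ are relatively prime, i.e. $\gcd(F_1,\dots,F_h)=1$ in $\mathbb{Q}[x_1,\dots,x_d]$, then: (i) $\lambda(\{1\})$ exists and $\lambda(\{1\})=\prod_{p}\lambda_p(\{1\})$, the product being over all primes $p$; (ii) $\lambda_p(\{0\})=O(p^{-2})$ as $p\to\infty$ over the primes (the implied constant may depend on $F_1,\dots,F_h$); (iii) $\lambda(\{1\})=0$ if and only if $\lambda_p(\{1\})=0$ for some prime $p$, i.e. if and only if there exists a prime $p$ such that $F_1(x),F_2(x),\dots,F_h(x)$ are all multiples of $p$ for all $x\in\mathbb{Z}^d$.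
   Context: $d,h$ are positive integers. The gcd of integers is nonnegative, and $g(x)=0$ if $F_j(x)=0$ for all $j$. For a positive integer $k$, $\mathbb{Z}_{(k)}=\{-k,-k+1,\dots,k\}$. For $\mathcal{Z}\subseteq\mathbb{Z}$, $\lambda^{(k)}(\mathcal{Z})$ is the probability that $g(x)\in\mathcal{Z}$ when $x$ is uniformly distributed over $\mathbb{Z}_{(k)}^d$, and $\lambda(\mathcal{Z})=\lim_{k\to\infty}\lambda^{(k)}(\mathcal{Z})$ if the limit exists. For a prime $p$, $\lambda_p(\mathcal{Z})$ is the probability, for $x$ uniformly distributed over $(\mathbb{Z}/p\mathbb{Z})^d$, that $g(x)\in\mathcal{Z}\ (\mathrm{mod}\ p)$ up to multiplication by a unit. Thus $\lambda_p(\{0\})$ is the probability that $F_1(x),\dots,F_h(x)$ all vanish in $\mathbb{Z}/p\mathbb{Z}$, and $\lambda_p(\{1\})=1-\lambda_p(\{0\})$. *)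

theory Defs
  imports
    "HOL-Library.Poly_Mapping"
    "HOL-Library.Landau_Symbols"
    "HOL-Analysis.Infinite_Products"
    "HOL-Probability.Probability_Mass_Function"
    "HOL-Number_Theory.Cong"
begin

text \<open>
  A polynomial maps each monomial (a finitely supported exponent vector) to its coefficient; the
  ring operations are the convolution ones of \<open>HOL-Library.Poly_Mapping\<close>.  The type itself
  allows the infinitely many variables \<open>x\<^sub>0, x\<^sub>1, \<dots>\<close>, so \<open>polys d\<close> cuts out
  the ring in the \<open>d\<close> variables \<open>x\<^sub>0, \<dots>, x\<^bsub>d-1\<^esub>\<close>.
\<close>

type_synonym 'a mpoly = "(nat \<Rightarrow>\<^sub>0 nat) \<Rightarrow>\<^sub>0 'a"

definition polys :: "nat \<Rightarrow> 'a::zero mpoly set" where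
  "polys d = {P. \<forall>m \<in> Poly_Mapping.keys P. Poly_Mapping.keys m \<subseteq> {..<d}}"

definition eval_poly :: "'a::comm_semiring_1 mpoly \<Rightarrow> (nat \<Rightarrow> 'a) \<Rightarrow> 'a" where
  "eval_poly P x =
     (\<Sum>m \<in> Poly_Mapping.keys P.
        Poly_Mapping.lookup P m * (\<Prod>i \<in> Poly_Mapping.keys m. x i ^ Poly_Mapping.lookup m i))"

definition rat_poly :: "int mpoly \<Rightarrow> rat mpoly" where
  "rat_poly P = Poly_Mapping.map rat_of_int P"

text \<open>
  Families \<open>F\<^sub>1, \<dots>, F\<^sub>h\<close> are indexed by \<open>{..<h}\<close>; values of \<open>F\<close> outside this
  range play no role.  That the gcd of the family in the polynomial ring over the rationals in
  \<open>d\<close> variables is 1 means that every common divisor in this ring is a unit of this ring.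
\<close>

definition rel_prime_over_Q :: "nat \<Rightarrow> nat \<Rightarrow> (nat \<Rightarrow> int mpoly) \<Rightarrow> bool" where
  "rel_prime_over_Q d h F \<longleftrightarrow>
     (\<forall>G \<in> polys d. (\<forall>j<h. \<exists>H \<in> polys d. rat_poly (F j) = G * H) \<longrightarrow>
        (\<exists>H \<in> polys d. G * H = 1))"

definition gcd_value :: "nat \<Rightarrow> (nat \<Rightarrow> int mpoly) \<Rightarrow> (nat \<Rightarrow> int) \<Rightarrow> int" where
  "gcd_value h F x = Gcd ((\<lambda>j. eval_poly (F j) x) ` {..<h})"

definition gcd_density_upto ::
    "nat \<Rightarrow> nat \<Rightarrow> (nat \<Rightarrow> int mpoly) \<Rightarrow> int set \<Rightarrow> nat \<Rightarrow> real" where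
  "gcd_density_upto d h F Z k =
     measure_pmf.prob (pmf_of_set ({..<d} \<rightarrow>\<^sub>E {- int k..int k})) {x. gcd_value h F x \<in> Z}"

text \<open>Only meaningful if \<open>gcd_density_upto d h F Z\<close> is \<open>convergent\<close>.\<close>

definition gcd_density :: "nat \<Rightarrow> nat \<Rightarrow> (nat \<Rightarrow> int mpoly) \<Rightarrow> int set \<Rightarrow> real" where
  "gcd_density d h F Z = lim (gcd_density_upto d h F Z)"

text \<open>
  The residue classes modulo \<open>p\<close> are represented by \<open>0, \<dots>, p - 1\<close>.  Changing the
  representatives of the point changes \<open>gcd_value h F x\<close> only by a unit modulo \<open>p\<close>.
\<close>

definition gcd_density_mod ::
    "nat \<Rightarrow> nat \<Rightarrow> (nat \<Rightarrow> int mpoly) \<Rightarrow> nat \<Rightarrow> int set \<Rightarrow> real" where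
  "gcd_density_mod d h F p Z =
     measure_pmf.prob (pmf_of_set ({..<d} \<rightarrow>\<^sub>E {0..<int p}))
       {x. \<exists>z \<in> Z. \<exists>u. coprime u (int p) \<and> [gcd_value h F x = u * z] (mod int p)}"

lemma gcd_density_mod_0:
  "gcd_density_mod d h F p {0} =
     measure_pmf.prob (pmf_of_set ({..<d} \<rightarrow>\<^sub>E {0..<int p}))
       {x. \<forall>j<h. [eval_poly (F j) x = 0] (mod int p)}"
proof -
  have "{x. \<exists>z \<in> {0}. \<exists>u. coprime u (int p) \<and> [gcd_value h F x = u * z] (mod int p)} =
      {x. \<forall>j<h. [eval_poly (F j) x = 0] (mod int p)}"
    by (auto simp: gcd_value_def cong_0_iff dvd_Gcd_iff intro: exI[of _ 1])
  then show ?thesis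
    unfolding gcd_density_mod_def by simp
qed

lemma gcd_density_mod_1:
  assumes "prime p"
  shows "gcd_density_mod d h F p {1} = 1 - gcd_density_mod d h F p {0}"
proof -
  have *: "(\<exists>u. coprime u (int p) \<and> [g = u] (mod int p)) \<longleftrightarrow> \<not> [g = 0] (mod int p)" for g :: int
  proof
    assume "\<exists>u. coprime u (int p) \<and> [g = u] (mod int p)"
    then obtain u where u: "coprime u (int p)" "[g = u] (mod int p)"
      by blast
    have "\<not> int p dvd u"
      using u(1) assms coprime_common_divisor[of u "int p" "int p"]
      by (metis dvd_refl not_prime_unit prime_int_nat_transfer nat_int of_nat_0_le_iff)
    then show "\<not> [g = 0] (mod int p)"
      using u(2) by (simp add: cong_0_iff cong_dvd_iff)
  next
    assume "\<not> [g = 0] (mod int p)"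
    then have "coprime g (int p)"
      using assms prime_imp_coprime[of "int p" g] by (simp add: cong_0_iff coprime_commute)
    then show "\<exists>u. coprime u (int p) \<and> [g = u] (mod int p)"
      using cong_refl by blast
  qed
  have "{x. \<exists>z \<in> {1}. \<exists>u. coprime u (int p) \<and> [gcd_value h F x = u * z] (mod int p)} =
      UNIV - {x. \<exists>z \<in> {0}. \<exists>u. coprime u (int p) \<and> [gcd_value h F x = u * z] (mod int p)}"
    using * by (auto intro: exI[of _ 1])
  then show ?thesis
    unfolding gcd_density_mod_def
    using measure_pmf.prob_compl[of _ "pmf_of_set ({..<d} \<rightarrow>\<^sub>E {0..<int p})"] by simp
qed

end

theory Submission
  imports Defs "HOL-Computational_Algebra.Polynomial"
begin

text \<open>
  Suppose first that the family has a nonconstant common factor \<open>G\<close> over the rationals.  After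
  clearing denominators, \<open>G x\<close> divides \<open>N * g x\<close> for a fixed nonzero integer \<open>N\<close>.  So \<open>g x = 1\<close>
  confines \<open>G x\<close> to finitely many values, and a nonzero polynomial has only
  \<open>O(k ^ (d - 1))\<close> zeros in the box (\<open>density_common_factor\<close>).

  For a coprime family the theorem is a case of the sieve of Ekedahl and Poonen.  By the Chinese
  remainder theorem, the points at which no prime up to \<open>M\<close> divides all the values have density
  \<open>\<Prod>p\<le>M. \<lambda>\<^sub>p({1})\<close> (\<open>density_small_primes\<close>).  To pass to the limit \<open>M \<rightarrow> \<infinity>\<close> one needs that the
  primes beyond \<open>M\<close> matter for a small proportion of the points of the box, uniformly in the box
  (\<open>card_tail\<close>).  A prime up to the side length of the box is controlled by the number of common
  zeros modulo \<open>p\<close>, which is \<open>O(p ^ (d - 2))\<close> (\<open>card_common_zeros_mod\<close>), and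
  \<open>\<Sum>p. 1 / p\<^sup>2\<close> converges.  The larger primes are controlled all at once
  (\<open>card_common_large_prime\<close>), because a nonzero integer that is polynomially bounded in \<open>k\<close> has a
  bounded number of prime factors larger than \<open>k\<close>.  The count of common zeros modulo \<open>p\<close> is also the
  claim \<open>\<lambda>\<^sub>p({0}) = O(1 / p\<^sup>2)\<close>; it makes the infinite product converge absolutely, and such a
  product vanishes only if one of its factors does.

  Both counts are inductions on the number of variables.  Let the family be coprime in
  \<open>x\<^sub>0, \<dots>, x\<^sub>n\<close>.  Its coefficients with respect to \<open>x\<^sub>n\<close> form a coprime family in the
  remaining variables (\<open>coprime_in_last_var_coeffs\<close>), and the ideal generated by the family contains
  a nonzero polynomial \<open>R\<close> free of \<open>x\<^sub>n\<close> (\<open>elimination\<close>).  If \<open>p\<close> divides all values at a point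
  \<open>(y, t)\<close>, then either \<open>p\<close> divides all the coefficients at \<open>y\<close>, which is covered by the
  induction hypothesis, or \<open>p\<close> divides \<open>R y\<close> and \<open>t\<close> is modulo \<open>p\<close> one of boundedly many roots of
  a nonzero polynomial.  The zeros of \<open>R\<close> are counted by the Schwartz-Zippel bound
  \<open>card_zeros_mod\<close>.

  Elimination is the algebraic core.  It needs that a polynomial ring over a field is factorial; this is Gauss's theorem \<open>factorial_coeffs_in\<close> together with an
  induction on the number of variables (\<open>polys_factorial\<close>).
\<close>

section \<open>Polynomial rings in finitely many variables\<close>

definition const_poly :: "'a::zero \<Rightarrow> 'a mpoly" where
  "const_poly c = Poly_Mapping.single 0 c"

definition var :: "nat \<Rightarrow> 'a::zero_neq_one mpoly" where
  "var i = Poly_Mapping.single (Poly_Mapping.single i 1) 1"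

lemma mpoly_eq_sum_monomials:
  fixes P :: "'a::comm_monoid_add mpoly"
  shows "P = (\<Sum>m\<in>Poly_Mapping.keys P. Poly_Mapping.single m (Poly_Mapping.lookup P m))"
  by (rule poly_mapping_eqI)
     (auto simp: lookup_sum lookup_single when_def in_keys_iff)

lemma monomial_eq_prod_vars:
  "Poly_Mapping.single m c =
     const_poly c * (\<Prod>i\<in>Poly_Mapping.keys m. var i ^ Poly_Mapping.lookup m i :: 'a::comm_semiring_1 mpoly)"
proof -
  have pow: "(var i :: 'a mpoly) ^ k = Poly_Mapping.single (Poly_Mapping.single i k) 1" for i k
    by (induction k) (simp_all add: var_def mult_single single_add[symmetric] flip: single_one)
  have prod: "(\<Prod>i\<in>A. var i ^ Poly_Mapping.lookup m i :: 'a mpoly) =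
      Poly_Mapping.single (\<Sum>i\<in>A. Poly_Mapping.single i (Poly_Mapping.lookup m i)) 1" if "finite A" for A
    using that by (induction A) (simp_all add: pow mult_single)
  have "m = (\<Sum>i\<in>Poly_Mapping.keys m. Poly_Mapping.single i (Poly_Mapping.lookup m i))"
    by (rule poly_mapping_eqI)
       (auto simp: lookup_sum lookup_single when_def in_keys_iff)
  then show ?thesis
    by (simp add: prod const_poly_def mult_single)
qed

lemma const_poly_hom [simp]:
  "const_poly 0 = 0"
  "const_poly (1::'a::comm_ring_1) = 1"
  "const_poly (a + b :: 'a) = const_poly a + const_poly b"
  "const_poly (a - b :: 'a) = const_poly a - const_poly b"
  "const_poly (- b :: 'a) = - const_poly b"
  "const_poly (a * b :: 'a) = const_poly a * const_poly b"
  by (simp_all add: const_poly_def single_add single_diff single_uminus mult_single)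

lemma const_poly_eq_iff [simp]: "const_poly a = const_poly b \<longleftrightarrow> a = b"
  unfolding const_poly_def by (metis lookup_single_eq)

lemma const_poly_eq_0_iff [simp]: "const_poly a = 0 \<longleftrightarrow> a = 0"
  using const_poly_eq_iff[of a 0] by simp

lemma const_in_polys [simp]: "const_poly c \<in> polys n"
  by (simp add: polys_def const_poly_def)

lemma zero_in_polys [simp]: "0 \<in> polys n"
  by (simp add: polys_def)

lemma one_in_polys [simp]: "(1::'a::comm_ring_1 mpoly) \<in> polys n"
  using const_in_polys[of "1::'a" n] by simp

lemma var_in_polys: "i < n \<Longrightarrow> (var i :: 'a::zero_neq_one mpoly) \<in> polys n"
  by (simp add: polys_def var_def)

lemma add_in_polys [simp]:
  fixes p q :: "'a::comm_ring_1 mpoly"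
  assumes "p \<in> polys n" "q \<in> polys n"
  shows "p + q \<in> polys n"
  using assms keys_add[of p q] unfolding polys_def by blast

lemma uminus_in_polys [simp]:
  fixes p :: "'a::comm_ring_1 mpoly"
  assumes "p \<in> polys n"
  shows "- p \<in> polys n"
  using assms unfolding polys_def by (auto simp: in_keys_iff)

lemma diff_in_polys [simp]:
  fixes p q :: "'a::comm_ring_1 mpoly"
  assumes "p \<in> polys n" "q \<in> polys n"
  shows "p - q \<in> polys n"
  using add_in_polys[of p n "- q"] assms by simp

lemma mult_in_polys [simp]:
  fixes p q :: "'a::comm_ring_1 mpoly"
  assumes "p \<in> polys n" "q \<in> polys n"
  shows "p * q \<in> polys n"
  unfolding polys_def
proof safe
  fix m i assume "m \<in> Poly_Mapping.keys (p * q)" and i: "i \<in> Poly_Mapping.keys m"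
  then obtain a b where ab: "m = a + b" "a \<in> Poly_Mapping.keys p" "b \<in> Poly_Mapping.keys q"
    using keys_mult[of p q] by blast
  then have "i \<in> Poly_Mapping.keys a \<union> Poly_Mapping.keys b"
    using i keys_add[of a b] by blast
  then show "i < n"
    using ab assms unfolding polys_def by blast
qed

lemma sum_in_polys [simp]:
  fixes f :: "'b \<Rightarrow> 'a::comm_ring_1 mpoly"
  assumes "\<And>i. i \<in> A \<Longrightarrow> f i \<in> polys n"
  shows "sum f A \<in> polys n"
  using assms by (induction A rule: infinite_finite_induct) auto

lemma prod_in_polys:
  fixes f :: "'b \<Rightarrow> 'a::comm_ring_1 mpoly"
  assumes "\<And>i. i \<in> A \<Longrightarrow> f i \<in> polys n"
  shows "prod f A \<in> polys n"
  using assms by (induction A rule: infinite_finite_induct) auto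

lemma polys_mono: "m \<le> n \<Longrightarrow> polys m \<subseteq> polys n"
  by (fastforce simp: polys_def)

lemma polys_0_const:
  fixes p :: "'a::comm_ring_1 mpoly"
  assumes "p \<in> polys 0" obtains c where "p = const_poly c"
proof -
  have "Poly_Mapping.keys p \<subseteq> {0}"
    using assms by (auto simp: polys_def simp flip: keys_eq_empty)
  then have "p = const_poly (Poly_Mapping.lookup p 0)"
    by (intro poly_mapping_eqI) (auto simp: const_poly_def lookup_single when_def in_keys_iff)
  then show ?thesis by (rule that)
qed

text \<open>
  The constants and the variables generate the polynomial ring, so it suffices to check a property
  that is closed under sums and products, such as the agreement of two homomorphisms, on them.
\<close>

lemma polys_induct [consumes 1, case_names const var add mult]:
  fixes p :: "'a::comm_ring_1 mpoly"
  assumes "p \<in> polys n"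
    and const: "\<And>c. Q (const_poly c)"
    and var: "\<And>i. i < n \<Longrightarrow> Q (var i)"
    and add: "\<And>p q. p \<in> polys n \<Longrightarrow> q \<in> polys n \<Longrightarrow> Q p \<Longrightarrow> Q q \<Longrightarrow> Q (p + q)"
    and mult: "\<And>p q. p \<in> polys n \<Longrightarrow> q \<in> polys n \<Longrightarrow> Q p \<Longrightarrow> Q q \<Longrightarrow> Q (p * q)"
  shows "Q p"
proof -
  define S where "S = {p \<in> polys n. Q p}"
  have S: "const_poly c \<in> S" "p \<in> S \<Longrightarrow> q \<in> S \<Longrightarrow> p + q \<in> S" "p \<in> S \<Longrightarrow> q \<in> S \<Longrightarrow> p * q \<in> S"
    "i < n \<Longrightarrow> var i \<in> S" for c p q i
    unfolding S_def using var_in_polys by (auto intro: const var add mult)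
  have 0: "0 \<in> S" and 1: "1 \<in> S"
    using S(1)[of 0] S(1)[of 1] by simp_all
  have pow: "p ^ k \<in> S" if "p \<in> S" for p k
    by (induction k) (use that S 1 in auto)
  have prod: "prod f A \<in> S" if "\<And>i. i \<in> A \<Longrightarrow> f i \<in> S" for f :: "nat \<Rightarrow> 'a mpoly" and A
    using that by (induction A rule: infinite_finite_induct) (use S 1 in auto)
  have sum: "sum f A \<in> S" if "\<And>i. i \<in> A \<Longrightarrow> f i \<in> S" for f :: "(nat \<Rightarrow>\<^sub>0 nat) \<Rightarrow> 'a mpoly" and A
    using that by (induction A rule: infinite_finite_induct) (use S 0 in auto)
  have "(\<Sum>m\<in>Poly_Mapping.keys p. Poly_Mapping.single m (Poly_Mapping.lookup p m)) \<in> S"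
    unfolding monomial_eq_prod_vars
    using assms(1) by (intro sum S prod pow) (auto simp: polys_def)
  then show ?thesis
    unfolding S_def using mpoly_eq_sum_monomials[of p] by simp
qed

lemma mpoly_in_polys: obtains n where "(p :: 'a::comm_ring_1 mpoly) \<in> polys n"
proof -
  have "finite (\<Union>m\<in>Poly_Mapping.keys p. Poly_Mapping.keys m)"
    by simp
  then obtain n where "\<forall>i\<in>(\<Union>m\<in>Poly_Mapping.keys p. Poly_Mapping.keys m). i < n"
    unfolding finite_nat_set_iff_bounded by blast
  then have "p \<in> polys n"
    by (auto simp: polys_def)
  then show ?thesis by (rule that)
qed

lemma mpoly_induct [case_names const var add mult]:
  fixes p :: "'a::comm_ring_1 mpoly"
  assumes "\<And>c. Q (const_poly c)" "\<And>i. Q (var i)"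
    and "\<And>p q. Q p \<Longrightarrow> Q q \<Longrightarrow> Q (p + q)" "\<And>p q. Q p \<Longrightarrow> Q q \<Longrightarrow> Q (p * q)"
  shows "Q p"
proof -
  obtain n where "p \<in> polys n" by (rule mpoly_in_polys)
  then show ?thesis
    by (induction p rule: polys_induct) (use assms in auto)
qed

definition ring_map :: "('a::comm_ring_1 \<Rightarrow> 'b::comm_ring_1) \<Rightarrow> bool" where
  "ring_map f \<longleftrightarrow> f 1 = 1 \<and> (\<forall>a b. f (a + b) = f a + f b) \<and> (\<forall>a b. f (a * b) = f a * f b)"

lemma ring_mapD:
  assumes "ring_map f"
  shows "f 1 = 1" "f (a + b) = f a + f b" "f (a * b) = f a * f b" "f 0 = 0"
    "f (a - b) = f a - f b" "f (- a) = - f a" "f (a ^ k) = f a ^ k"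
    "f (sum g A) = (\<Sum>x\<in>A. f (g x))" "f (prod g A) = (\<Prod>x\<in>A. f (g x))"
proof -
  show 1: "f 1 = 1" and add: "\<And>a b. f (a + b) = f a + f b" and mult: "\<And>a b. f (a * b) = f a * f b"
    using assms by (auto simp: ring_map_def)
  show 0: "f 0 = 0"
    using add[of 0 0] by simp
  show "f (a - b) = f a - f b"
    using add[of "a - b" b] by simp
  show "f (- a) = - f a"
    using add[of "- a" a] 0 by (simp add: eq_neg_iff_add_eq_0)
  show "f (a ^ k) = f a ^ k"
    by (induction k) (simp_all add: 1 mult)
  show "f (sum g A) = (\<Sum>x\<in>A. f (g x))"
    by (induction A rule: infinite_finite_induct) (simp_all add: 0 add)
  show "f (prod g A) = (\<Prod>x\<in>A. f (g x))"
    by (induction A rule: infinite_finite_induct) (simp_all add: 1 mult)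
qed

text \<open>
  The universal property of the polynomial ring: the homomorphism that is \<open>\<phi>\<close> on the coefficients
  and sends \<open>x\<^sub>i\<close> to \<open>x i\<close>.  Evaluation at integer points, the embedding of the
  integer into the rational polynomials and the isolation of one variable are all of this form.
\<close>

definition ext_hom :: "('a::comm_ring_1 \<Rightarrow> 'b::comm_ring_1) \<Rightarrow> (nat \<Rightarrow> 'b) \<Rightarrow> 'a mpoly \<Rightarrow> 'b" where
  "ext_hom \<phi> x P =
     (\<Sum>m \<in> Poly_Mapping.keys P.
        \<phi> (Poly_Mapping.lookup P m) * (\<Prod>i \<in> Poly_Mapping.keys m. x i ^ Poly_Mapping.lookup m i))"

context
  fixes \<phi> :: "'a::comm_ring_1 \<Rightarrow> 'b::comm_ring_1" and x :: "nat \<Rightarrow> 'b"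
  assumes \<phi>: "ring_map \<phi>"
begin

lemma ext_hom_single:
  "ext_hom \<phi> x (Poly_Mapping.single m c) = \<phi> c * (\<Prod>i \<in> Poly_Mapping.keys m. x i ^ Poly_Mapping.lookup m i)"
  by (cases "c = 0") (simp_all add: ext_hom_def ring_mapD[OF \<phi>])

lemma ext_hom_const: "ext_hom \<phi> x (const_poly c) = \<phi> c"
  by (simp add: const_poly_def ext_hom_single)

lemma ext_hom_var: "ext_hom \<phi> x (var i) = x i"
  by (simp add: var_def ext_hom_single ring_mapD[OF \<phi>])

lemma ext_hom_add: "ext_hom \<phi> x (p + q) = ext_hom \<phi> x p + ext_hom \<phi> x q"
  unfolding ext_hom_def
  by (subst setsum_keys_plus_distrib[where p = p and q = q and
        f = "\<lambda>m c. \<phi> c * (\<Prod>i \<in> Poly_Mapping.keys m. x i ^ Poly_Mapping.lookup m i)"])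
     (simp_all add: ring_mapD[OF \<phi>] algebra_simps)

lemma ext_hom_sum: "ext_hom \<phi> x (sum f A) = (\<Sum>a\<in>A. ext_hom \<phi> x (f a))"
proof (induction A rule: infinite_finite_induct)
qed (simp_all add: ext_hom_add, simp_all add: ext_hom_def)

lemma ext_hom_mult: "ext_hom \<phi> x (p * q) = ext_hom \<phi> x p * ext_hom \<phi> x q"
proof -
  let ?mon = "\<lambda>m. \<Prod>i \<in> Poly_Mapping.keys m. x i ^ Poly_Mapping.lookup m i"
  have mon: "?mon m = (\<Prod>i \<in> A. x i ^ Poly_Mapping.lookup m i)" if "finite A" "Poly_Mapping.keys m \<subseteq> A" for m A
    using that by (intro prod.mono_neutral_left) (auto simp: in_keys_iff)
  have mon_add: "?mon (m + m') = ?mon m * ?mon m'" for m m'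
    using keys_add[of m m']
    by (subst (1 2 3) mon[of "Poly_Mapping.keys m \<union> Poly_Mapping.keys m'"])
       (auto simp: lookup_add power_add prod.distrib)
  have single: "ext_hom \<phi> x (Poly_Mapping.single m c * Poly_Mapping.single m' c') =
      ext_hom \<phi> x (Poly_Mapping.single m c) * ext_hom \<phi> x (Poly_Mapping.single m' c')" for m c m' c'
    by (simp add: mult_single ext_hom_single mon_add ring_mapD[OF \<phi>] mult_ac)
  show ?thesis
  proof -
    let ?s = "\<lambda>p. \<Sum>m\<in>Poly_Mapping.keys p. Poly_Mapping.single m (Poly_Mapping.lookup p m)"
    have "ext_hom \<phi> x (?s p * ?s q) = ext_hom \<phi> x (?s p) * ext_hom \<phi> x (?s q)"
      by (simp add: ext_hom_sum sum_product single)
    then show ?thesis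
      by (simp only: mpoly_eq_sum_monomials[symmetric])
  qed
qed

lemma ring_map_ext_hom: "ring_map (ext_hom \<phi> x)"
proof -
  have "ext_hom \<phi> x 1 = 1"
    using ext_hom_const[of 1] by (simp add: ring_mapD[OF \<phi>])
  then show ?thesis
    by (auto simp: ring_map_def ext_hom_add ext_hom_mult)
qed

end

lemma ring_map_eqI:
  fixes p :: "'a::comm_ring_1 mpoly"
  assumes "ring_map f" "ring_map g" "p \<in> polys n"
    "\<And>c. f (const_poly c) = g (const_poly c)" "\<And>i. i < n \<Longrightarrow> f (var i) = g (var i)"
  shows "f p = g p"
  using assms(3) by (induction p rule: polys_induct) (simp_all add: assms ring_mapD[OF assms(1)] ring_mapD[OF assms(2)])

lemma ring_map_eqI_all:
  fixes p :: "'a::comm_ring_1 mpoly"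
  assumes "ring_map f" "ring_map g"
    "\<And>c. f (const_poly c) = g (const_poly c)" "\<And>i. f (var i) = g (var i)"
  shows "f p = g p"
  by (induction p rule: mpoly_induct) (simp_all add: assms ring_mapD[OF assms(1)] ring_mapD[OF assms(2)])

lemma ring_map_id: "ring_map (\<lambda>x. x)"
  by (simp add: ring_map_def)

lemma ring_map_comp: "ring_map f \<Longrightarrow> ring_map g \<Longrightarrow> ring_map (\<lambda>x. f (g x))"
  by (simp add: ring_map_def)

lemma eval_poly_eq_ext_hom: "eval_poly P x = ext_hom (\<lambda>c. c) x P"
  by (simp add: eval_poly_def ext_hom_def)

lemma ring_map_eval_poly: "ring_map (\<lambda>P. eval_poly P x)"
  unfolding eval_poly_eq_ext_hom by (rule ring_map_ext_hom[OF ring_map_id])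

lemma eval_poly_const [simp]: "eval_poly (const_poly c :: 'a::comm_ring_1 mpoly) x = c"
  and eval_poly_var [simp]: "eval_poly (var i :: 'a::comm_ring_1 mpoly) x = x i"
  by (simp_all add: eval_poly_eq_ext_hom ext_hom_const ext_hom_var ring_map_id)

lemmas eval_poly_simps [simp] = ring_mapD[OF ring_map_eval_poly]

lemma eval_poly_cong:
  assumes "P \<in> polys n" "\<And>i. i < n \<Longrightarrow> x i = y i"
  shows "eval_poly P x = eval_poly P y"
  unfolding eval_poly_def
proof (intro sum.cong prod.cong arg_cong2[where f = "(*)"] refl)
  fix m i assume "m \<in> Poly_Mapping.keys P" "i \<in> Poly_Mapping.keys m"
  then have "i < n"
    using assms(1) by (auto simp: polys_def)
  then show "x i ^ Poly_Mapping.lookup m i = y i ^ Poly_Mapping.lookup m i"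
    by (simp add: assms(2))
qed

lemma lookup_rat_poly [simp]: "Poly_Mapping.lookup (rat_poly p) m = rat_of_int (Poly_Mapping.lookup p m)"
  unfolding rat_poly_def by transfer (simp add: when_def)

lemma keys_rat_poly [simp]: "Poly_Mapping.keys (rat_poly p) = Poly_Mapping.keys p"
  by (auto simp: in_keys_iff)

lemma ring_map_rat_poly: "ring_map rat_poly"
proof -
  have "rat_poly p = ext_hom (\<lambda>c. const_poly (rat_of_int c)) var p" for p
    by (subst mpoly_eq_sum_monomials) (simp add: monomial_eq_prod_vars ext_hom_def)
  moreover have "ring_map (\<lambda>c. const_poly (rat_of_int c))"
    by (simp add: ring_map_def)
  ultimately show ?thesis
    using ring_map_ext_hom[of "\<lambda>c. const_poly (rat_of_int c)" var] by (simp add: ring_map_def)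
qed

lemmas rat_poly_simps [simp] = ring_mapD[OF ring_map_rat_poly]

lemma rat_poly_in_polys_iff [simp]: "rat_poly p \<in> polys n \<longleftrightarrow> p \<in> polys n"
  by (simp add: polys_def)

lemma rat_poly_eq_iff [simp]: "rat_poly p = rat_poly q \<longleftrightarrow> p = q"
  by (auto simp: poly_mapping_eq_iff fun_eq_iff)

lemma rat_poly_eq_0_iff [simp]: "rat_poly p = 0 \<longleftrightarrow> p = 0"
  using rat_poly_eq_iff[of p 0] by simp

lemma rat_poly_const [simp]: "rat_poly (const_poly c) = const_poly (rat_of_int c)"
  by (rule poly_mapping_eqI) (simp add: const_poly_def lookup_single when_def del: single_of_int)

lemma rat_poly_var [simp]: "rat_poly (var i) = var i"
  by (rule poly_mapping_eqI) (simp add: var_def lookup_single when_def)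

text \<open>
  A polynomial seen as a univariate one in \<open>x\<^sub>n\<close> over the polynomials in the other variables.
  On \<open>polys (Suc n)\<close> this is the isomorphism with \<open>(polys n)[x\<^sub>n]\<close>, with inverse
  \<open>\<lambda>q. poly q (var n)\<close>; it makes the univariate theory available and carries the inductions on
  the number of variables.
\<close>

definition uni :: "nat \<Rightarrow> 'a::comm_ring_1 mpoly \<Rightarrow> 'a mpoly poly" where
  "uni n = ext_hom (\<lambda>c. [:const_poly c:]) (\<lambda>j. if j = n then [:0, 1:] else [:var j:])"

lemma ring_map_uni: "ring_map (uni n)"
  unfolding uni_def by (rule ring_map_ext_hom) (simp add: ring_map_def one_pCons)

lemmas uni_simps [simp] = ring_mapD[OF ring_map_uni]

lemma uni_const [simp]: "uni n (const_poly c) = [:const_poly c:]"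
  unfolding uni_def by (rule ext_hom_const) (simp add: ring_map_def one_pCons)

lemma uni_var: "uni n (var i) = (if i = n then [:0, 1:] else [:var i:])"
  unfolding uni_def by (rule ext_hom_var) (simp add: ring_map_def one_pCons)

lemma ring_map_poly: "ring_map (\<lambda>p. poly p x)"
  by (simp add: ring_map_def)

lemma poly_uni [simp]: "poly (uni n p) (var n) = p"
  by (rule ring_map_eqI_all[OF ring_map_comp[OF ring_map_poly ring_map_uni] ring_map_id])
     (simp_all add: uni_var)

lemma uni_eq_iff [simp]: "uni n p = uni n q \<longleftrightarrow> p = q"
  by (metis poly_uni)

lemma uni_eq_0_iff [simp]: "uni n p = 0 \<longleftrightarrow> p = 0"
  using uni_eq_iff[of n p 0] by simp

lemma uni_of_polys:
  assumes "p \<in> polys n" shows "uni n p = [:p:]"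
  by (rule ring_map_eqI[OF ring_map_uni _ assms]) (simp_all add: ring_map_def one_pCons uni_var)

lemma coeff_uni_in_polys:
  assumes "p \<in> polys (Suc n)" shows "coeff (uni n p) i \<in> polys n"
  using assms
proof (induction p arbitrary: i rule: polys_induct)
  case (var j)
  then show ?case
    by (auto simp: uni_var coeff_pCons var_in_polys split: nat.splits)
qed (auto simp: coeff_mult coeff_pCons split: nat.splits)

lemma poly_in_polys:
  fixes q :: "'a::comm_ring_1 mpoly poly"
  assumes "\<And>i. coeff q i \<in> polys n" shows "poly q (var n) \<in> polys (Suc n)"
proof -
  have "coeff q i * var n ^ i \<in> polys (Suc n)" for i
  proof -
    have "(var n :: 'a mpoly) ^ i \<in> polys (Suc n)"
      by (induction i) (auto simp: var_in_polys)
    moreover have "coeff q i \<in> polys (Suc n)"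
      using assms[of i] polys_mono[of n "Suc n"] by auto
    ultimately show ?thesis by simp
  qed
  then show ?thesis
    by (simp add: poly_altdef)
qed

lemma uni_poly:
  fixes q :: "'a::comm_ring_1 mpoly poly"
  assumes "\<And>i. coeff q i \<in> polys n" shows "uni n (poly q (var n)) = q"
proof -
  have "uni n (poly q (var n)) = (\<Sum>i\<le>degree q. [:coeff q i:] * [:0, 1:] ^ i)"
    by (simp add: poly_altdef uni_var uni_of_polys[OF assms])
  also have "\<dots> = q"
    by (subst (4) poly_as_sum_of_monoms[symmetric]) (simp add: monom_altdef)
  finally show ?thesis .
qed

lemma eval_poly_uni:
  fixes p :: "'a::comm_ring_1 mpoly"
  assumes "p \<in> polys (Suc n)"
  shows "eval_poly p x = poly (map_poly (\<lambda>c. eval_poly c x) (uni n p)) (x n)"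
proof -
  have "eval_poly p x = eval_poly (poly (uni n p) (var n)) x"
    by simp
  also have "\<dots> = (\<Sum>i\<le>degree (uni n p). eval_poly (coeff (uni n p) i) x * x n ^ i)"
    by (simp add: poly_altdef del: poly_uni)
  also have "\<dots> = poly (map_poly (\<lambda>c. eval_poly c x) (uni n p)) (x n)"
  proof -
    let ?q = "map_poly (\<lambda>c. eval_poly c x) (uni n p)"
    have "(\<Sum>i\<le>degree (uni n p). eval_poly (coeff (uni n p) i) x * x n ^ i) =
        (\<Sum>i\<le>degree ?q. coeff ?q i * x n ^ i)"
    proof (rule sum.mono_neutral_cong_right)
      show "{..degree ?q} \<subseteq> {..degree (uni n p)}"
        using map_poly_degree_leq[of "\<lambda>c. eval_poly c x" "uni n p"] by simp
      show "\<forall>i\<in>{..degree (uni n p)} - {..degree ?q}. eval_poly (coeff (uni n p) i) x * x n ^ i = 0"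
      proof
        fix i assume "i \<in> {..degree (uni n p)} - {..degree ?q}"
        then have "coeff ?q i = 0"
          by (intro coeff_eq_0) auto
        then show "eval_poly (coeff (uni n p) i) x * x n ^ i = 0"
          by (simp add: coeff_map_poly)
      qed
    qed (simp_all add: coeff_map_poly)
    then show ?thesis
      by (simp add: poly_altdef)
  qed
  finally show ?thesis .
qed

section \<open>Gauss: polynomials over a factorial ring form a factorial ring\<close>

definition coeffs_in :: "'a::zero set \<Rightarrow> 'a poly set" where
  "coeffs_in R = {p. \<forall>i. coeff p i \<in> R}"

text \<open>
  The rings \<open>polys n\<close> for varying \<open>n\<close> are subrings of a single type, and \<open>n\<close> varies inside the
  inductions below.  Divisibility and primality are therefore relative to a subring.
\<close>

locale idom_subring =
  fixes R :: "'a::idom set"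
  assumes one_in [simp]: "1 \<in> R"
    and diff_in [simp]: "a \<in> R \<Longrightarrow> b \<in> R \<Longrightarrow> a - b \<in> R"
    and mult_in [simp]: "a \<in> R \<Longrightarrow> b \<in> R \<Longrightarrow> a * b \<in> R"
begin

definition dvd_in :: "'a \<Rightarrow> 'a \<Rightarrow> bool" where
  "dvd_in a b \<longleftrightarrow> (\<exists>c\<in>R. b = a * c)"

definition prime_in :: "'a \<Rightarrow> bool" where
  "prime_in p \<longleftrightarrow> p \<in> R \<and> p \<noteq> 0 \<and> \<not> dvd_in p 1 \<and>
     (\<forall>a\<in>R. \<forall>b\<in>R. dvd_in p (a * b) \<longrightarrow> dvd_in p a \<or> dvd_in p b)"

text \<open>
  A domain is factorial if and only if every nonzero element is a unit times a product of primes; the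
  uniqueness of the factorization is contained in the primality of the factors.
\<close>

inductive_set prime_products :: "'a set" where
  unit: "u \<in> R \<Longrightarrow> dvd_in u 1 \<Longrightarrow> u \<in> prime_products"
| mult: "prime_in p \<Longrightarrow> a \<in> prime_products \<Longrightarrow> p * a \<in> prime_products"

definition factorial :: bool where
  "factorial \<longleftrightarrow> R - {0} \<subseteq> prime_products"

lemma zero_in [simp]: "0 \<in> R"
  using diff_in[of 1 1] by simp

lemma uminus_in [simp]: "a \<in> R \<Longrightarrow> - a \<in> R"
  using diff_in[of 0 a] by simp

lemma add_in [simp]: "a \<in> R \<Longrightarrow> b \<in> R \<Longrightarrow> a + b \<in> R"
  using diff_in[of a "- b"] by simp

lemma sum_in [simp]: "(\<And>i. i \<in> A \<Longrightarrow> f i \<in> R) \<Longrightarrow> sum f A \<in> R"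
  by (induction A rule: infinite_finite_induct) auto

lemma dvd_inI: "c \<in> R \<Longrightarrow> b = a * c \<Longrightarrow> dvd_in a b"
  by (auto simp: dvd_in_def)

lemma dvd_in_refl: "dvd_in a a"
  by (rule dvd_inI[of 1]) auto

lemma dvd_in_mult: "dvd_in a b \<Longrightarrow> c \<in> R \<Longrightarrow> dvd_in a (b * c)"
  unfolding dvd_in_def by (metis mult.assoc mult_in)

lemma dvd_in_add: "dvd_in a b \<Longrightarrow> dvd_in a c \<Longrightarrow> dvd_in a (b + c)"
  unfolding dvd_in_def by (metis distrib_left add_in)

lemma dvd_in_diff: "dvd_in a b \<Longrightarrow> dvd_in a c \<Longrightarrow> dvd_in a (b - c)"
  unfolding dvd_in_def by (metis right_diff_distrib diff_in)

lemma dvd_in_sum: "(\<And>i. i \<in> A \<Longrightarrow> dvd_in a (f i)) \<Longrightarrow> dvd_in a (sum f A)"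
proof (induction A rule: infinite_finite_induct)
  case (insert x F)
  then show ?case by (auto intro: dvd_in_add)
qed (auto intro: dvd_inI[of 0])

lemma prime_in_dvd_mult:
  assumes "prime_in p" "dvd_in p (a * b)" "a \<in> R" "b \<in> R"
  obtains "dvd_in p a" | "dvd_in p b"
  using assms by (auto simp: prime_in_def)

lemma prime_products_subset: "prime_products \<subseteq> R - {0}"
proof
  fix a assume "a \<in> prime_products"
  then show "a \<in> R - {0}"
    by induction (auto simp: prime_in_def dvd_in_def)
qed

lemma factorial_iff: "factorial \<longleftrightarrow> prime_products = R - {0}"
  using prime_products_subset by (auto simp: factorial_def)

lemma prime_products_mult:
  assumes "a \<in> prime_products" "b \<in> prime_products"
  shows "a * b \<in> prime_products"
  using assms(1)
proof induction
  case (unit u)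
  then obtain v where v: "v \<in> R" "u * v = 1"
    by (auto simp: dvd_in_def)
  from assms(2) unit show ?case
  proof (induction b)
    case (unit w)
    then obtain z where z: "z \<in> R" "w * z = 1"
      by (auto simp: dvd_in_def)
    have "u * w * (v * z) = (u * v) * (w * z)"
      by (simp add: ac_simps)
    then have "u * w * (v * z) = 1"
      using v z by simp
    then have "dvd_in (u * w) 1"
      using v z by (intro dvd_inI[of "v * z"]) auto
    then show ?case
      using unit by (intro prime_products.unit) auto
  next
    case (mult p a)
    then show ?case
      using prime_products.mult[of p "u * a"] by (simp add: ac_simps)
  qed
next
  case (mult p a)
  then show ?case
    using prime_products.mult[of p "a * b"] by (simp add: ac_simps)
qed

lemma coeffs_in_subring: "idom_subring (coeffs_in R)"
proof
  show "1 \<in> coeffs_in R"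
    by (auto simp: coeffs_in_def coeff_pCons one_pCons split: nat.splits)
next
  fix a b assume "a \<in> coeffs_in R" "b \<in> coeffs_in R"
  then show "a - b \<in> coeffs_in R" "a * b \<in> coeffs_in R"
    by (auto simp: coeffs_in_def coeff_mult)
qed

interpretation P: idom_subring "coeffs_in R"
  by (rule coeffs_in_subring)

lemma coeffs_inD: "f \<in> coeffs_in R \<Longrightarrow> coeff f i \<in> R"
  by (simp add: coeffs_in_def)

lemma const_in_coeffs_in [simp]: "[:a:] \<in> coeffs_in R \<longleftrightarrow> a \<in> R"
  by (auto simp: coeffs_in_def coeff_pCons split: nat.splits intro: spec[of _ 0])

lemma smult_in_coeffs_in [simp]: "a \<in> R \<Longrightarrow> f \<in> coeffs_in R \<Longrightarrow> smult a f \<in> coeffs_in R"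
  by (simp add: coeffs_in_def)

lemma monom_in_coeffs_in [simp]: "a \<in> R \<Longrightarrow> monom a k \<in> coeffs_in R"
  by (simp add: coeffs_in_def)

lemma const_dvd_in_iff:
  assumes f: "f \<in> coeffs_in R"
  shows "P.dvd_in [:a:] f \<longleftrightarrow> (\<forall>i. dvd_in a (coeff f i))"
proof
  assume "P.dvd_in [:a:] f"
  then show "\<forall>i. dvd_in a (coeff f i)"
    unfolding P.dvd_in_def dvd_in_def using coeffs_inD by fastforce
next
  assume "\<forall>i. dvd_in a (coeff f i)"
  then obtain c where c: "\<And>i. c i \<in> R" "\<And>i. coeff f i = a * c i"
    unfolding dvd_in_def by metis
  define g where "g = Poly (map c [0..<Suc (degree f)])"
  have g: "coeff g i = (if i \<le> degree f then c i else 0)" for i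
    by (auto simp: g_def nth_default_def simp del: upt_Suc)
  have "f = [:a:] * g"
    by (rule poly_eqI) (auto simp: g c(2)[symmetric] coeff_eq_0)
  moreover have "g \<in> coeffs_in R"
    by (auto simp: coeffs_in_def g c)
  ultimately show "P.dvd_in [:a:] f"
    by (rule P.dvd_inI[rotated])
qed

text \<open>
  Gauss's lemma: if a prime \<open>p\<close> divides neither \<open>f\<close> nor \<open>g\<close>, take the first coefficients, in degrees
  \<open>i\<close> and \<open>j\<close>, that it does not divide; then it does not divide the coefficient of \<open>f * g\<close>
  in degree \<open>i + j\<close>.
\<close>

lemma prime_in_const:
  assumes p: "prime_in p" shows "P.prime_in [:p:]"
proof -
  have not_unit: "\<not> P.dvd_in [:p:] 1"
    using p by (force simp: const_dvd_in_iff prime_in_def dest: spec[of _ 0])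
  have "P.dvd_in [:p:] f \<or> P.dvd_in [:p:] g"
    if f: "f \<in> coeffs_in R" and g: "g \<in> coeffs_in R" and fg: "P.dvd_in [:p:] (f * g)" for f g
  proof (rule ccontr)
    assume "\<not> (P.dvd_in [:p:] f \<or> P.dvd_in [:p:] g)"
    then have ex: "\<exists>i. \<not> dvd_in p (coeff f i)" "\<exists>j. \<not> dvd_in p (coeff g j)"
      using f g by (auto simp: const_dvd_in_iff)
    define i where "i = (LEAST i. \<not> dvd_in p (coeff f i))"
    define j where "j = (LEAST j. \<not> dvd_in p (coeff g j))"
    have i: "\<not> dvd_in p (coeff f i)" "\<And>k. k < i \<Longrightarrow> dvd_in p (coeff f k)"
      using LeastI_ex[OF ex(1)] not_less_Least unfolding i_def by blast+
    have j: "\<not> dvd_in p (coeff g j)" "\<And>k. k < j \<Longrightarrow> dvd_in p (coeff g k)"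
      using LeastI_ex[OF ex(2)] not_less_Least unfolding j_def by blast+
    \<comment> \<open>in the coefficient of degree \<open>i + j\<close> all other terms are divisible by \<open>p\<close>\<close>
    have "coeff (f * g) (i + j) = (\<Sum>k\<le>i+j. coeff f k * coeff g (i + j - k))"
      by (rule coeff_mult)
    also have "\<dots> = coeff f i * coeff g j + (\<Sum>k\<in>{..i+j}-{i}. coeff f k * coeff g (i + j - k))"
      by (subst sum.remove[of _ i]) auto
    finally have eq: "coeff f i * coeff g j =
        coeff (f * g) (i + j) - (\<Sum>k\<in>{..i+j}-{i}. coeff f k * coeff g (i + j - k))"
      by simp
    have "dvd_in p (coeff f k * coeff g (i + j - k))" if "k \<in> {..i+j}-{i}" for k
    proof (cases "k < i")
      case True
      then show ?thesis
        using i(2) g by (intro dvd_in_mult) (auto simp: coeffs_inD)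
    next
      case False
      then have "i + j - k < j"
        using that by auto
      then show ?thesis
        using j(2) f by (subst mult.commute, intro dvd_in_mult) (auto simp: coeffs_inD)
    qed
    moreover have "dvd_in p (coeff (f * g) (i + j))"
      using fg f g by (simp add: const_dvd_in_iff)
    ultimately have "dvd_in p (coeff f i * coeff g j)"
      unfolding eq by (intro dvd_in_diff dvd_in_sum)
    then show False
      using p i(1) j(1) f g by (meson prime_in_dvd_mult coeffs_inD)
  qed
  then show ?thesis
    using p not_unit by (auto simp: P.prime_in_def prime_in_def)
qed

lemma prime_products_const:
  assumes "a \<in> prime_products" shows "[:a:] \<in> P.prime_products"
  using assms
proof induction
  case (unit u)
  then obtain v where "v \<in> R" "u * v = 1"
    by (auto simp: dvd_in_def)
  then have "P.dvd_in [:u:] 1"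
    by (intro P.dvd_inI[of "[:v:]"]) (auto simp: one_pCons mult.commute)
  then show ?case
    using unit by (intro P.prime_products.unit) auto
next
  case (mult p a)
  then show ?case
    using P.prime_products.mult[of "[:p:]" "[:a:]"] prime_in_const[of p] by (simp add: mult.commute)
qed

lemma pseudo_division:
  assumes g: "g \<in> coeffs_in R" "g \<noteq> 0" and "f \<in> coeffs_in R"
  shows "\<exists>c q r. c \<in> R \<and> c \<noteq> 0 \<and> q \<in> coeffs_in R \<and> r \<in> coeffs_in R \<and>
    smult c f = g * q + r \<and> (r = 0 \<or> degree r < degree g)"
  using assms(3)
proof (induction "degree f" arbitrary: f rule: less_induct)
  case less
  show ?case
  proof (cases "f = 0 \<or> degree f < degree g")
    case True
    then show ?thesis
      using less by (intro exI[of _ 1] exI[of _ 0] exI[of _ f]) auto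
  next
    case False
    define t where "t = monom (lead_coeff f) (degree f - degree g)"
    define f' where "f' = smult (lead_coeff g) f - g * t"
    have t: "t \<in> coeffs_in R" and f': "f' \<in> coeffs_in R"
      using less(2) g(1) by (auto simp: t_def f'_def coeffs_inD)
    have deg_t: "degree (g * t) = degree f"
      using False g by (subst degree_mult_eq) (auto simp: t_def degree_monom_eq)
    have step: "smult (lead_coeff g) f = g * t + f'"
      by (simp add: f'_def)
    show ?thesis
    proof (cases "f' = 0")
      case True
      then show ?thesis
        using step t g by (intro exI[of _ "lead_coeff g"] exI[of _ t] exI[of _ 0]) (auto simp: coeffs_inD)
    next
      case f'0: False
      have "degree f' \<le> degree f"
        unfolding f'_def using deg_t by (intro degree_diff_le) auto
      moreover have "coeff f' (degree f) = 0"
        using False g deg_t lead_coeff_mult[of g t]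
        by (simp add: f'_def t_def degree_monom_eq)
      ultimately have "degree f' < degree f"
        using f'0 by (metis le_neq_implies_less leading_coeff_0_iff)
      from less(1)[OF this f'] obtain c q r where
        IH: "c \<in> R" "c \<noteq> 0" "q \<in> coeffs_in R" "r \<in> coeffs_in R" "smult c f' = g * q + r"
          "r = 0 \<or> degree r < degree g"
        by blast
      have "smult (c * lead_coeff g) f = smult c (g * t + f')"
        by (simp flip: step)
      also have "\<dots> = g * (smult c t + q) + r"
        by (simp add: IH(5) smult_add_right algebra_simps)
      finally show ?thesis
        using IH t g by (intro exI[of _ "c * lead_coeff g"] exI[of _ "smult c t + q"] exI[of _ r])
          (auto simp: coeffs_inD)
    qed
  qed
qed

text \<open>
  Over the field of fractions the ideal is principal.  Without fractions, an element of least degree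
  still divides every element up to a nonzero constant factor, since the remainder of the
  pseudo-division lies in the ideal and has smaller degree.
\<close>

lemma ideal_pseudo_generator:
  assumes I: "I \<subseteq> coeffs_in R" "f0 \<in> I" "f0 \<noteq> 0"
    and diff: "\<And>f g. f \<in> I \<Longrightarrow> g \<in> I \<Longrightarrow> f - g \<in> I"
    and mult: "\<And>f g. f \<in> coeffs_in R \<Longrightarrow> g \<in> I \<Longrightarrow> f * g \<in> I"
  obtains g where "g \<in> I" "g \<noteq> 0"
    "\<And>f. f \<in> I \<Longrightarrow> \<exists>c q. c \<in> R \<and> c \<noteq> 0 \<and> q \<in> coeffs_in R \<and> smult c f = g * q"
proof -
  have "f0 \<in> I \<and> f0 \<noteq> 0"
    using I by simp
  from ex_has_least_nat[of "\<lambda>g. g \<in> I \<and> g \<noteq> 0", OF this, of degree]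
  obtain g where gI: "g \<in> I" "g \<noteq> 0" and min: "\<And>h. h \<in> I \<Longrightarrow> h \<noteq> 0 \<Longrightarrow> degree g \<le> degree h"
    by blast
  show ?thesis
  proof (rule that[OF gI])
    fix f assume f: "f \<in> I"
    have "g \<in> coeffs_in R" "f \<in> coeffs_in R"
      using gI(1) f I(1) by (meson subsetD)+
    from pseudo_division[OF this(1) gI(2) this(2)]
    obtain c q r where cqr: "c \<in> R" "c \<noteq> 0" "q \<in> coeffs_in R" "r \<in> coeffs_in R"
        "smult c f = g * q + r" "r = 0 \<or> degree r < degree g"
      by (elim exE conjE) (rule that)
    have "r = [:c:] * f - q * g"
      using cqr(5) by (simp add: algebra_simps)
    moreover have "[:c:] * f \<in> I" "q * g \<in> I"
      using cqr(1,3) f gI(1) by (intro mult; simp)+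
    ultimately have "r \<in> I"
      using diff by simp
    then have "r = 0"
      using cqr(6) min[of r] by (cases "r = 0") auto
    then show "\<exists>c q. c \<in> R \<and> c \<noteq> 0 \<and> q \<in> coeffs_in R \<and> smult c f = g * q"
      using cqr(1-3,5) by (intro exI[of _ c] exI[of _ q]) simp
  qed
qed

text \<open>
  By Gauss's lemma the prime factors of a constant that divides \<open>g * h\<close> can be cancelled one at
  a time, each against \<open>g\<close> or against \<open>h\<close>.
\<close>

lemma split_const_factor:
  assumes "c \<in> prime_products" "f \<in> coeffs_in R" "g \<in> coeffs_in R" "h \<in> coeffs_in R"
    and "smult c f = g * h"
  shows "\<exists>a b g' h'. a \<in> R \<and> b \<in> R \<and> g' \<in> coeffs_in R \<and> h' \<in> coeffs_in R \<and>
     f = g' * h' \<and> g = smult a g' \<and> h = smult b h'"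
  using assms
proof (induction c arbitrary: g h)
  case (unit u)
  then obtain v where v: "v \<in> R" "u * v = 1"
    by (auto simp: dvd_in_def)
  have "f = smult v (smult u f)"
    using v by (simp add: mult.commute)
  also have "\<dots> = smult v g * h"
    by (simp add: unit)
  finally show ?case
    using unit v
    by (intro exI[of _ u] exI[of _ 1] exI[of _ "smult v g"] exI[of _ h]) auto
next
  case (mult p c)
  have p: "P.prime_in [:p:]" "p \<noteq> 0" "p \<in> R"
    using mult prime_in_const by (auto simp: prime_in_def)
  have c: "c \<in> R"
    using mult prime_products_subset by auto
  have "P.dvd_in [:p:] (g * h)"
    using mult c by (intro P.dvd_inI[of "smult c f"]) (auto simp: mult.commute simp flip: mult.prems(4))
  then consider "P.dvd_in [:p:] g" | "P.dvd_in [:p:] h"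
    using P.prime_in_dvd_mult[OF p(1) _ mult.prems(2,3)] by blast
  then show ?case
  proof cases
    case 1
    then obtain k where k: "k \<in> coeffs_in R" "g = smult p k"
      by (auto simp: P.dvd_in_def)
    then have "smult p (smult c f) = smult p (k * h)"
      using mult by simp
    then have "smult c f = k * h"
      using p(2) by (simp only: smult_cancel)
    from mult.IH[OF mult.prems(1) k(1) mult.prems(3) this] obtain a b g' h' where
      "a \<in> R" "b \<in> R" "g' \<in> coeffs_in R" "h' \<in> coeffs_in R" "f = g' * h'" "k = smult a g'" "h = smult b h'"
      by blast
    then show ?thesis
      using k p by (intro exI[of _ "p * a"] exI[of _ b] exI[of _ g'] exI[of _ h']) auto
  next
    case 2
    then obtain k where k: "k \<in> coeffs_in R" "h = smult p k"
      by (auto simp: P.dvd_in_def)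
    then have "smult p (smult c f) = smult p (g * k)"
      using mult by simp
    then have "smult c f = g * k"
      using p(2) by (simp only: smult_cancel)
    from mult.IH[OF mult.prems(1,2) k(1) this] obtain a b g' h' where
      "a \<in> R" "b \<in> R" "g' \<in> coeffs_in R" "h' \<in> coeffs_in R" "f = g' * h'" "g = smult a g'" "k = smult b h'"
      by blast
    then show ?thesis
      using k p by (intro exI[of _ a] exI[of _ "p * b"] exI[of _ g'] exI[of _ h']) auto
  qed
qed

definition primitive :: "'a poly \<Rightarrow> bool" where
  "primitive f \<longleftrightarrow> (\<forall>p. prime_in p \<longrightarrow> \<not> P.dvd_in [:p:] f)"

lemma primitive_dvd_cancel:
  assumes "c \<in> prime_products" "primitive f" "f \<in> coeffs_in R" "g \<in> coeffs_in R"
    and "P.dvd_in f (smult c g)"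
  shows "P.dvd_in f g"
  using assms
proof (induction c arbitrary: g)
  case (unit u)
  then obtain v where v: "v \<in> R" "u * v = 1"
    by (auto simp: dvd_in_def)
  have "P.dvd_in f (smult u g * [:v:])"
    using unit v by (intro P.dvd_in_mult) auto
  then show ?case
    using v by (simp add: mult.commute)
next
  case (mult p c)
  have p: "P.prime_in [:p:]" "p \<noteq> 0" "p \<in> R"
    using mult prime_in_const by (auto simp: prime_in_def)
  have c: "c \<in> R"
    using mult prime_products_subset by auto
  obtain h where h: "h \<in> coeffs_in R" "smult (p * c) g = f * h"
    using mult.prems by (auto simp: P.dvd_in_def)
  have "P.dvd_in [:p:] (f * h)"
    using mult c by (intro P.dvd_inI[of "smult c g"]) (auto simp: mult.commute simp flip: h(2))
  then have "P.dvd_in [:p:] h"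
    using P.prime_in_dvd_mult[OF p(1) _ mult.prems(2) h(1)] mult by (auto simp: primitive_def)
  then obtain k where k: "k \<in> coeffs_in R" "h = smult p k"
    by (auto simp: P.dvd_in_def)
  then have "smult p (smult c g) = smult p (f * k)"
    using h by simp
  then have "smult c g = f * k"
    using p(2) by (simp only: smult_cancel)
  then have "P.dvd_in f (smult c g)"
    using k(1) by (rule P.dvd_inI[rotated])
  with mult.prems(1-3) show ?case
    by (rule mult.IH)
qed

text \<open>
  Let \<open>f\<close> divide \<open>g * h\<close>, and let \<open>e\<close> be an element of least degree of the ideal \<open>(f, g)\<close>.  Up to
  constants \<open>e\<close> is a factor of \<open>f\<close>, so it has the degree of \<open>f\<close> or is constant.  If it has
  the degree of \<open>f\<close>, then \<open>f\<close> divides a constant multiple of \<open>g\<close>; if \<open>e\<close> is constant, then \<open>e * h\<close>, a combination of \<open>f * h\<close> and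
  \<open>g * h\<close>, is divisible by \<open>f\<close>.  As \<open>f\<close> is primitive, the constants can be dropped.
\<close>

lemma prime_if_no_splitting:
  assumes fact: "factorial" and f: "f \<in> coeffs_in R" "primitive f" "0 < degree f"
    and no_split: "\<And>g h. g \<in> coeffs_in R \<Longrightarrow> h \<in> coeffs_in R \<Longrightarrow> f = g * h \<Longrightarrow> degree g = 0 \<or> degree h = 0"
  shows "P.prime_in f"
proof -
  have f0: "f \<noteq> 0"
    using f by auto
  have not_unit: "\<not> P.dvd_in f 1"
  proof
    assume "P.dvd_in f 1"
    then obtain g where "1 = f * g"
      by (auto simp: P.dvd_in_def)
    then show False
      using f degree_mult_eq[of f g] by (metis add_is_0 degree_1 mult_eq_0_iff not_gr_zero one_neq_zero)
  qed
  have "P.dvd_in f h"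
    if g: "g \<in> coeffs_in R" and h: "h \<in> coeffs_in R" and gh: "P.dvd_in f (g * h)" and ng: "\<not> P.dvd_in f g" for g h
  proof -
    define I where "I = {a * f + b * g | a b. a \<in> coeffs_in R \<and> b \<in> coeffs_in R}"
    have fI: "f \<in> I"
      unfolding I_def by (intro CollectI exI[of _ 1] exI[of _ 0]) auto
    have gI: "g \<in> I"
      unfolding I_def by (intro CollectI exI[of _ 0] exI[of _ 1]) auto
    obtain e where e: "e \<in> I" "e \<noteq> 0"
        "\<And>k. k \<in> I \<Longrightarrow> \<exists>c q. c \<in> R \<and> c \<noteq> 0 \<and> q \<in> coeffs_in R \<and> smult c k = e * q"
    proof (rule ideal_pseudo_generator[of I f])
      show "I \<subseteq> coeffs_in R"
        using f g by (auto simp: I_def)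
      show "u - v \<in> I" if uI: "u \<in> I" and vI: "v \<in> I" for u v
      proof -
        obtain a b where u: "u = a * f + b * g" "a \<in> coeffs_in R" "b \<in> coeffs_in R"
          using uI unfolding I_def by blast
        obtain a' b' where v: "v = a' * f + b' * g" "a' \<in> coeffs_in R" "b' \<in> coeffs_in R"
          using vI unfolding I_def by blast
        have "u - v = (a - a') * f + (b - b') * g"
          by (simp add: u v algebra_simps)
        with u(2,3) v(2,3) show ?thesis
          unfolding I_def by (intro CollectI exI[of _ "a - a'"] exI[of _ "b - b'"] conjI P.diff_in)
      qed
      show "u * v \<in> I" if uR: "u \<in> coeffs_in R" and vI: "v \<in> I" for u v
      proof -
        obtain a b where *: "v = a * f + b * g" "a \<in> coeffs_in R" "b \<in> coeffs_in R"
          using vI unfolding I_def by blast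
        have "u * v = (u * a) * f + (u * b) * g"
          by (simp add: * algebra_simps)
        with *(2,3) uR show ?thesis
          unfolding I_def by (intro CollectI exI[of _ "u * a"] exI[of _ "u * b"] conjI P.mult_in)
      qed
    qed (use fI f0 in auto)
    have eR: "e \<in> coeffs_in R"
      using e(1) f g by (auto simp: I_def)
    obtain c q where c: "c \<in> R" "c \<noteq> 0" "q \<in> coeffs_in R" "smult c f = e * q"
      using e(3)[OF fI] by blast
    obtain c2 q2 where c2: "c2 \<in> R" "c2 \<noteq> 0" "q2 \<in> coeffs_in R" "smult c2 g = e * q2"
      using e(3)[OF gI] by blast
    have cp: "c \<in> prime_products" "c2 \<in> prime_products"
      using c c2 fact by (auto simp: factorial_def)
    obtain a b e' q' where s: "a \<in> R" "b \<in> R" "e' \<in> coeffs_in R" "q' \<in> coeffs_in R"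
        "f = e' * q'" "e = smult a e'" "q = smult b q'"
      using split_const_factor[OF cp(1) f(1) eR c(3,4)] by blast
    from no_split[OF s(3,4,5)] show ?thesis
    proof
      assume "degree e' = 0"
      \<comment> \<open>a nonzero constant is a combination of \<open>f\<close> and \<open>g\<close>\<close>
      then have "degree e = 0"
        using s(6) by simp
      then obtain z where z: "e = [:z:]"
        by (rule degree_eq_zeroE)
      then have zR: "z \<in> R"
        using eR by simp
      obtain u v where uv: "e = u * f + v * g" "u \<in> coeffs_in R" "v \<in> coeffs_in R"
        using e(1) by (auto simp: I_def)
      have "smult z h = e * h"
        using z by simp
      also have "\<dots> = u * h * f + v * (g * h)"
        unfolding uv(1) by (simp add: algebra_simps)
      finally have "smult z h = f * (u * h) + (g * h) * v"
        by (simp add: ac_simps)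
      moreover have "P.dvd_in f (f * (u * h) + (g * h) * v)"
        using uv h gh by (intro P.dvd_in_add P.dvd_in_mult[OF gh] P.dvd_in_mult[OF P.dvd_in_refl]) auto
      ultimately have "P.dvd_in f (smult z h)"
        by simp
      moreover have "z \<in> prime_products"
        using fact z zR e(2) by (simp add: factorial_iff)
      ultimately show ?thesis
        using f(1,2) h by (metis primitive_dvd_cancel)
    next
      assume "degree q' = 0"
      \<comment> \<open>then \<open>f\<close> is up to constants the generator, which pseudo-divides \<open>g\<close>\<close>
      then obtain z where z: "q' = [:z:]"
        by (rule degree_eq_zeroE)
      then have zR: "z \<in> R"
        using s(4) by simp
      have f_eq: "f = smult z e'"
        by (simp add: s(5) z)
      have z0: "z \<noteq> 0"
        using f0 f_eq by auto
      have "smult (z * c2) g = smult z (e * q2)"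
        by (simp only: c2(4)[symmetric] smult_smult)
      also have "\<dots> = f * smult a q2"
        by (simp add: f_eq s(6) mult.commute)
      finally have "P.dvd_in f (smult (z * c2) g)"
        using s(1) c2(3) by (intro P.dvd_inI[of "smult a q2"]) simp_all
      moreover have "z * c2 \<in> prime_products"
        using fact zR z0 c2(1,2) by (simp add: factorial_iff)
      ultimately have "P.dvd_in f g"
        using f(1,2) g by (metis primitive_dvd_cancel)
      then show ?thesis
        using ng by simp
    qed
  qed
  then have "\<forall>a\<in>coeffs_in R. \<forall>b\<in>coeffs_in R. P.dvd_in f (a * b) \<longrightarrow> P.dvd_in f a \<or> P.dvd_in f b"
    by (intro ballI impI disjCI) metis
  then show ?thesis
    using f(1) f0 not_unit unfolding P.prime_in_def by (intro conjI)
qed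

text \<open>
  A polynomial is broken up by splitting it into factors of smaller positive degree or by extracting
  prime constants; what resists both is prime by \<open>prime_if_no_splitting\<close>.  The extraction of constants
  terminates because it lowers the size \<open>\<delta>\<close> of the leading coefficient.
\<close>

theorem factorial_coeffs_in:
  fixes \<delta> :: "'a \<Rightarrow> nat"
  assumes fact: "factorial"
    and \<delta>_mult: "\<And>a b. a \<in> R \<Longrightarrow> b \<in> R \<Longrightarrow> a \<noteq> 0 \<Longrightarrow> b \<noteq> 0 \<Longrightarrow> \<delta> (a * b) = \<delta> a + \<delta> b"
    and \<delta>_unit: "\<And>a. a \<in> R \<Longrightarrow> a \<noteq> 0 \<Longrightarrow> \<delta> a = 0 \<Longrightarrow> dvd_in a 1"
  shows "P.factorial"
proof -
  have "f \<in> P.prime_products" if "f \<in> coeffs_in R" "f \<noteq> 0" for f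
    using that
  proof (induction "degree f" arbitrary: f rule: less_induct)
    case outer: (less f)
    have "k \<in> P.prime_products" if "k \<in> coeffs_in R" "k \<noteq> 0" "degree k = degree f" for k
      using that
    proof (induction "\<delta> (lead_coeff k)" arbitrary: k rule: less_induct)
      case (less k)
      show ?case
      proof (cases "degree k = 0")
        case True
        then obtain a where "k = [:a:]"
          by (rule degree_eq_zeroE)
        then show ?thesis
          using less(2,3) fact prime_products_const by (simp add: factorial_iff)
      next
        case deg: False
        show ?thesis
        proof (cases "primitive k")
          case False
          then obtain p where p: "prime_in p" "P.dvd_in [:p:] k"
            by (auto simp: primitive_def)
          then obtain l where l: "l \<in> coeffs_in R" "k = smult p l"
            by (auto simp: P.dvd_in_def)
          have p': "p \<in> R" "p \<noteq> 0" "0 < \<delta> p"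
            using p(1) \<delta>_unit[of p] by (auto simp: prime_in_def)
          have l0: "l \<noteq> 0"
            using l less(3) by auto
          have deg_l: "degree l = degree f"
            using l p' less(4) by simp
          have "\<delta> (lead_coeff k) = \<delta> p + \<delta> (lead_coeff l)"
            using \<delta>_mult[of p "lead_coeff l"] l p' l0 by (simp add: coeffs_inD)
          then have "l \<in> P.prime_products"
            using l l0 deg_l p' by (intro less(1)) auto
          then show ?thesis
            using P.prime_products.mult[OF prime_in_const[OF p(1)], of l] l by simp
        next
          case prim: True
          show ?thesis
          proof (cases "\<exists>g h. g \<in> coeffs_in R \<and> h \<in> coeffs_in R \<and> k = g * h \<and> degree g \<noteq> 0 \<and> degree h \<noteq> 0")
            case True
            then obtain g h where gh: "g \<in> coeffs_in R" "h \<in> coeffs_in R" "k = g * h"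
                "degree g \<noteq> 0" "degree h \<noteq> 0"
              by blast
            have "degree f = degree g + degree h"
              using less(3,4) gh(3) by (metis degree_mult_eq mult_zero_left mult_zero_right)
            then have "g \<in> P.prime_products" "h \<in> P.prime_products"
              using gh less(3) by (auto intro!: outer(1))
            then show ?thesis
              using gh(3) P.prime_products_mult by simp
          next
            case False
            then have "P.prime_in k"
              using prim deg less(2) fact by (intro prime_if_no_splitting) auto
            moreover have "1 \<in> P.prime_products"
              by (intro P.prime_products.unit) (auto intro: P.dvd_in_refl)
            ultimately show ?thesis
              using P.prime_products.mult[of k 1] by simp
          qed
        qed
      qed
    qed
    then show ?case
      using outer by blast
  qed
  then show ?thesis
    by (auto simp: P.factorial_def)
qed

end

section \<open>Elimination of a variable\<close>

lemma polys_subring: "idom_subring (polys n :: 'a::idom mpoly set)"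
  by unfold_locales auto

lemma uni_in_coeffs_in: "p \<in> polys (Suc n) \<Longrightarrow> uni n p \<in> coeffs_in (polys n)"
  by (simp add: coeffs_in_def coeff_uni_in_polys)

lemma poly_var_in_polys: "q \<in> coeffs_in (polys n) \<Longrightarrow> poly q (var n :: 'a::comm_ring_1 mpoly) \<in> polys (Suc n)"
  by (simp add: coeffs_in_def poly_in_polys)

lemma uni_poly_var: "q \<in> coeffs_in (polys n) \<Longrightarrow> uni n (poly q (var n :: 'a::comm_ring_1 mpoly)) = q"
  by (simp add: coeffs_in_def uni_poly)

lemma degree_uni_mult:
  fixes p q :: "'a::idom mpoly"
  assumes "p \<noteq> 0" "q \<noteq> 0"
  shows "degree (uni i (p * q)) = degree (uni i p) + degree (uni i q)"
  using assms by (simp add: degree_mult_eq)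

lemma degree_uni_eq_0_imp_const:
  fixes p :: "'a::idom mpoly"
  assumes "p \<in> polys n" "\<And>i. i < n \<Longrightarrow> degree (uni i p) = 0"
  shows "\<exists>c. p = const_poly c"
  using assms
proof (induction n arbitrary: p)
  case 0
  then show ?case
    using polys_0_const by blast
next
  case (Suc n)
  have "degree (uni n p) = 0"
    using Suc.prems(2) by simp
  then obtain q where q: "uni n p = [:q:]"
    by (rule degree_eq_zeroE)
  have "p = poly (uni n p) (var n)"
    by simp
  also have "\<dots> = q"
    unfolding q by simp
  finally have "p = coeff (uni n p) 0"
    unfolding q by simp
  then have "p \<in> polys n"
    using coeff_uni_in_polys[OF Suc.prems(1), of 0] by simp
  then show ?case
    by (rule Suc.IH) (use Suc.prems(2) in simp_all)
qed

lemma dvd_in_polys_Suc_iff: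
  fixes p q :: "'a::idom mpoly poly"
  assumes "p \<in> coeffs_in (polys n)" "q \<in> coeffs_in (polys n)"
  shows "idom_subring.dvd_in (polys (Suc n)) (poly p (var n)) (poly q (var n)) \<longleftrightarrow>
    idom_subring.dvd_in (coeffs_in (polys n)) p q"
proof -
  interpret R: idom_subring "polys n :: 'a mpoly set"
    by (rule polys_subring)
  interpret S: idom_subring "polys (Suc n) :: 'a mpoly set"
    by (rule polys_subring)
  interpret P: idom_subring "coeffs_in (polys n :: 'a mpoly set)"
    by (rule R.coeffs_in_subring)
  show ?thesis
  proof
    assume "S.dvd_in (poly p (var n)) (poly q (var n))"
    then obtain c where c: "c \<in> polys (Suc n)" "poly q (var n) = poly p (var n) * c"
      by (auto simp: S.dvd_in_def)
    have "uni n (poly q (var n)) = uni n (poly p (var n)) * uni n c"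
      by (simp add: c(2))
    then have "q = p * uni n c"
      using assms by (simp add: uni_poly_var)
    then show "P.dvd_in p q"
      using c(1) uni_in_coeffs_in by (intro P.dvd_inI[of "uni n c"])
  next
    assume "P.dvd_in p q"
    then obtain c where "c \<in> coeffs_in (polys n)" "q = p * c"
      by (auto simp: P.dvd_in_def)
    then show "S.dvd_in (poly p (var n)) (poly q (var n))"
      using poly_var_in_polys by (intro S.dvd_inI[of "poly c (var n)"]) auto
  qed
qed

text \<open>
  The step from \<open>n\<close> to \<open>n + 1\<close> is Gauss's theorem, transported along
  \<open>polys (Suc n) = (polys n)[x\<^sub>n]\<close>.  The size that Gauss's theorem asks for is the sum of the
  partial degrees, which vanishes only on constants, and nonzero constants are units over a field.
\<close>

theorem polys_factorial: "idom_subring.factorial (polys n :: 'a::field mpoly set)"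
proof (induction n)
  case 0
  interpret R: idom_subring "polys 0 :: 'a mpoly set"
    by (rule polys_subring)
  have "p \<in> R.prime_products" if p: "p \<in> polys 0" "p \<noteq> 0" for p
  proof -
    obtain c where c: "p = const_poly c"
      using p polys_0_const by blast
    then have "p * const_poly (inverse c) = 1"
      using p by (simp flip: const_poly_hom)
    then show ?thesis
      using p by (intro R.unit R.dvd_inI[of "const_poly (inverse c)"]) auto
  qed
  then show ?case
    by (auto simp: R.factorial_def)
next
  case (Suc n)
  interpret R: idom_subring "polys n :: 'a mpoly set"
    by (rule polys_subring)
  interpret S: idom_subring "polys (Suc n) :: 'a mpoly set"
    by (rule polys_subring)
  interpret P: idom_subring "coeffs_in (polys n :: 'a mpoly set)"
    by (rule R.coeffs_in_subring)
  have "P.factorial"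
  proof (rule R.factorial_coeffs_in[where \<delta> = "\<lambda>p. \<Sum>i<n. degree (uni i p)"])
    show "R.dvd_in p 1" if p: "p \<in> polys n" "p \<noteq> 0" "(\<Sum>i<n. degree (uni i p)) = 0" for p
    proof -
      obtain c where c: "p = const_poly c"
        using degree_uni_eq_0_imp_const[OF p(1)] p(3) by auto
      then have "p * const_poly (inverse c) = 1"
        using p by (simp flip: const_poly_hom)
      then show ?thesis
        by (intro R.dvd_inI[of "const_poly (inverse c)"]) auto
    qed
  qed (use Suc in \<open>auto simp: degree_mult_eq sum.distrib\<close>)
  have transport: "poly q (var n) \<in> S.prime_products" if "q \<in> P.prime_products" for q
    using that
  proof induction
    case (unit u)
    then show ?case
      using dvd_in_polys_Suc_iff[of u n 1] poly_var_in_polys by (intro S.unit) auto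
  next
    case (mult p a)
    have p: "p \<in> coeffs_in (polys n)" "p \<noteq> 0" "\<not> P.dvd_in p 1"
      using mult(1) by (auto simp: P.prime_in_def)
    have "S.prime_in (poly p (var n))"
      unfolding S.prime_in_def
    proof (intro conjI ballI impI)
      show "poly p (var n) \<in> polys (Suc n)"
        using p by (simp add: poly_var_in_polys)
      show "poly p (var n) \<noteq> 0"
        using uni_poly_var[OF p(1)] p(2) by auto
      show "\<not> S.dvd_in (poly p (var n)) 1"
        using dvd_in_polys_Suc_iff[of p n 1] p by simp
    next
      fix a b :: "'a mpoly"
      assume ab: "a \<in> polys (Suc n)" "b \<in> polys (Suc n)" "S.dvd_in (poly p (var n)) (a * b)"
      have *: "S.dvd_in (poly p (var n)) c \<longleftrightarrow> P.dvd_in p (uni n c)" if "c \<in> polys (Suc n)" for c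
        using dvd_in_polys_Suc_iff[OF p(1) uni_in_coeffs_in[OF that]] by simp
      have "P.dvd_in p (uni n a * uni n b)"
        using *[of "a * b"] ab by simp
      then show "S.dvd_in (poly p (var n)) a \<or> S.dvd_in (poly p (var n)) b"
        using ab mult(1) uni_in_coeffs_in by (auto simp: * elim: P.prime_in_dvd_mult)
    qed
    then show ?case
      using S.mult mult.IH by simp
  qed
  have "p \<in> S.prime_products" if p: "p \<in> polys (Suc n)" "p \<noteq> 0" for p
    using transport[of "uni n p"] p uni_in_coeffs_in[OF p(1)] \<open>P.factorial\<close> by (simp add: P.factorial_iff)
  then show ?case
    by (auto simp: S.factorial_def)
qed

lemma uni_rat_poly: "uni n (rat_poly p) = map_poly rat_poly (uni n p)"
proof (rule poly_eqI)
  fix i show "coeff (uni n (rat_poly p)) i = coeff (map_poly rat_poly (uni n p)) i"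
  proof (induction p arbitrary: i rule: mpoly_induct)
    case (mult p q)
    then show ?case by (simp add: coeff_map_poly coeff_mult)
  qed (auto simp: coeff_map_poly uni_var coeff_pCons split: nat.splits)
qed

lemma degree_uni_rat_poly [simp]: "degree (uni n (rat_poly p)) = degree (uni n p)"
  unfolding uni_rat_poly by (cases "p = 0") (simp_all add: map_poly_degree_eq)

text \<open>
  The induction on the number of variables passes from a family to the set of all the coefficients of
  its members.  Therefore coprimality is a joint condition on a set, which may contain zero.
\<close>

definition coprime_in :: "nat \<Rightarrow> 'a::comm_ring_1 mpoly set \<Rightarrow> bool" where
  "coprime_in n \<F> \<longleftrightarrow>
     (\<forall>G \<in> polys n. (\<forall>F\<in>\<F>. \<exists>H \<in> polys n. F = G * H) \<longrightarrow> (\<exists>H \<in> polys n. G * H = 1))"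

lemma coprime_in_nonzero:
  assumes "coprime_in n \<F>" obtains F where "F \<in> \<F>" "F \<noteq> 0"
proof -
  have "\<exists>F\<in>\<F>. F \<noteq> 0"
  proof (rule ccontr)
    assume "\<not> ?thesis"
    then have "\<forall>F\<in>\<F>. \<exists>H\<in>polys n. F = 0 * H"
      by (intro ballI bexI[of _ 0]) auto
    then have "\<exists>H\<in>polys n. 0 * H = (1 :: 'a mpoly)"
      using assms zero_in_polys unfolding coprime_in_def by blast
    then show False by simp
  qed
  then show ?thesis using that by blast
qed

definition last_var_coeffs :: "nat \<Rightarrow> 'a::comm_ring_1 mpoly set \<Rightarrow> 'a mpoly set" where
  "last_var_coeffs n \<F> = (\<Union>F\<in>\<F>. coeff (uni n F) ` {..degree (uni n F)})"

lemma finite_last_var_coeffs: "finite \<F> \<Longrightarrow> finite (last_var_coeffs n \<F>)"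
  by (simp add: last_var_coeffs_def)

lemma last_var_coeffs_subset: "\<F> \<subseteq> polys (Suc n) \<Longrightarrow> last_var_coeffs n \<F> \<subseteq> polys n"
  by (auto simp: last_var_coeffs_def coeff_uni_in_polys)

text \<open>
  A common divisor of all the coefficients is a common divisor of the polynomials themselves.  Thus
  coprimality passes on to a family in one variable less.
\<close>

lemma coprime_in_last_var_coeffs:
  assumes F: "\<F> \<subseteq> polys (Suc n)" and cop: "coprime_in (Suc n) (rat_poly ` \<F>)"
  shows "coprime_in n (rat_poly ` last_var_coeffs n \<F>)"
  unfolding coprime_in_def
proof (intro ballI impI)
  fix G :: "rat mpoly"
  assume G: "G \<in> polys n" and dvd: "\<forall>c\<in>rat_poly ` last_var_coeffs n \<F>. \<exists>H\<in>polys n. c = G * H"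
  have G': "G \<in> polys (Suc n)"
    using G polys_mono[of n "Suc n"] by auto
  interpret R: idom_subring "polys n :: rat mpoly set"
    by (rule polys_subring)
  interpret P: idom_subring "coeffs_in (polys n :: rat mpoly set)"
    by (rule R.coeffs_in_subring)
  have "\<exists>H\<in>polys (Suc n). rat_poly F = G * H" if F': "F \<in> \<F>" for F
  proof -
    have "R.dvd_in G (coeff (uni n (rat_poly F)) i)" for i
    proof (cases "i \<le> degree (uni n F)")
      case True
      then show ?thesis
        using dvd F' by (fastforce simp: R.dvd_in_def last_var_coeffs_def uni_rat_poly coeff_map_poly)
    next
      case False
      then show ?thesis
        by (intro R.dvd_inI[of 0]) (auto intro!: coeff_eq_0)
    qed
    moreover have "uni n (rat_poly F) \<in> coeffs_in (polys n)"
      using F F' by (intro uni_in_coeffs_in) auto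
    ultimately have "P.dvd_in [:G:] (uni n (rat_poly F))"
      by (simp add: R.const_dvd_in_iff)
    then obtain H where H: "H \<in> coeffs_in (polys n)" "uni n (rat_poly F) = [:G:] * H"
      by (auto simp: P.dvd_in_def)
    have "rat_poly F = poly (uni n (rat_poly F)) (var n)"
      by simp
    also have "\<dots> = G * poly H (var n)"
      unfolding H(2) by simp
    finally show ?thesis
      using H(1) poly_var_in_polys by blast
  qed
  then have "\<exists>H\<in>polys (Suc n). G * H = 1"
    using cop G' by (simp add: coprime_in_def)
  then obtain H where H: "H \<in> polys (Suc n)" "G * H = 1"
    by blast
  have "uni n (G * H) = 1"
    by (simp add: H(2) del: uni_simps(3))
  then have "[:G:] * uni n H = 1"
    by (simp add: uni_of_polys[OF G])
  then have "coeff ([:G:] * uni n H) 0 = coeff 1 0"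
    by simp
  then have "G * coeff (uni n H) 0 = 1"
    by simp
  then show "\<exists>H\<in>polys n. G * H = 1"
    using coeff_uni_in_polys[OF H(1)] by blast
qed

lemma prime_factor_of_positive_degree:
  fixes f :: "'a::field mpoly"
  assumes "f \<in> polys d" "0 < degree (uni i f)"
  obtains p where "idom_subring.prime_in (polys d) p" "idom_subring.dvd_in (polys d) p f" "0 < degree (uni i p)"
proof -
  interpret S: idom_subring "polys d :: 'a mpoly set"
    by (rule polys_subring)
  have pp: "S.prime_products = polys d - {0}"
  proof -
    have "S.factorial"
      by (rule polys_factorial)
    then show ?thesis
      by (simp only: S.factorial_iff)
  qed
  have "f \<noteq> 0"
    using assms(2) by auto
  then have "f \<in> S.prime_products"
    using assms(1) by (simp add: pp)
  then have "\<exists>p. S.prime_in p \<and> S.dvd_in p f \<and> 0 < degree (uni i p)"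
    using assms(2)
  proof (induction f)
    case (unit u)
    then obtain v where v: "1 = u * v"
      by (auto simp: S.dvd_in_def)
    then have "u \<noteq> 0" "v \<noteq> 0"
      by auto
    then have "degree (uni i (1 :: 'a mpoly)) = degree (uni i u) + degree (uni i v)"
      unfolding v by (rule degree_uni_mult)
    then show ?case
      using unit by simp
  next
    case (mult p a)
    have a: "a \<in> polys d" "a \<noteq> 0" and p: "p \<in> polys d" "p \<noteq> 0"
      using mult S.prime_products_subset by (auto simp: S.prime_in_def)
    show ?case
    proof (cases "0 < degree (uni i p)")
      case True
      then show ?thesis
        using mult(1) a S.dvd_inI[of a "p * a" p] by blast
    next
      case False
      then have "0 < degree (uni i a)"
        using mult.prems a p by (simp add: degree_mult_eq)
      then obtain q where "S.prime_in q" "S.dvd_in q a" "0 < degree (uni i q)"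
        using mult.IH by blast
      then show ?thesis
        using S.dvd_in_mult[of q a p] p by (metis mult.commute)
    qed
  qed
  then show ?thesis using that by blast
qed

text \<open>
  The ideal generated by the family over the integers meets \<open>polys n\<close>.  Take an element \<open>g\<close> of the
  ideal of least degree in \<open>x\<^sub>n\<close>; it divides \<open>c * F\<close> for every member \<open>F\<close>, with \<open>c\<close> free of
  \<open>x\<^sub>n\<close> depending on \<open>F\<close>.  If \<open>g\<close> involved \<open>x\<^sub>n\<close>, it would have a prime factor over
  \<open>\<rat>\<close> that involves \<open>x\<^sub>n\<close>; this prime does not divide \<open>c\<close>, hence it would divide every \<open>F\<close>.
\<close>

lemma elimination:
  assumes fin: "finite \<F>" and F: "\<F> \<subseteq> polys (Suc n)" and cop: "coprime_in (Suc n) (rat_poly ` \<F>)"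
  obtains R A where "R \<in> polys n" "R \<noteq> 0" "R = (\<Sum>F\<in>\<F>. A F * F)"
proof -
  interpret R: idom_subring "polys n :: int mpoly set"
    by (rule polys_subring)
  interpret P: idom_subring "coeffs_in (polys n :: int mpoly set)"
    by (rule R.coeffs_in_subring)
  interpret S: idom_subring "polys (Suc n) :: rat mpoly set"
    by (rule polys_subring)
  define I where "I = {\<Sum>F\<in>\<F>. A F * uni n F | A. \<forall>F. A F \<in> coeffs_in (polys n)}"
  have uniF: "uni n F \<in> coeffs_in (polys n)" if "F \<in> \<F>" for F
    using F that by (auto intro: uni_in_coeffs_in)
  have in_I: "uni n F \<in> I" if "F \<in> \<F>" for F
  proof -
    have "uni n F = (\<Sum>F'\<in>\<F>. (if F' = F then 1 else 0) * uni n F')"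
      using fin that by (simp add: if_distrib[of "\<lambda>x. x * _"] cong: if_cong)
    then show ?thesis
      unfolding I_def by (intro CollectI exI[of _ "\<lambda>F'. if F' = F then 1 else 0"]) auto
  qed
  obtain F0 where F0: "F0 \<in> \<F>" "F0 \<noteq> 0"
    using coprime_in_nonzero[OF cop] by (metis imageE rat_poly_eq_0_iff)
  obtain g where g: "g \<in> I" "g \<noteq> 0"
    and gen: "\<And>f. f \<in> I \<Longrightarrow> \<exists>c q. c \<in> polys n \<and> c \<noteq> 0 \<and> q \<in> coeffs_in (polys n) \<and> smult c f = g * q"
  proof (rule R.ideal_pseudo_generator[of I "uni n F0"])
    show "I \<subseteq> coeffs_in (polys n)"
      unfolding I_def using uniF by (auto intro!: P.sum_in)
    show "u - v \<in> I" if u: "u \<in> I" and v: "v \<in> I" for u v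
    proof -
      obtain A B where "u = (\<Sum>F\<in>\<F>. A F * uni n F)" "\<forall>F. A F \<in> coeffs_in (polys n)"
        "v = (\<Sum>F\<in>\<F>. B F * uni n F)" "\<forall>F. B F \<in> coeffs_in (polys n)"
        using u v unfolding I_def by auto
      then show ?thesis
        unfolding I_def by (intro CollectI exI[of _ "\<lambda>F. A F - B F"]) (auto simp: sum_subtractf left_diff_distrib)
    qed
    show "u * v \<in> I" if u: "u \<in> coeffs_in (polys n)" and v: "v \<in> I" for u v
    proof -
      obtain B where "v = (\<Sum>F\<in>\<F>. B F * uni n F)" "\<forall>F. B F \<in> coeffs_in (polys n)"
        using v unfolding I_def by auto
      then show ?thesis
        unfolding I_def using u by (intro CollectI exI[of _ "\<lambda>F. u * B F"]) (auto simp: sum_distrib_left mult.assoc)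
    qed
  qed (use F0 in_I in auto)
  obtain A where A: "g = (\<Sum>F\<in>\<F>. A F * uni n F)" "\<forall>F. A F \<in> coeffs_in (polys n)"
    using g(1) unfolding I_def by auto
  have gR: "g \<in> coeffs_in (polys n)"
    unfolding A(1) using A(2) uniF by (intro P.sum_in) auto
  define \<gamma> where "\<gamma> = poly g (var n)"
  have \<gamma>: "\<gamma> \<in> polys (Suc n)" "uni n \<gamma> = g"
    unfolding \<gamma>_def using gR by (simp_all add: poly_var_in_polys uni_poly_var)
  have "degree g = 0"
  proof (rule ccontr)
    assume "degree g \<noteq> 0"
    then obtain p where p: "S.prime_in p" "S.dvd_in p (rat_poly \<gamma>)" "0 < degree (uni n p)"
      using prime_factor_of_positive_degree[of "rat_poly \<gamma>" "Suc n" n] \<gamma> by auto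
    have "S.dvd_in p (rat_poly F')" if F': "F' \<in> \<F>" for F'
    proof -
      obtain c q where c: "c \<in> polys n" "c \<noteq> 0" "q \<in> coeffs_in (polys n)" "smult c (uni n F') = g * q"
        using gen[OF in_I[OF F']] by blast
      have "c * F' = poly (smult c (uni n F')) (var n)"
        by simp
      also have "\<dots> = \<gamma> * poly q (var n)"
        unfolding c(4) by (simp add: \<gamma>_def)
      finally have "rat_poly c * rat_poly F' = rat_poly \<gamma> * rat_poly (poly q (var n))"
        by (metis rat_poly_simps(3))
      moreover have "rat_poly (poly q (var n)) \<in> polys (Suc n)"
        using c(3) by (simp add: poly_var_in_polys)
      ultimately have dvd: "S.dvd_in p (rat_poly c * rat_poly F')"
        using S.dvd_in_mult[OF p(2)] by simp
      have c': "rat_poly c \<in> polys (Suc n)"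
        using c(1) polys_mono[of n "Suc n"] by auto
      have "\<not> S.dvd_in p (rat_poly c)"
      proof
        assume "S.dvd_in p (rat_poly c)"
        then obtain k where k: "rat_poly c = p * k"
          by (auto simp: S.dvd_in_def)
        then have "p \<noteq> 0" "k \<noteq> 0"
          using c(2) rat_poly_eq_0_iff[of c] by auto
        then have "degree (uni n (rat_poly c)) = degree (uni n p) + degree (uni n k)"
          unfolding k by (rule degree_uni_mult)
        then show False
          using p(3) c(1) by (simp add: uni_of_polys)
      qed
      then show ?thesis
        using S.prime_in_dvd_mult[OF p(1) dvd c'] F F' by auto
    qed
    then have "\<forall>G\<in>rat_poly ` \<F>. \<exists>H\<in>polys (Suc n). G = p * H"
      by (auto simp: S.dvd_in_def)
    moreover have "p \<in> polys (Suc n)"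
      using p(1) by (simp add: S.prime_in_def)
    ultimately have "\<exists>H\<in>polys (Suc n). p * H = 1"
      using cop by (simp add: coprime_in_def)
    then have "S.dvd_in p 1"
      by (auto simp: S.dvd_in_def)
    then show False
      using p(1) by (simp add: S.prime_in_def)
  qed
  then obtain R where R: "g = [:R:]"
    by (rule degree_eq_zeroE)
  have "R = poly g (var n)"
    by (simp add: R)
  also have "\<dots> = (\<Sum>F\<in>\<F>. poly (A F) (var n) * F)"
    unfolding A(1) by (simp add: poly_sum)
  finally have "R = (\<Sum>F\<in>\<F>. poly (A F) (var n) * F)" .
  moreover have "R \<in> polys n" "R \<noteq> 0"
    using gR g(2) by (simp_all add: R)
  ultimately show ?thesis
    by (rule that[rotated 2])
qed

section \<open>Counting zeros modulo primes\<close>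

lemma card_points_Suc:
  assumes "finite A"
  shows "card {x \<in> {..<Suc n} \<rightarrow>\<^sub>E A. Q x} = (\<Sum>y\<in>{..<n} \<rightarrow>\<^sub>E A. card {t \<in> A. Q (y(n := t))})"
proof -
  let ?S = "SIGMA y:{..<n} \<rightarrow>\<^sub>E A. {t \<in> A. Q (y(n := t))}"
  have "bij_betw (\<lambda>(y, t). y(n := t)) ?S {x \<in> {..<Suc n} \<rightarrow>\<^sub>E A. Q x}"
  proof (rule bij_betw_byWitness[where f' = "\<lambda>x. (restrict x {..<n}, x n)"])
    have upd: "(restrict x {..<n})(n := x n) = x" if "x \<in> {..<Suc n} \<rightarrow>\<^sub>E A" for x :: "nat \<Rightarrow> 'a"
    proof
      fix i show "((restrict x {..<n})(n := x n)) i = x i"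
        using PiE_arb[OF that, of i] by (cases "i < n"; cases "i = n") auto
    qed
    have res: "restrict (y(n := t)) {..<n} = y" if "y \<in> {..<n} \<rightarrow>\<^sub>E A" for y :: "nat \<Rightarrow> 'a" and t
    proof
      fix i show "restrict (y(n := t)) {..<n} i = y i"
        using PiE_arb[OF that, of i] by (cases "i < n") auto
    qed
    show "\<forall>a\<in>?S. (\<lambda>x. (restrict x {..<n}, x n)) ((\<lambda>(y, t). y(n := t)) a) = a"
      using res by (auto simp del: restrict_fupd)
    show "\<forall>x\<in>{x \<in> {..<Suc n} \<rightarrow>\<^sub>E A. Q x}. (\<lambda>(y, t). y(n := t)) ((\<lambda>x. (restrict x {..<n}, x n)) x) = x"
      using upd by simp
    show "(\<lambda>(y, t). y(n := t)) ` ?S \<subseteq> {x \<in> {..<Suc n} \<rightarrow>\<^sub>E A. Q x}"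
    proof (rule image_subsetI)
      fix a assume "a \<in> ?S"
      then obtain y t where a: "a = (y, t)" "y \<in> {..<n} \<rightarrow>\<^sub>E A" "t \<in> A" "Q (y(n := t))"
        by (elim SigmaE) blast
      then have "y(n := t) \<in> {..<Suc n} \<rightarrow>\<^sub>E A"
        unfolding lessThan_Suc by (intro PiE_fun_upd)
      then show "(\<lambda>(y, t). y(n := t)) a \<in> {x \<in> {..<Suc n} \<rightarrow>\<^sub>E A. Q x}"
        using a by simp
    qed
    show "(\<lambda>x. (restrict x {..<n}, x n)) ` {x \<in> {..<Suc n} \<rightarrow>\<^sub>E A. Q x} \<subseteq> ?S"
    proof (intro image_subsetI, elim CollectE conjE)
      fix x assume x: "x \<in> {..<Suc n} \<rightarrow>\<^sub>E A" "Q x"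
      have "restrict x {..<n} \<in> {..<n} \<rightarrow>\<^sub>E A" "x n \<in> A"
        using PiE_mem[OF x(1)] by (simp_all add: restrict_PiE_iff)
      then show "(restrict x {..<n}, x n) \<in> ?S"
        using x(2) upd[OF x(1)] by simp
    qed
  qed
  then have "card {x \<in> {..<Suc n} \<rightarrow>\<^sub>E A. Q x} = card ?S"
    by (simp add: bij_betw_same_card)
  also have "\<dots> = (\<Sum>y\<in>{..<n} \<rightarrow>\<^sub>E A. card {t \<in> A. Q (y(n := t))})"
    using assms by (intro card_SigmaI) (auto intro: finite_PiE)
  finally show ?thesis .
qed

lemma finite_points [simp]: "finite A \<Longrightarrow> finite ({..<n::nat} \<rightarrow>\<^sub>E A)"
  by (intro finite_PiE) auto

lemma card_points: "finite A \<Longrightarrow> card ({..<n::nat} \<rightarrow>\<^sub>E A) = card A ^ n"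
  by (simp add: card_PiE)

lemma eval_poly_update:
  assumes "c \<in> polys n" shows "eval_poly c (y(n := t)) = eval_poly c y"
  using assms by (rule eval_poly_cong) auto

definition specialize :: "nat \<Rightarrow> int mpoly \<Rightarrow> (nat \<Rightarrow> int) \<Rightarrow> int poly" where
  "specialize n F y = map_poly (\<lambda>c. eval_poly c y) (uni n F)"

lemma coeff_specialize: "coeff (specialize n F y) i = eval_poly (coeff (uni n F) i) y"
  by (simp add: specialize_def coeff_map_poly)

lemma degree_specialize_le: "degree (specialize n F y) \<le> degree (uni n F)"
  by (simp add: specialize_def map_poly_degree_leq)

lemma eval_poly_specialize:
  assumes "F \<in> polys (Suc n)"
  shows "eval_poly F (y(n := t)) = poly (specialize n F y) t"
proof -
  have "specialize n F (y(n := t)) = specialize n F y"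
    by (rule poly_eqI) (simp add: coeff_specialize eval_poly_update[OF coeff_uni_in_polys[OF assms]])
  then show ?thesis
    using eval_poly_uni[OF assms, of "y(n := t)"] by (simp add: specialize_def)
qed

text \<open>
  The modulus \<open>0\<close>, for which divisibility means vanishing, is treated together with the primes, so
  that integer zeros and zeros modulo \<open>p\<close> are counted by one argument.
\<close>

lemma card_roots_mod:
  fixes f :: "int poly" and q :: int
  assumes q: "q = 0 \<or> prime q" and A: "finite A" "inj_on (\<lambda>a. a mod q) A"
    and "\<not> q dvd coeff f i"
  shows "card {t \<in> A. q dvd poly f t} \<le> degree f"
  using assms(4)
proof (induction "degree f" arbitrary: f i rule: less_induct)
  case (less f)
  show ?case
  proof (cases "\<exists>a\<in>A. q dvd poly f a")
    case False
    then have "{t \<in> A. q dvd poly f t} = {}"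
      by auto
    then show ?thesis
      by (simp only: card.empty)
  next
    case True
    then obtain a where a: "a \<in> A" "q dvd poly f a"
      by blast
    define g where "g = synthetic_div f a"
    have f_eq: "f = [:- a, 1:] * g + [:poly f a:]"
      using synthetic_div_correct'[of a f] by (simp add: g_def)
    have deg: "degree g = degree f - 1"
      by (simp add: g_def degree_synthetic_div)
    have "\<exists>j. \<not> q dvd coeff g j"
    proof (rule ccontr)
      assume "\<not> ?thesis"
      then have "q dvd coeff ([:- a, 1:] * g) j" for j
        by (auto simp: coeff_pCons split: nat.splits)
      then have "q dvd coeff f j" for j
        using a(2) by (subst f_eq) (auto simp: coeff_pCons split: nat.splits)
      then show False
        using less.prems by blast
    qed
    then obtain j where j: "\<not> q dvd coeff g j"
      by blast
    have deg0: "degree f \<noteq> 0"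
    proof
      assume "degree f = 0"
      then obtain c where c: "f = [:c:]"
        by (rule degree_eq_zeroE)
      then show False
        using a(2) less.prems by (auto simp: coeff_pCons split: nat.splits)
    qed
    have "{t \<in> A. q dvd poly f t} \<subseteq> insert a {t \<in> A. q dvd poly g t}"
    proof (intro subsetI, rule ccontr)
      fix t assume t': "t \<in> {t \<in> A. q dvd poly f t}" "t \<notin> insert a {t \<in> A. q dvd poly g t}"
      then have t: "t \<in> A" "q dvd poly f t" "\<not> q dvd poly g t"
        by auto
      have "poly f t = (t - a) * poly g t + poly f a"
        by (subst f_eq) (simp add: algebra_simps)
      then have "q dvd (t - a) * poly g t"
        using t(2) a(2) by (metis dvd_add_left_iff)
      then have "q dvd t - a"
        using q t(3) by (auto dest: prime_dvd_multD)
      then have "t mod q = a mod q"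
        by (simp add: mod_eq_dvd_iff)
      then show False
        using A(2) t(1) a(1) t'(2) by (auto dest: inj_onD)
    qed
    then have "card {t \<in> A. q dvd poly f t} \<le> card (insert a {t \<in> A. q dvd poly g t})"
      using A(1) by (intro card_mono) auto
    also have "\<dots> \<le> Suc (card {t \<in> A. q dvd poly g t})"
      using A(1) by (simp add: card_insert_if)
    also have "card {t \<in> A. q dvd poly g t} \<le> degree g"
      using less.hyps[OF _ j] deg deg0 by simp
    finally show ?thesis
      using deg deg0 by simp
  qed
qed

lemma card_le_modulus:
  fixes q :: int
  assumes "0 < q" "inj_on (\<lambda>a. a mod q) A"
  shows "int (card A) \<le> q"
proof -
  have "card A \<le> card {0..<q}"
    using assms by (intro card_inj_on_le[OF assms(2)]) auto
  then show ?thesis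
    using assms by simp
qed

lemma modulus_le_of_dvd:
  fixes q :: int
  assumes "q = 0 \<or> prime q" "inj_on (\<lambda>a. a mod q) A" "q dvd c" "c \<noteq> 0"
  shows "card A \<le> nat \<bar>c\<bar>"
proof -
  have "0 < q"
    using assms prime_gt_0_int by auto
  moreover have "q \<le> \<bar>c\<bar>"
    using assms dvd_imp_le_int[of c q] \<open>0 < q\<close> by simp
  ultimately show ?thesis
    using card_le_modulus[of q A] assms(2) by linarith
qed

text \<open>
  The Schwartz-Zippel bound, in a form with a constant that serves all moduli: should \<open>q\<close> divide all
  the coefficients of \<open>R\<close>, then \<open>q\<close>, and with it \<open>card A\<close>, is bounded in terms of \<open>R\<close>.  In
  the induction this case surfaces for constant polynomials, by \<open>modulus_le_of_dvd\<close>.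
\<close>

lemma card_zeros_mod:
  assumes "R \<in> polys n" "(R :: int mpoly) \<noteq> 0"
  shows "\<exists>C. \<forall>q A. (q = 0 \<or> prime q) \<longrightarrow> finite A \<longrightarrow> inj_on (\<lambda>a. a mod q) A \<longrightarrow>
    card {y \<in> {..<n} \<rightarrow>\<^sub>E A. q dvd eval_poly R y} * card A \<le> C * card A ^ n"
  using assms
proof (induction n arbitrary: R)
  case 0
  then obtain c where c: "R = const_poly c" "c \<noteq> 0"
    using polys_0_const by force
  show ?case
  proof (intro exI[of _ "nat \<bar>c\<bar>"] allI impI)
    fix q :: int and A :: "int set"
    assume A: "q = 0 \<or> prime q" "finite A" "inj_on (\<lambda>a. a mod q) A"
    show "card {y \<in> {..<0} \<rightarrow>\<^sub>E A. q dvd eval_poly R y} * card A \<le> nat \<bar>c\<bar> * card A ^ 0"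
    proof (cases "q dvd c")
      case True
      then show ?thesis
        using modulus_le_of_dvd[OF A(1,3) True c(2)] by (simp add: c)
    qed (simp add: c)
  qed
next
  case (Suc n)
  define c where "c = lead_coeff (uni n R)"
  have c: "c \<in> polys n" "c \<noteq> 0"
    using Suc.prems by (auto simp: c_def coeff_uni_in_polys)
  define D where "D = degree (uni n R)"
  obtain C where C: "\<And>q A. (q = 0 \<or> prime q) \<Longrightarrow> finite A \<Longrightarrow> inj_on (\<lambda>a. a mod q) A \<Longrightarrow>
    card {y \<in> {..<n} \<rightarrow>\<^sub>E A. q dvd eval_poly c y} * card A \<le> C * card A ^ n"
    using Suc.IH[OF c] by blast
  show ?case
  proof (intro exI[of _ "C + D"] allI impI)
    fix q :: int and A :: "int set"
    assume A: "q = 0 \<or> prime q" "finite A" "inj_on (\<lambda>a. a mod q) A"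
    let ?Y = "{..<n} \<rightarrow>\<^sub>E A"
    have "card {x \<in> {..<Suc n} \<rightarrow>\<^sub>E A. q dvd eval_poly R x} =
        (\<Sum>y\<in>?Y. card {t \<in> A. q dvd poly (specialize n R y) t})"
      using A(2) Suc.prems(1) by (simp add: card_points_Suc eval_poly_specialize)
    also have "\<dots> \<le> (\<Sum>y\<in>?Y. (if q dvd eval_poly c y then card A else 0) + D)"
    proof (rule sum_mono)
      fix y assume "y \<in> ?Y"
      show "card {t \<in> A. q dvd poly (specialize n R y) t} \<le> (if q dvd eval_poly c y then card A else 0) + D"
      proof (cases "q dvd eval_poly c y")
        case True
        then show ?thesis
          using A(2) card_mono[of A "{t \<in> A. q dvd poly (specialize n R y) t}"] by auto
      next
        case False
        then have "\<not> q dvd coeff (specialize n R y) D"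
          by (simp add: coeff_specialize c_def D_def)
        from card_roots_mod[OF A this] show ?thesis
          using False degree_specialize_le[of n R y] by (simp add: D_def)
      qed
    qed
    also have "\<dots> = card {y \<in> ?Y. q dvd eval_poly c y} * card A + D * card A ^ n"
      using A(2) by (simp add: sum.distrib card_points flip: sum.inter_filter)
    finally have "card {x \<in> {..<Suc n} \<rightarrow>\<^sub>E A. q dvd eval_poly R x} * card A \<le>
        (card {y \<in> ?Y. q dvd eval_poly c y} * card A + D * card A ^ n) * card A"
      by (rule mult_right_mono) simp
    also have "\<dots> \<le> (C * card A ^ n + D * card A ^ n) * card A"
      using C[OF A] by (intro mult_right_mono add_mono) auto
    finally show "card {x \<in> {..<Suc n} \<rightarrow>\<^sub>E A. q dvd eval_poly R x} * card A \<le> (C + D) * card A ^ Suc n"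
      by (simp add: algebra_simps)
  qed
qed

text \<open>
  The member of the family to which the coefficient \<open>G\<close> belongs specializes at \<open>y\<close> to a nonzero
  polynomial modulo \<open>p\<close>, and the common zeros above \<open>y\<close> are among its roots.
\<close>

lemma card_fibre:
  assumes fin: "finite \<F>" and F: "\<F> \<subseteq> polys (Suc n)" and p: "prime (p :: int)"
    and A: "finite A" "inj_on (\<lambda>a. a mod p) A"
    and G: "G \<in> last_var_coeffs n \<F>" "\<not> p dvd eval_poly G y"
  shows "card {t \<in> A. \<forall>F\<in>\<F>. p dvd eval_poly F (y(n := t))} \<le> (\<Sum>F\<in>\<F>. degree (uni n F))"
proof -
  obtain F i where F': "F \<in> \<F>" "G = coeff (uni n F) i"
    using G(1) by (auto simp: last_var_coeffs_def)
  have FP: "F \<in> polys (Suc n)"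
    using F' F by blast
  have "card {t \<in> A. \<forall>F\<in>\<F>. p dvd eval_poly F (y(n := t))} \<le> card {t \<in> A. p dvd poly (specialize n F y) t}"
    using A(1) F'(1) by (intro card_mono) (auto simp: eval_poly_specialize[OF FP, symmetric])
  also have "\<dots> \<le> degree (specialize n F y)"
    using G(2) p A by (intro card_roots_mod[where i = i]) (auto simp: coeff_specialize F')
  also have "\<dots> \<le> degree (uni n F)"
    by (rule degree_specialize_le)
  also have "\<dots> \<le> (\<Sum>F\<in>\<F>. degree (uni n F))"
    using fin F'(1) by (intro member_le_sum) auto
  finally show ?thesis .
qed

lemma dvd_eliminant_value:
  fixes R :: "int mpoly"
  assumes "\<F> \<subseteq> polys (Suc n)" "R \<in> polys n" "R = (\<Sum>F\<in>\<F>. A F * F)" "\<forall>F\<in>\<F>. p dvd eval_poly F (y(n := t))"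
  shows "p dvd eval_poly R y"
proof -
  have "eval_poly R (y(n := t)) = (\<Sum>F\<in>\<F>. eval_poly (A F) (y(n := t)) * eval_poly F (y(n := t)))"
    by (simp add: assms(3))
  also have "p dvd \<dots>"
    using assms(4) by (intro dvd_sum dvd_mult) auto
  finally show ?thesis
    by (simp add: eval_poly_update[OF assms(2)])
qed

lemma coprime_in_0:
  assumes "\<F> \<subseteq> polys 0" "coprime_in 0 (rat_poly ` \<F>)"
  obtains c where "const_poly c \<in> \<F>" "c \<noteq> 0"
proof -
  obtain F where F: "F \<in> rat_poly ` \<F>" "F \<noteq> 0"
    using coprime_in_nonzero[OF assms(2)] .
  then obtain F' where F': "F' \<in> \<F>" "F' \<noteq> 0"
    by auto
  moreover obtain c where "F' = const_poly c"
    using polys_0_const F' assms(1) by blast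
  ultimately show ?thesis
    using that by auto
qed

text \<open>
  A coprime family has a zero set of codimension two, uniformly in the prime.  Above a common zero \<open>y\<close>
  of the coefficients there may be a whole line of zeros, but by induction such \<open>y\<close> are already rare
  enough.  All other common zeros lie above the zeros of the eliminant \<open>R\<close>, at most \<open>D\<close> above each.
\<close>

theorem card_common_zeros_mod:
  assumes "finite \<F>" "\<F> \<subseteq> polys n" "coprime_in n (rat_poly ` \<F>)"
  shows "\<exists>C. \<forall>p A. prime p \<longrightarrow> finite A \<longrightarrow> inj_on (\<lambda>a. a mod p) A \<longrightarrow>
    card {x \<in> {..<n} \<rightarrow>\<^sub>E A. \<forall>F\<in>\<F>. p dvd eval_poly F x} * card A ^ 2 \<le> C * card A ^ n"
  using assms
proof (induction n arbitrary: \<F>)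
  case 0
  obtain c where c: "const_poly c \<in> \<F>" "c \<noteq> 0"
    using coprime_in_0 0 by blast
  show ?case
  proof (intro exI[of _ "nat \<bar>c\<bar> ^ 2"] allI impI)
    fix p :: int and A :: "int set"
    assume A: "prime p" "finite A" "inj_on (\<lambda>a. a mod p) A"
    show "card {x \<in> {..<0} \<rightarrow>\<^sub>E A. \<forall>F\<in>\<F>. p dvd eval_poly F x} * card A ^ 2 \<le> nat \<bar>c\<bar> ^ 2 * card A ^ 0"
    proof (cases "p dvd c")
      case True
      have "card {x \<in> {..<0} \<rightarrow>\<^sub>E A. \<forall>F\<in>\<F>. p dvd eval_poly F x} \<le> card ({..<0::nat} \<rightarrow>\<^sub>E A)"
        using A(2) by (intro card_mono) auto
      then have "card {x \<in> {..<0} \<rightarrow>\<^sub>E A. \<forall>F\<in>\<F>. p dvd eval_poly F x} * card A ^ 2 \<le> 1 * nat \<bar>c\<bar> ^ 2"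
        using modulus_le_of_dvd[OF disjI2[OF A(1)] A(3) True c(2)]
        by (intro mult_mono power_mono) auto
      then show ?thesis by simp
    next
      case False
      then have "{x \<in> {..<0} \<rightarrow>\<^sub>E A. \<forall>F\<in>\<F>. p dvd eval_poly F x} = {}"
        using c(1) by force
      then show ?thesis
        by (simp only: card.empty)
    qed
  qed
next
  case (Suc n)
  define \<F>' where "\<F>' = last_var_coeffs n \<F>"
  have "finite \<F>'" "\<F>' \<subseteq> polys n" "coprime_in n (rat_poly ` \<F>')"
    unfolding \<F>'_def using Suc.prems
    by (auto intro: finite_last_var_coeffs coprime_in_last_var_coeffs dest: last_var_coeffs_subset)
  from Suc.IH[OF this] obtain C where C: "\<And>p A. prime p \<Longrightarrow> finite A \<Longrightarrow> inj_on (\<lambda>a. a mod p) A \<Longrightarrow>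
    card {x \<in> {..<n} \<rightarrow>\<^sub>E A. \<forall>F\<in>\<F>'. p dvd eval_poly F x} * card A ^ 2 \<le> C * card A ^ n"
    by blast
  obtain R B where R: "R \<in> polys n" "R \<noteq> 0" "R = (\<Sum>F\<in>\<F>. B F * F)"
    using elimination[OF Suc.prems] .
  obtain C' where C': "\<And>q A. (q = 0 \<or> prime q) \<Longrightarrow> finite A \<Longrightarrow> inj_on (\<lambda>a. a mod q) A \<Longrightarrow>
    card {y \<in> {..<n} \<rightarrow>\<^sub>E A. q dvd eval_poly R y} * card A \<le> C' * card A ^ n"
    using card_zeros_mod[OF R(1,2)] by blast
  define D where "D = (\<Sum>F\<in>\<F>. degree (uni n F))"
  show ?case
  proof (intro exI[of _ "C + C' * D"] allI impI)
    fix p :: int and A :: "int set"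
    assume A: "prime p" "finite A" "inj_on (\<lambda>a. a mod p) A"
    let ?Y = "{..<n} \<rightarrow>\<^sub>E A"
    let ?K = "\<lambda>y. {t \<in> A. \<forall>F\<in>\<F>. p dvd eval_poly F (y(n := t))}"
    have "card {x \<in> {..<Suc n} \<rightarrow>\<^sub>E A. \<forall>F\<in>\<F>. p dvd eval_poly F x} = (\<Sum>y\<in>?Y. card (?K y))"
      using A(2) by (rule card_points_Suc)
    also have "\<dots> \<le> (\<Sum>y\<in>?Y. (if \<forall>F\<in>\<F>'. p dvd eval_poly F y then card A else 0) +
        (if p dvd eval_poly R y then D else 0))"
    proof (rule sum_mono)
      fix y assume "y \<in> ?Y"
      consider "\<forall>F\<in>\<F>'. p dvd eval_poly F y" | "?K y = {}" |
        "\<not> (\<forall>F\<in>\<F>'. p dvd eval_poly F y)" "?K y \<noteq> {}"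
        by blast
      then show "card (?K y) \<le> (if \<forall>F\<in>\<F>'. p dvd eval_poly F y then card A else 0) +
        (if p dvd eval_poly R y then D else 0)"
      proof cases
        case 1
        then show ?thesis
          using A(2) card_mono[of A "?K y"] by auto
      next
        case 2
        then show ?thesis
          by (simp only: card.empty)
      next
        case 3
        have "card (?K y) \<le> D"
          using 3(1) A Suc.prems(1,2) unfolding D_def \<F>'_def by (blast intro: card_fibre)
        moreover have "p dvd eval_poly R y"
          using 3(2) dvd_eliminant_value[OF Suc.prems(2) R(1,3)] by blast
        ultimately show ?thesis by simp
      qed
    qed
    also have "\<dots> = card {y \<in> ?Y. \<forall>F\<in>\<F>'. p dvd eval_poly F y} * card A + card {y \<in> ?Y. p dvd eval_poly R y} * D"
      using A(2) by (simp add: sum.distrib flip: sum.inter_filter)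
    finally have "card {x \<in> {..<Suc n} \<rightarrow>\<^sub>E A. \<forall>F\<in>\<F>. p dvd eval_poly F x} * card A ^ 2 \<le>
        (card {y \<in> ?Y. \<forall>F\<in>\<F>'. p dvd eval_poly F y} * card A + card {y \<in> ?Y. p dvd eval_poly R y} * D) * card A ^ 2"
      by (rule mult_right_mono) simp
    also have "\<dots> = (card {y \<in> ?Y. \<forall>F\<in>\<F>'. p dvd eval_poly F y} * card A ^ 2) * card A +
        (card {y \<in> ?Y. p dvd eval_poly R y} * card A) * (D * card A)"
      by (simp add: algebra_simps power2_eq_square)
    also have "\<dots> \<le> (C * card A ^ n) * card A + (C' * card A ^ n) * (D * card A)"
      using C[OF A] C'[of p A] A by (intro mult_right_mono add_mono) auto
    finally show "card {x \<in> {..<Suc n} \<rightarrow>\<^sub>E A. \<forall>F\<in>\<F>. p dvd eval_poly F x} * card A ^ 2 \<le> (C + C' * D) * card A ^ Suc n"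
      by (simp add: algebra_simps)
  qed
qed

lemma eval_poly_growth:
  assumes "R \<in> polys n"
  shows "\<exists>e. \<forall>k\<ge>1. \<forall>y. (\<forall>i<n. \<bar>y i\<bar> \<le> k) \<longrightarrow> \<bar>eval_poly R y\<bar> \<le> (2 * k + 1 :: int) ^ e"
  using assms
proof (induction R rule: polys_induct)
  case (const c)
  have "\<bar>c\<bar> \<le> (2 * k + 1) ^ nat \<bar>c\<bar>" if "k \<ge> 1" for k :: int
  proof -
    have "int (nat \<bar>c\<bar>) < 2 ^ nat \<bar>c\<bar>"
      by (rule of_nat_less_two_power)
    also have "(2::int) ^ nat \<bar>c\<bar> \<le> (2 * k + 1) ^ nat \<bar>c\<bar>"
      using that by (intro power_mono) auto
    finally show ?thesis by simp
  qed
  then show ?case by auto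
next
  case (var i)
  show ?case
    using var by (intro exI[of _ 1]) fastforce
next
  case (add p q)
  then obtain e e' where e: "\<And>k y. k \<ge> 1 \<Longrightarrow> (\<forall>i<n. \<bar>y i\<bar> \<le> k) \<Longrightarrow> \<bar>eval_poly p y\<bar> \<le> (2 * k + 1) ^ e"
    and e': "\<And>k y. k \<ge> 1 \<Longrightarrow> (\<forall>i<n. \<bar>y i\<bar> \<le> k) \<Longrightarrow> \<bar>eval_poly q y\<bar> \<le> (2 * k + 1) ^ e'"
    by blast
  show ?case
  proof (intro exI[of _ "Suc (e + e')"] allI impI)
    fix k :: int and y assume k: "k \<ge> 1" "\<forall>i<n. \<bar>y i\<bar> \<le> k"
    have "\<bar>eval_poly (p + q) y\<bar> \<le> (2 * k + 1) ^ e + (2 * k + 1) ^ e'"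
      using e[OF k] e'[OF k] by simp
    also have "\<dots> \<le> (2 * k + 1) ^ (e + e') + (2 * k + 1) ^ (e + e')"
      using k by (intro add_mono power_increasing) auto
    also have "\<dots> = 2 * (2 * k + 1) ^ (e + e')"
      by simp
    also have "\<dots> \<le> (2 * k + 1) * (2 * k + 1) ^ (e + e')"
      using k by (intro mult_right_mono) auto
    finally show "\<bar>eval_poly (p + q) y\<bar> \<le> (2 * k + 1) ^ Suc (e + e')"
      by simp
  qed
next
  case (mult p q)
  then obtain e e' where e: "\<And>k y. k \<ge> 1 \<Longrightarrow> (\<forall>i<n. \<bar>y i\<bar> \<le> k) \<Longrightarrow> \<bar>eval_poly p y\<bar> \<le> (2 * k + 1) ^ e"
    and e': "\<And>k y. k \<ge> 1 \<Longrightarrow> (\<forall>i<n. \<bar>y i\<bar> \<le> k) \<Longrightarrow> \<bar>eval_poly q y\<bar> \<le> (2 * k + 1) ^ e'"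
    by blast
  show ?case
  proof (intro exI[of _ "e + e'"] allI impI)
    fix k :: int and y assume k: "k \<ge> 1" "\<forall>i<n. \<bar>y i\<bar> \<le> k"
    show "\<bar>eval_poly (p * q) y\<bar> \<le> (2 * k + 1) ^ (e + e')"
      using e[OF k] e'[OF k] k by (simp add: abs_mult power_add mult_mono)
  qed
qed

text \<open>
  The product of these primes divides \<open>r\<close>, and each of them contributes a factor larger than \<open>b\<close>.
\<close>

lemma card_large_prime_factors:
  fixes r b :: int
  assumes r: "r \<noteq> 0" "\<bar>r\<bar> \<le> b ^ e" and b: "1 < b"
  shows "finite {p. prime p \<and> b < p \<and> p dvd r} \<and> card {p. prime p \<and> b < p \<and> p dvd r} \<le> e"
proof -
  let ?S = "{p. prime p \<and> b < p \<and> p dvd r}"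
  have fin: "finite ?S"
    using r(1) by (intro finite_subset[OF _ finite_divisors_int[OF r(1)]]) auto
  have "\<Prod>S dvd r" if "finite S" "S \<subseteq> ?S" for S
    using that
  proof (induction S)
    case (insert p S)
    then have "coprime p (\<Prod>S)"
      by (intro prod_coprime_right primes_coprime) auto
    then show ?case
      using insert by (simp add: divides_mult)
  qed simp
  then have "\<Prod>?S dvd r"
    using fin by blast
  then have "\<Prod>?S \<le> \<bar>r\<bar>"
    using dvd_imp_le_int[OF r(1)] abs_ge_self order.trans by blast
  moreover have "b ^ card ?S \<le> \<Prod>?S"
    using prod_mono[of ?S "\<lambda>_. b" "\<lambda>p. p"] b by simp
  ultimately have "b ^ card ?S \<le> b ^ e"
    using r(2) by linarith
  then show ?thesis
    using b fin by (simp add: power_le_imp_le_exp)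
qed

lemma inj_on_mod_box:
  assumes "2 * int k + 1 \<le> p" shows "inj_on (\<lambda>a. a mod p) {- int k..int k}"
proof (rule inj_onI)
  fix a b assume ab: "a \<in> {- int k..int k}" "b \<in> {- int k..int k}" "a mod p = b mod p"
  then have "p dvd a - b"
    by (simp add: mod_eq_dvd_iff)
  then show "a = b"
    using ab assms dvd_imp_le_int[of "a - b" p] by fastforce
qed

text \<open>
  For primes beyond the side length of the box the residue count is of no use, as there are infinitely
  many of them.  Instead, for a given \<open>y\<close> with \<open>R y \<noteq> 0\<close>, only the boundedly many large
  prime factors of the value \<open>R y\<close>, which is polynomially bounded in \<open>k\<close>, can occur, and each contributes
  at most \<open>D\<close> points above \<open>y\<close>.
\<close>

theorem card_common_large_prime:
  assumes "finite \<F>" "\<F> \<subseteq> polys n" "coprime_in n (rat_poly ` \<F>)"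
  shows "\<exists>C. \<forall>k\<ge>1.
    card {x \<in> {..<n} \<rightarrow>\<^sub>E {- int k..int k}. \<exists>p. prime p \<and> 2 * int k + 1 < p \<and> (\<forall>F\<in>\<F>. p dvd eval_poly F x)} *
      (2 * k + 1) \<le> C * (2 * k + 1) ^ n"
  using assms
proof (induction n arbitrary: \<F>)
  case 0
  obtain c where c: "const_poly c \<in> \<F>" "c \<noteq> 0"
    using coprime_in_0 0 by blast
  show ?case
  proof (intro exI[of _ "nat \<bar>c\<bar>"] allI impI)
    fix k :: nat assume "k \<ge> 1"
    let ?S = "{x \<in> {..<0::nat} \<rightarrow>\<^sub>E {- int k..int k}. \<exists>p. prime p \<and> 2 * int k + 1 < p \<and> (\<forall>F\<in>\<F>. p dvd eval_poly F x)}"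
    show "card ?S * (2 * k + 1) \<le> nat \<bar>c\<bar> * (2 * k + 1) ^ 0"
    proof (cases "?S = {}")
      case True
      then show ?thesis
        by (simp only: card.empty)
    next
      case False
      then obtain p x where "2 * int k + 1 < p" "p dvd eval_poly (const_poly c) x"
        using c(1) by blast
      then have "2 * k + 1 \<le> nat \<bar>c\<bar>"
        using dvd_imp_le_int[OF c(2), of p] by simp
      moreover have "card ?S \<le> card ({..<0::nat} \<rightarrow>\<^sub>E {- int k..int k})"
        by (intro card_mono) auto
      then have "card ?S * (2 * k + 1) \<le> 1 * (2 * k + 1)"
        by (intro mult_right_mono) auto
      ultimately show ?thesis by simp
    qed
  qed
next
  case (Suc n)
  define \<F>' where "\<F>' = last_var_coeffs n \<F>"
  have "finite \<F>'" "\<F>' \<subseteq> polys n" "coprime_in n (rat_poly ` \<F>')"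
    unfolding \<F>'_def using Suc.prems
    by (auto intro: finite_last_var_coeffs coprime_in_last_var_coeffs dest: last_var_coeffs_subset)
  from Suc.IH[OF this] obtain C where C: "\<And>k. k \<ge> 1 \<Longrightarrow>
    card {x \<in> {..<n} \<rightarrow>\<^sub>E {- int k..int k}. \<exists>p. prime p \<and> 2 * int k + 1 < p \<and> (\<forall>F\<in>\<F>'. p dvd eval_poly F x)} *
      (2 * k + 1) \<le> C * (2 * k + 1) ^ n"
    by blast
  obtain R B where R: "R \<in> polys n" "R \<noteq> 0" "R = (\<Sum>F\<in>\<F>. B F * F)"
    using elimination[OF Suc.prems] .
  obtain C' where C': "\<And>q A. (q = 0 \<or> prime q) \<Longrightarrow> finite A \<Longrightarrow> inj_on (\<lambda>a. a mod q) A \<Longrightarrow>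
    card {y \<in> {..<n} \<rightarrow>\<^sub>E A. q dvd eval_poly R y} * card A \<le> C' * card A ^ n"
    using card_zeros_mod[OF R(1,2)] by blast
  obtain e where e: "\<And>k y. k \<ge> 1 \<Longrightarrow> (\<forall>i<n. \<bar>y i\<bar> \<le> k) \<Longrightarrow> \<bar>eval_poly R y\<bar> \<le> (2 * k + 1) ^ e"
    using eval_poly_growth[OF R(1)] by blast
  define D where "D = (\<Sum>F\<in>\<F>. degree (uni n F))"
  show ?case
  proof (intro exI[of _ "C + C' + e * D"] allI impI)
    fix k :: nat assume k: "k \<ge> 1"
    define A where "A = {- int k..int k}"
    define b where "b = 2 * int k + 1"
    define m where "m = 2 * k + 1"
    have A: "finite A" "card A = m"
      by (auto simp: A_def m_def)
    let ?Y = "{..<n} \<rightarrow>\<^sub>E A"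
    let ?P = "\<lambda>\<F> x. \<exists>p. prime p \<and> b < p \<and> (\<forall>F\<in>\<F>. p dvd eval_poly F x)"
    let ?K = "\<lambda>y. {t \<in> A. ?P \<F> (y(n := t))}"
    have "card {x \<in> {..<Suc n} \<rightarrow>\<^sub>E A. ?P \<F> x} = (\<Sum>y\<in>?Y. card (?K y))"
      using A(1) by (rule card_points_Suc)
    also have "\<dots> \<le> (\<Sum>y\<in>?Y. (if ?P \<F>' y then m else 0) + (if 0 dvd eval_poly R y then m else 0) + e * D)"
    proof (rule sum_mono)
      fix y assume y: "y \<in> ?Y"
      have K: "card (?K y) \<le> m"
        using A card_mono[of A "?K y"] by auto
      show "card (?K y) \<le> (if ?P \<F>' y then m else 0) + (if 0 dvd eval_poly R y then m else 0) + e * D"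
      proof (cases "?P \<F>' y \<or> eval_poly R y = 0")
        case True
        then show ?thesis
          using K by auto
      next
        case False
        let ?Q = "{p. prime p \<and> b < p \<and> p dvd eval_poly R y}"
        have bound: "\<bar>eval_poly R y\<bar> \<le> b ^ e"
        proof -
          have "\<forall>i<n. \<bar>y i\<bar> \<le> int k"
            using PiE_mem[OF y] by (fastforce simp: A_def)
          then show ?thesis
            using e[of "int k" y] k by (simp add: b_def)
        qed
        have Q: "finite ?Q" "card ?Q \<le> e"
          using card_large_prime_factors[OF _ bound] False k by (auto simp: b_def)
        have "?K y \<subseteq> (\<Union>p\<in>?Q. {t \<in> A. \<forall>F\<in>\<F>. p dvd eval_poly F (y(n := t))})"
          using dvd_eliminant_value[OF Suc.prems(2) R(1,3)] by blast
        then have "card (?K y) \<le> card (\<Union>p\<in>?Q. {t \<in> A. \<forall>F\<in>\<F>. p dvd eval_poly F (y(n := t))})"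
          using Q A(1) by (intro card_mono) auto
        also have "\<dots> \<le> (\<Sum>p\<in>?Q. card {t \<in> A. \<forall>F\<in>\<F>. p dvd eval_poly F (y(n := t))})"
          using Q by (intro card_UN_le)
        also have "\<dots> \<le> (\<Sum>p\<in>?Q. D)"
        proof (rule sum_mono)
          fix p assume p: "p \<in> ?Q"
          then obtain G where "G \<in> last_var_coeffs n \<F>" "\<not> p dvd eval_poly G y"
            using False by (auto simp: \<F>'_def)
          moreover have "inj_on (\<lambda>a. a mod p) A"
            unfolding A_def using p by (intro inj_on_mod_box) (auto simp: b_def)
          ultimately show "card {t \<in> A. \<forall>F\<in>\<F>. p dvd eval_poly F (y(n := t))} \<le> D"
            unfolding D_def using p A(1) Suc.prems(1,2) by (intro card_fibre) auto
        qed
        also have "\<dots> \<le> e * D"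
          using Q by simp
        finally show ?thesis
          by simp
      qed
    qed
    also have "\<dots> = card {y \<in> ?Y. ?P \<F>' y} * m + card {y \<in> ?Y. 0 dvd eval_poly R y} * m + e * D * m ^ n"
      using A by (simp add: sum.distrib card_points flip: sum.inter_filter)
    also have "\<dots> \<le> C * m ^ n + C' * m ^ n + e * D * m ^ n"
      using C[OF k] C'[of 0 A] A by (intro add_mono) (simp_all add: A_def b_def m_def)
    finally have "card {x \<in> {..<Suc n} \<rightarrow>\<^sub>E A. ?P \<F> x} * m \<le> (C * m ^ n + C' * m ^ n + e * D * m ^ n) * m"
      by (rule mult_right_mono) simp
    then have "card {x \<in> {..<Suc n} \<rightarrow>\<^sub>E A. ?P \<F> x} * m \<le> (C + C' + e * D) * m ^ Suc n"
      by (simp add: algebra_simps)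
    then show "card {x \<in> {..<Suc n} \<rightarrow>\<^sub>E {- int k..int k}. \<exists>p. prime p \<and> 2 * int k + 1 < p \<and> (\<forall>F\<in>\<F>. p dvd eval_poly F x)} *
      (2 * k + 1) \<le> (C + C' + e * D) * (2 * k + 1) ^ Suc n"
      by (simp only: A_def b_def m_def)
  qed
qed

section \<open>Densities of periodic sets\<close>

lemma eval_poly_cong_mod:
  fixes Q :: int
  assumes "R \<in> polys n" "\<And>i. i < n \<Longrightarrow> x i mod Q = y i mod Q"
  shows "eval_poly R x mod Q = eval_poly R y mod Q"
  using assms(1)
proof (induction R rule: polys_induct)
  case (add p q)
  then show ?case by (metis eval_poly_simps(2) mod_add_cong)
next
  case (mult p q)
  then show ?case by (metis eval_poly_simps(3) mod_mult_cong)
qed (use assms(2) in simp_all)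

definition all_dvd :: "nat \<Rightarrow> (nat \<Rightarrow> int mpoly) \<Rightarrow> nat \<Rightarrow> (nat \<Rightarrow> int) \<Rightarrow> bool" where
  "all_dvd h F p x \<longleftrightarrow> (\<forall>j<h. int p dvd eval_poly (F j) x)"

lemma all_dvd_periodic:
  assumes "\<And>j. j < h \<Longrightarrow> F j \<in> polys d" "\<And>i. i < d \<Longrightarrow> x i mod int p = y i mod int p"
  shows "all_dvd h F p x \<longleftrightarrow> all_dvd h F p y"
  unfolding all_dvd_def using eval_poly_cong_mod[OF assms(1) assms(2)] by (simp add: dvd_eq_mod_eq_0)

lemma gcd_value_eq_1_iff: "gcd_value h F x = 1 \<longleftrightarrow> (\<forall>p. prime p \<longrightarrow> \<not> all_dvd h F p x)"
proof -
  have dvd: "all_dvd h F p x \<longleftrightarrow> int p dvd gcd_value h F x" for p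
    by (auto simp: all_dvd_def gcd_value_def dvd_Gcd_iff)
  show ?thesis
  proof
    assume "gcd_value h F x = 1"
    then show "\<forall>p. prime p \<longrightarrow> \<not> all_dvd h F p x"
      by (auto simp: dvd)
  next
    assume no: "\<forall>p. prime p \<longrightarrow> \<not> all_dvd h F p x"
    have nonneg: "gcd_value h F x \<ge> 0"
      by (simp add: gcd_value_def)
    have "nat (gcd_value h F x) = 1"
    proof (rule ccontr)
      assume "nat (gcd_value h F x) \<noteq> 1"
      then obtain p where p: "prime p" "p dvd nat (gcd_value h F x)"
        using prime_factor_nat by blast
      then have "int p dvd gcd_value h F x"
        using nonneg by (metis int_dvd_int_iff nat_0_le)
      then show False
        using no p dvd by blast
    qed
    then show "gcd_value h F x = 1"
      using nonneg by linarith
  qed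
qed

definition int_box :: "nat \<Rightarrow> nat \<Rightarrow> (nat \<Rightarrow> int) set" where
  "int_box d k = {..<d} \<rightarrow>\<^sub>E {- int k..int k}"

lemma finite_int_box [simp]: "finite (int_box d k)"
  by (simp add: int_box_def)

lemma card_int_box: "card (int_box d k) = (2 * k + 1) ^ d"
proof -
  have "nat (int k - (- int k) + 1) = 2 * k + 1"
    by simp
  then show ?thesis
    by (simp add: int_box_def card_points)
qed

lemma gcd_density_upto_eq:
  "gcd_density_upto d h F Z k = card {x \<in> int_box d k. gcd_value h F x \<in> Z} / real (2 * k + 1) ^ d"
proof -
  have "int_box d k \<noteq> {}"
    using card_int_box[of d k] by force
  then have "gcd_density_upto d h F Z k = card (int_box d k \<inter> {x. gcd_value h F x \<in> Z}) / card (int_box d k)"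
    unfolding gcd_density_upto_def int_box_def[symmetric] by (simp add: measure_pmf_of_set)
  also have "int_box d k \<inter> {x. gcd_value h F x \<in> Z} = {x \<in> int_box d k. gcd_value h F x \<in> Z}"
    by auto
  finally show ?thesis
    by (simp add: card_int_box)
qed

lemma residues_nonempty: "Q > 0 \<Longrightarrow> {..<d::nat} \<rightarrow>\<^sub>E {0..<Q::int} \<noteq> {}"
  by (auto simp: PiE_eq_empty_iff)

lemma gcd_density_mod_0_eq:
  assumes "p > 0"
  shows "gcd_density_mod d h F p {0} = card {x \<in> {..<d} \<rightarrow>\<^sub>E {0..<int p}. all_dvd h F p x} / real p ^ d"
proof -
  let ?S = "{..<d} \<rightarrow>\<^sub>E {0..<int p}"
  have "gcd_density_mod d h F p {0} = card (?S \<inter> {x. \<forall>j<h. [eval_poly (F j) x = 0] (mod int p)}) / card ?S"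
    unfolding gcd_density_mod_0 using assms residues_nonempty[of "int p" d] by (simp add: measure_pmf_of_set)
  also have "?S \<inter> {x. \<forall>j<h. [eval_poly (F j) x = 0] (mod int p)} = {x \<in> ?S. all_dvd h F p x}"
    by (auto simp: all_dvd_def cong_0_iff)
  finally show ?thesis
    by (simp add: card_points)
qed

lemma card_compl_points:
  assumes "finite S" shows "card {x \<in> S. \<not> Q x} + card {x \<in> S. Q x} = card S"
proof -
  have "card S = card ({x \<in> S. \<not> Q x} \<union> {x \<in> S. Q x})"
    by (rule arg_cong[where f = card]) auto
  also have "\<dots> = card {x \<in> S. \<not> Q x} + card {x \<in> S. Q x}"
    using assms by (intro card_Un_disjoint) auto
  finally show ?thesis by simp
qed

lemma gcd_density_mod_1_eq:
  assumes "prime p"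
  shows "gcd_density_mod d h F p {1} = card {x \<in> {..<d} \<rightarrow>\<^sub>E {0..<int p}. \<not> all_dvd h F p x} / real p ^ d"
proof -
  have p: "p > 0"
    using assms prime_gt_0_nat by blast
  have "card {x \<in> {..<d} \<rightarrow>\<^sub>E {0..<int p}. \<not> all_dvd h F p x} +
      card {x \<in> {..<d} \<rightarrow>\<^sub>E {0..<int p}. all_dvd h F p x} = p ^ d"
    by (subst card_compl_points) (auto simp: card_points)
  then have sum: "real (card {x \<in> {..<d} \<rightarrow>\<^sub>E {0..<int p}. \<not> all_dvd h F p x}) +
      real (card {x \<in> {..<d} \<rightarrow>\<^sub>E {0..<int p}. all_dvd h F p x}) = real p ^ d"
    by (simp only: of_nat_add[symmetric] of_nat_power[symmetric])
  have "1 - b / P = a / P" if "a + b = P" "P \<noteq> 0" for a b P :: real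
    using that by (auto simp: field_simps)
  from this[OF sum] show ?thesis
    unfolding gcd_density_mod_1[OF assms] gcd_density_mod_0_eq[OF p] using p by simp
qed

text \<open>
  A periodic set is a disjoint union of products of residue classes.
\<close>

lemma card_periodic:
  fixes Q :: int and d :: nat
  assumes A: "finite A" and Q: "Q > 0"
    and per: "\<And>x y. (\<And>i. i < d \<Longrightarrow> x i mod Q = y i mod Q) \<Longrightarrow> S x \<longleftrightarrow> S y"
  shows "card {x \<in> {..<d} \<rightarrow>\<^sub>E A. S x} =
    (\<Sum>r\<in>{r \<in> {..<d} \<rightarrow>\<^sub>E {0..<Q}. S r}. \<Prod>i<d. card {t \<in> A. t mod Q = r i})"
proof -
  let ?R = "{r \<in> {..<d} \<rightarrow>\<^sub>E {0..<Q}. S r}"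
  let ?T = "\<lambda>r. PiE {..<d} (\<lambda>i. {t \<in> A. t mod Q = r i})"
  have eq: "{x \<in> {..<d} \<rightarrow>\<^sub>E A. S x} = (\<Union>r\<in>?R. ?T r)"
  proof (intro equalityI subsetI)
    fix x assume x: "x \<in> {x \<in> {..<d} \<rightarrow>\<^sub>E A. S x}"
    define r where "r = (\<lambda>i\<in>{..<d}. x i mod Q)"
    have "S x \<longleftrightarrow> S r"
      by (rule per) (simp add: r_def)
    then have "r \<in> ?R"
      using x Q by (auto simp: r_def)
    moreover have "x \<in> ?T r"
      using x by (auto simp: r_def PiE_iff)
    ultimately show "x \<in> (\<Union>r\<in>?R. ?T r)"
      by blast
  next
    fix x assume "x \<in> (\<Union>r\<in>?R. ?T r)"
    then obtain r where r: "r \<in> {..<d} \<rightarrow>\<^sub>E {0..<Q}" "S r" "x \<in> ?T r"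
      by (elim UN_E CollectE conjE) (rule that)
    have "S x \<longleftrightarrow> S r"
    proof (rule per)
      fix i assume i: "i < d"
      have "x i mod Q = r i" "r i \<in> {0..<Q}"
        using PiE_mem[OF r(3), of i] PiE_mem[OF r(1), of i] i by auto
      then show "x i mod Q = r i mod Q"
        by simp
    qed
    then show "x \<in> {x \<in> {..<d} \<rightarrow>\<^sub>E A. S x}"
      using r(2) subsetD[OF PiE_mono r(3), of "\<lambda>_. A"] by simp
  qed
  have disj: "?T r \<inter> ?T r' = {}" if r: "r \<in> ?R" "r' \<in> ?R" "r \<noteq> r'" for r r'
  proof (rule Int_emptyI)
    fix x assume x: "x \<in> ?T r" "x \<in> ?T r'"
    have "r = r'"
    proof (rule PiE_ext)
      show "r \<in> {..<d} \<rightarrow>\<^sub>E {0..<Q}" "r' \<in> {..<d} \<rightarrow>\<^sub>E {0..<Q}"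
        using r by auto
      show "r i = r' i" if "i \<in> {..<d}" for i
        using PiE_mem[OF x(1) that] PiE_mem[OF x(2) that] by simp
    qed
    then show False
      using r(3) by simp
  qed
  have "card {x \<in> {..<d} \<rightarrow>\<^sub>E A. S x} = (\<Sum>r\<in>?R. card (?T r))"
    unfolding eq
  proof (intro card_UN_disjoint ballI impI disj)
    show "finite ?R"
      by (rule finite_subset[of _ "{..<d} \<rightarrow>\<^sub>E {0..<Q}"]) auto
    show "finite (?T r)" for r
      using A by (intro finite_PiE) auto
  qed
  then show ?thesis
    by (simp add: card_PiE)
qed

text \<open>
  The elements of the class are \<open>m * Q + r\<close> for the integers \<open>m\<close> in an interval of length
  \<open>2 * k / Q\<close>, whose number differs from this length by at most 1.
\<close>

lemma card_residue_class:
  fixes Q r :: int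
  assumes "Q > 0" "0 \<le> r" "r < Q"
  shows "\<bar>int (card {t \<in> {- int k..int k}. t mod Q = r}) * Q - (2 * int k + 1)\<bar> \<le> Q"
proof -
  let ?u = "(int k - r) div Q" and ?l = "(int k + r) div Q"
  have u: "?u * Q \<le> int k - r" "int k - r < ?u * Q + Q"
    using assms(1) div_mult_mod_eq[of "int k - r" Q] pos_mod_bound[of Q "int k - r"] pos_mod_sign[of Q "int k - r"] by linarith+
  have l: "?l * Q \<le> int k + r" "int k + r < ?l * Q + Q"
    using assms(1) div_mult_mod_eq[of "int k + r" Q] pos_mod_bound[of Q "int k + r"] pos_mod_sign[of Q "int k + r"] by linarith+
  have "{t \<in> {- int k..int k}. t mod Q = r} = (\<lambda>m. m * Q + r) ` {- ?l..?u}"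
  proof (intro equalityI subsetI)
    fix t assume "t \<in> {t \<in> {- int k..int k}. t mod Q = r}"
    then have t: "- int k \<le> t" "t \<le> int k" "t = (t div Q) * Q + r"
      using div_mult_mod_eq[of t Q] by auto
    have "(t div Q) * Q \<le> int k - r" "- (t div Q) * Q \<le> int k + r"
      using t by (simp_all add: algebra_simps)
    then have "t div Q \<le> ?u" "- (t div Q) \<le> ?l"
      using assms(1) zdiv_mono1[of "(t div Q) * Q" "int k - r" Q] zdiv_mono1[of "- (t div Q) * Q" "int k + r" Q]
      by (simp_all only: nonzero_mult_div_cancel_right[OF less_imp_neq[OF assms(1), symmetric]])
    then show "t \<in> (\<lambda>m. m * Q + r) ` {- ?l..?u}"
      using t(3) by (intro image_eqI[of _ _ "t div Q"]) auto
  next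
    fix t assume "t \<in> (\<lambda>m. m * Q + r) ` {- ?l..?u}"
    then obtain m where "m \<in> {- ?l..?u}" and mt: "t = m * Q + r"
      by blast
    then have m: "- ?l \<le> m" "m \<le> ?u"
      by simp_all
    have "m * Q \<le> ?u * Q" "- ?l * Q \<le> m * Q"
      using m assms(1) by (auto intro!: mult_right_mono simp del: mult_minus_left)
    then have "m * Q \<le> int k - r" "- int k - r \<le> m * Q"
      using u(1) l(1) by linarith+
    then show "t \<in> {t \<in> {- int k..int k}. t mod Q = r}"
      using mt assms by simp
  qed
  moreover have "inj_on (\<lambda>m. m * Q + r) {- ?l..?u}"
    using assms(1) by (auto simp: inj_on_def)
  ultimately have card: "card {t \<in> {- int k..int k}. t mod Q = r} = nat (?u + ?l + 1)"
    by (simp add: card_image add.commute)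
  have "?u \<ge> -1"
  proof (rule ccontr)
    assume "\<not> ?thesis"
    then have "?u * Q \<le> - 2 * Q"
      using assms(1) by (intro mult_right_mono) auto
    then show False
      using u(2) assms by linarith
  qed
  moreover have "?l \<ge> 0"
    using assms by (simp add: pos_imp_zdiv_nonneg_iff)
  ultimately have "int (card {t \<in> {- int k..int k}. t mod Q = r}) = ?u + ?l + 1"
    unfolding card by simp
  then have "int (card {t \<in> {- int k..int k}. t mod Q = r}) * Q = ?u * Q + ?l * Q + Q"
    by (simp add: algebra_simps)
  then show ?thesis
    using u l by linarith
qed

lemma tendsto_divide_side_length: "(\<lambda>k. c / real (2 * k + 1)) \<longlonglongrightarrow> 0"
  using LIMSEQ_subseq_LIMSEQ[OF lim_const_over_n[of c], of "\<lambda>k. 2 * k + 1"]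
  by (simp add: o_def strict_mono_def del: of_nat_add of_nat_mult)

lemma density_residue_class:
  fixes Q r :: int
  assumes "Q > 0" "0 \<le> r" "r < Q"
  shows "(\<lambda>k. card {t \<in> {- int k..int k}. t mod Q = r} / real (2 * k + 1)) \<longlonglongrightarrow> 1 / of_int Q"
proof -
  let ?c = "\<lambda>k. card {t \<in> {- int k..int k}. t mod Q = r}"
  have "(\<lambda>k. ?c k / real (2 * k + 1) - 1 / of_int Q) \<longlonglongrightarrow> 0"
  proof (rule tendsto_rabs_zero_cancel, rule tendsto_sandwich[OF _ _ tendsto_const tendsto_divide_side_length[of 1]])
    show "\<forall>\<^sub>F k in sequentially. \<bar>?c k / real (2 * k + 1) - 1 / of_int Q\<bar> \<le> 1 / real (2 * k + 1)"
    proof (rule always_eventually, rule allI)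
      fix k
      have "\<bar>real_of_int (int (?c k) * Q - (2 * int k + 1))\<bar> \<le> of_int Q"
        using card_residue_class[OF assms, of k] by (simp only: of_int_abs[symmetric] of_int_le_iff)
      then have *: "\<bar>real (?c k) * of_int Q - real (2 * k + 1)\<bar> \<le> of_int Q"
        by simp
      have Q: "real_of_int Q > 0"
        using assms by simp
      have "?c k / real (2 * k + 1) - 1 / of_int Q =
          (real (?c k) * of_int Q - real (2 * k + 1)) / (real (2 * k + 1) * of_int Q)"
        using Q by (simp add: field_simps del: of_nat_add of_nat_mult)
      then have "\<bar>?c k / real (2 * k + 1) - 1 / of_int Q\<bar> =
          \<bar>real (?c k) * of_int Q - real (2 * k + 1)\<bar> / (real (2 * k + 1) * of_int Q)"
        using Q by (simp add: abs_mult del: of_nat_add of_nat_mult)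
      also have "\<dots> \<le> of_int Q / (real (2 * k + 1) * of_int Q)"
        using * Q by (intro divide_right_mono) auto
      also have "\<dots> = 1 / real (2 * k + 1)"
        using Q by simp
      finally show "\<bar>?c k / real (2 * k + 1) - 1 / of_int Q\<bar> \<le> 1 / real (2 * k + 1)" .
    qed
  qed auto
  then show ?thesis
    by (simp add: LIM_zero_iff)
qed

lemma density_periodic:
  fixes Q :: int
  assumes Q: "Q > 0"
    and per: "\<And>x y. (\<And>i. i < d \<Longrightarrow> x i mod Q = y i mod Q) \<Longrightarrow> S x \<longleftrightarrow> S y"
  shows "(\<lambda>k. card {x \<in> int_box d k. S x} / real (2 * k + 1) ^ d) \<longlonglongrightarrow>
    card {r \<in> {..<d} \<rightarrow>\<^sub>E {0..<Q}. S r} / of_int Q ^ d"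
proof -
  let ?R = "{r \<in> {..<d} \<rightarrow>\<^sub>E {0..<Q}. S r}"
  have "card {x \<in> int_box d k. S x} / real (2 * k + 1) ^ d =
      (\<Sum>r\<in>?R. \<Prod>i<d. card {t \<in> {- int k..int k}. t mod Q = r i} / real (2 * k + 1))" for k
    unfolding int_box_def by (subst card_periodic[OF _ Q per]) (simp_all add: prod_dividef sum_divide_distrib)
  moreover have "(\<lambda>k. \<Sum>r\<in>?R. \<Prod>i<d. card {t \<in> {- int k..int k}. t mod Q = r i} / real (2 * k + 1)) \<longlonglongrightarrow>
      (\<Sum>r\<in>?R. \<Prod>i<d. 1 / of_int Q)"
  proof (intro tendsto_sum tendsto_prod density_residue_class Q)
    fix r i assume "r \<in> ?R" "i \<in> {..<d}"
    then have "r i \<in> {0..<Q}"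
      using PiE_mem[of r "{..<d}" "\<lambda>_. {0..<Q}" i] by simp
    then show "0 \<le> r i" "r i < Q"
      by auto
  qed
  ultimately show ?thesis
    by (simp add: power_one_over field_simps)
qed

text \<open>
  A residue class modulo \<open>p\<close> has at most \<open>2 * (2 * k + 1) / p\<close> elements in the interval because
  \<open>p\<close> does not exceed its length.
\<close>

lemma card_common_zeros_int_box:
  assumes "k \<ge> 1" "p > 0" "p \<le> 2 * k + 1" and F: "\<And>j. j < h \<Longrightarrow> F j \<in> polys d"
    and C: "card {x \<in> {..<d} \<rightarrow>\<^sub>E {0..<int p}. all_dvd h F p x} * p ^ 2 \<le> C * p ^ d"
  shows "card {x \<in> int_box d k. all_dvd h F p x} \<le> real C * 2 ^ d / real p ^ 2 * real (2 * k + 1) ^ d"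
proof -
  let ?R = "{r \<in> {..<d} \<rightarrow>\<^sub>E {0..<int p}. all_dvd h F p r}"
  have p: "int p > 0" "real p > 0"
    using assms by auto
  have "card {x \<in> int_box d k. all_dvd h F p x} =
      (\<Sum>r\<in>?R. \<Prod>i<d. card {t \<in> {- int k..int k}. t mod int p = r i})"
    unfolding int_box_def by (rule card_periodic[OF _ p(1)], simp, rule all_dvd_periodic[OF F])
  then have "real (card {x \<in> int_box d k. all_dvd h F p x}) =
      (\<Sum>r\<in>?R. \<Prod>i<d. real (card {t \<in> {- int k..int k}. t mod int p = r i}))"
    by simp
  also have "\<dots> \<le> (\<Sum>r\<in>?R. \<Prod>i<d. 2 * real (2 * k + 1) / real p)"
  proof (intro sum_mono prod_mono conjI)
    fix r i assume "r \<in> ?R" "i \<in> {..<d}"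
    then have r: "r i \<in> {0..<int p}"
      using PiE_mem[of r "{..<d}" "\<lambda>_. {0..<int p}" i] by simp
    have "int (card {t \<in> {- int k..int k}. t mod int p = r i}) * int p \<le> 2 * int (2 * k + 1)"
      using card_residue_class[OF p(1), of "r i" k] r assms(3) by simp
    then have "card {t \<in> {- int k..int k}. t mod int p = r i} * p \<le> 2 * (2 * k + 1)"
      by (metis of_nat_mult of_nat_le_iff of_nat_numeral)
    then have "real (card {t \<in> {- int k..int k}. t mod int p = r i}) * real p \<le> 2 * real (2 * k + 1)"
      by (metis of_nat_mult of_nat_le_iff of_nat_numeral)
    then show "real (card {t \<in> {- int k..int k}. t mod int p = r i}) \<le> 2 * real (2 * k + 1) / real p"
      using p by (simp add: pos_le_divide_eq)
  qed auto
  also have "\<dots> = real (card ?R) * (2 * real (2 * k + 1) / real p) ^ d"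
    by simp
  also have "\<dots> \<le> (C * real p ^ d / real p ^ 2) * (2 * real (2 * k + 1) / real p) ^ d"
  proof (rule mult_right_mono)
    have "real (card ?R) * real p ^ 2 \<le> real C * real p ^ d"
      using C unfolding of_nat_power[symmetric] of_nat_mult[symmetric] of_nat_le_iff .
    then show "real (card ?R) \<le> C * real p ^ d / real p ^ 2"
      using p by (simp add: pos_le_divide_eq)
  qed auto
  also have "\<dots> = real C * 2 ^ d / real p ^ 2 * real (2 * k + 1) ^ d"
  proof -
    have "real C * P / q * (2 * b / real p) ^ d = real C * 2 ^ d / q * b ^ d" if "P = real p ^ d" for P q b :: real
      using p(2) that by (simp add: power_divide power_mult_distrib)
    then show ?thesis
      by blast
  qed
  finally show ?thesis .
qed

lemma sum_inverse_squares_tail: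
  assumes "M \<ge> 1" shows "(\<Sum>n\<in>{M<..N}. 1 / real n ^ 2) \<le> 1 / real M"
proof (cases "M \<le> N")
  case True
  then have "(\<Sum>n\<in>{M<..N}. 1 / real n ^ 2) \<le> 1 / real M - 1 / real N"
  proof (induction N rule: dec_induct)
    case (step N)
    have "{M<..Suc N} = insert (Suc N) {M<..N}"
      using step by auto
    then have "(\<Sum>n\<in>{M<..Suc N}. 1 / real n ^ 2) = 1 / real (Suc N) ^ 2 + (\<Sum>n\<in>{M<..N}. 1 / real n ^ 2)"
      by simp
    also have "\<dots> \<le> 1 / real (Suc N) ^ 2 + (1 / real M - 1 / real N)"
      using step by simp
    also have "1 / real (Suc N) ^ 2 \<le> 1 / real N - 1 / real (Suc N)"
      using step assms by (simp add: divide_simps power2_eq_square)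
    finally show ?case
      by simp
  qed simp
  also have "\<dots> \<le> 1 / real M"
    by simp
  finally show ?thesis .
qed simp

text \<open>
  The Chinese remainder theorem, coordinate by coordinate.  Reduction modulo \<open>Q\<^sub>1\<close> and
  \<open>Q\<^sub>2\<close> is injective on the residues modulo \<open>Q\<^sub>1 * Q\<^sub>2\<close>, hence bijective because
  both sides have the same finite size.
\<close>

lemma card_residues_product:
  fixes Q\<^sub>1 Q\<^sub>2 :: int and d :: nat
  assumes Q: "Q\<^sub>1 > 0" "Q\<^sub>2 > 0" "coprime Q\<^sub>1 Q\<^sub>2"
    and S1: "\<And>x y. (\<And>i. i < d \<Longrightarrow> x i mod Q\<^sub>1 = y i mod Q\<^sub>1) \<Longrightarrow> S\<^sub>1 x \<longleftrightarrow> S\<^sub>1 y"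
    and S2: "\<And>x y. (\<And>i. i < d \<Longrightarrow> x i mod Q\<^sub>2 = y i mod Q\<^sub>2) \<Longrightarrow> S\<^sub>2 x \<longleftrightarrow> S\<^sub>2 y"
  shows "card {x \<in> {..<d} \<rightarrow>\<^sub>E {0..<Q\<^sub>1 * Q\<^sub>2}. S\<^sub>1 x \<and> S\<^sub>2 x} =
    card {x \<in> {..<d} \<rightarrow>\<^sub>E {0..<Q\<^sub>1}. S\<^sub>1 x} * card {x \<in> {..<d} \<rightarrow>\<^sub>E {0..<Q\<^sub>2}. S\<^sub>2 x}"
proof -
  let ?X = "{..<d} \<rightarrow>\<^sub>E {0..<Q\<^sub>1 * Q\<^sub>2}"
  let ?Y = "({..<d} \<rightarrow>\<^sub>E {0..<Q\<^sub>1}) \<times> ({..<d} \<rightarrow>\<^sub>E {0..<Q\<^sub>2})"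
  define f where "f = (\<lambda>x. ((\<lambda>i\<in>{..<d}. x i mod Q\<^sub>1), (\<lambda>i\<in>{..<d}. x i mod Q\<^sub>2)))"
  have inj: "inj_on f ?X"
  proof (rule inj_onI)
    fix x y assume xy: "x \<in> ?X" "y \<in> ?X" "f x = f y"
    show "x = y"
    proof (rule PiE_ext[OF xy(1,2)])
      fix i assume i: "i \<in> {..<d}"
      have "x i mod Q\<^sub>1 = y i mod Q\<^sub>1" "x i mod Q\<^sub>2 = y i mod Q\<^sub>2"
        using fun_cong[OF arg_cong[where f = fst, OF xy(3)], of i]
          fun_cong[OF arg_cong[where f = snd, OF xy(3)], of i] i
        by (simp_all add: f_def)
      then have "Q\<^sub>1 * Q\<^sub>2 dvd x i - y i"
        using Q(3) by (intro divides_mult) (simp_all add: mod_eq_dvd_iff)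
      then have "x i mod (Q\<^sub>1 * Q\<^sub>2) = y i mod (Q\<^sub>1 * Q\<^sub>2)"
        by (simp add: mod_eq_dvd_iff)
      then show "x i = y i"
        using PiE_mem[OF xy(1) i] PiE_mem[OF xy(2) i] by simp
    qed
  qed
  have sub: "f ` ?X \<subseteq> ?Y"
    using Q by (intro image_subsetI) (simp add: f_def)
  have "card (f ` ?X) = card ?Y"
    using Q by (simp add: card_image[OF inj] card_points card_cartesian_product nat_mult_distrib power_mult_distrib)
  then have surj: "f ` ?X = ?Y"
    using sub by (intro card_subset_eq) auto
  have S: "S\<^sub>1 (fst (f x)) \<longleftrightarrow> S\<^sub>1 x" "S\<^sub>2 (snd (f x)) \<longleftrightarrow> S\<^sub>2 x" for x
    unfolding f_def fst_conv snd_conv by (rule S1, simp) (rule S2, simp)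
  have "f ` {x \<in> ?X. S\<^sub>1 x \<and> S\<^sub>2 x} = {y \<in> ?Y. S\<^sub>1 (fst y) \<and> S\<^sub>2 (snd y)}"
    unfolding surj[symmetric]
  proof (intro equalityI subsetI)
    fix y assume "y \<in> f ` {x \<in> ?X. S\<^sub>1 x \<and> S\<^sub>2 x}"
    then obtain x where "y = f x" "x \<in> ?X" "S\<^sub>1 x" "S\<^sub>2 x"
      by (elim imageE CollectE conjE) (rule that)
    then show "y \<in> {y \<in> f ` ?X. S\<^sub>1 (fst y) \<and> S\<^sub>2 (snd y)}"
      using S[of x] by simp
  next
    fix y assume "y \<in> {y \<in> f ` ?X. S\<^sub>1 (fst y) \<and> S\<^sub>2 (snd y)}"
    then obtain x where "y = f x" "x \<in> ?X" "S\<^sub>1 (fst y)" "S\<^sub>2 (snd y)"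
      by (elim imageE CollectE conjE) (rule that)
    then show "y \<in> f ` {x \<in> ?X. S\<^sub>1 x \<and> S\<^sub>2 x}"
      using S[of x] by (intro image_eqI[of _ _ x]) simp_all
  qed
  also have "\<dots> = {x \<in> {..<d} \<rightarrow>\<^sub>E {0..<Q\<^sub>1}. S\<^sub>1 x} \<times> {x \<in> {..<d} \<rightarrow>\<^sub>E {0..<Q\<^sub>2}. S\<^sub>2 x}"
    by (rule set_eqI) (simp only: mem_Times_iff mem_Collect_eq conj_ac)
  finally have "card (f ` {x \<in> ?X. S\<^sub>1 x \<and> S\<^sub>2 x}) =
      card {x \<in> {..<d} \<rightarrow>\<^sub>E {0..<Q\<^sub>1}. S\<^sub>1 x} * card {x \<in> {..<d} \<rightarrow>\<^sub>E {0..<Q\<^sub>2}. S\<^sub>2 x}"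
    by (simp add: card_cartesian_product)
  moreover have "card (f ` {x \<in> ?X. S\<^sub>1 x \<and> S\<^sub>2 x}) = card {x \<in> ?X. S\<^sub>1 x \<and> S\<^sub>2 x}"
    by (rule card_image, rule inj_on_subset[OF inj]) blast
  ultimately show ?thesis
    by simp
qed

lemma card_residues_no_prime:
  assumes "finite Ps" "\<And>p. p \<in> Ps \<Longrightarrow> prime p" and F: "\<And>j. j < h \<Longrightarrow> F j \<in> polys d"
  shows "card {x \<in> {..<d} \<rightarrow>\<^sub>E {0..<int (\<Prod>Ps)}. \<forall>p\<in>Ps. \<not> all_dvd h F p x} =
    (\<Prod>p\<in>Ps. card {x \<in> {..<d} \<rightarrow>\<^sub>E {0..<int p}. \<not> all_dvd h F p x})"
  using assms(1,2)
proof (induction Ps)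
  case empty
  have "{x \<in> {..<d} \<rightarrow>\<^sub>E {0..<int (\<Prod>{})}. \<forall>p\<in>{}. \<not> all_dvd h F p x} = {..<d} \<rightarrow>\<^sub>E {0..<1}"
    by simp
  then show ?case
    by (simp only: card_points finite_atLeastLessThan_int card_atLeastLessThan_int) simp
next
  case (insert p Ps)
  have cop: "coprime p (\<Prod>Ps)"
    using insert by (intro prod_coprime_right primes_coprime) auto
  have pos: "\<Prod>Ps > 0" "p > 0"
    using insert by (auto intro!: prod_pos prime_gt_0_nat)
  have "{x \<in> {..<d} \<rightarrow>\<^sub>E {0..<int (\<Prod>(insert p Ps))}. \<forall>q\<in>insert p Ps. \<not> all_dvd h F q x} =
      {x \<in> {..<d} \<rightarrow>\<^sub>E {0..<int p * int (\<Prod>Ps)}. \<not> all_dvd h F p x \<and> (\<forall>q\<in>Ps. \<not> all_dvd h F q x)}"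
    using insert by simp
  also have "card \<dots> = card {x \<in> {..<d} \<rightarrow>\<^sub>E {0..<int p}. \<not> all_dvd h F p x} *
      card {x \<in> {..<d} \<rightarrow>\<^sub>E {0..<int (\<Prod>Ps)}. \<forall>q\<in>Ps. \<not> all_dvd h F q x}"
  proof (rule card_residues_product)
    show "coprime (int p) (int (\<Prod>Ps))"
      using cop by (simp only: coprime_int_iff)
    show "(\<not> all_dvd h F p x) = (\<not> all_dvd h F p y)" if "\<And>i. i < d \<Longrightarrow> x i mod int p = y i mod int p" for x y
      using all_dvd_periodic[OF F that] by simp
    show "(\<forall>q\<in>Ps. \<not> all_dvd h F q x) = (\<forall>q\<in>Ps. \<not> all_dvd h F q y)"
      if xy: "\<And>i. i < d \<Longrightarrow> x i mod int (\<Prod>Ps) = y i mod int (\<Prod>Ps)" for x y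
    proof (intro ball_cong refl arg_cong[where f = Not] all_dvd_periodic F)
      fix q i assume "q \<in> Ps" "i < d"
      then have "int q dvd int (\<Prod>Ps)"
        using insert by auto
      then show "x i mod int q = y i mod int q"
        using xy[OF \<open>i < d\<close>] by (metis mod_mod_cancel)
    qed (rule F)
  qed (simp_all only: of_nat_0_less_iff pos)
  also have "\<dots> = (\<Prod>q\<in>insert p Ps. card {x \<in> {..<d} \<rightarrow>\<^sub>E {0..<int q}. \<not> all_dvd h F q x})"
    using insert by simp
  finally show ?case .
qed

section \<open>The sieve for coprime families\<close>

lemma rel_prime_over_Q_iff_coprime_in:
  "rel_prime_over_Q d h F \<longleftrightarrow> coprime_in d (rat_poly ` F ` {..<h})"
  unfolding rel_prime_over_Q_def coprime_in_def by (simp add: Ball_def[of "{..<h}"])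

lemma all_dvd_iff_image: "(\<forall>P\<in>F ` {..<h}. int p dvd eval_poly P x) \<longleftrightarrow> all_dvd h F p x"
  by (auto simp: all_dvd_def)

locale coprime_family =
  fixes d h :: nat and F :: "nat \<Rightarrow> int mpoly"
  assumes F: "\<And>j. j < h \<Longrightarrow> F j \<in> polys d"
    and coprime: "coprime_in d (rat_poly ` F ` {..<h})"
begin

lemma family: "finite (F ` {..<h})" "F ` {..<h} \<subseteq> polys d"
  using F by auto

lemma card_common_zeros_residues:
  "\<exists>C. \<forall>p. prime p \<longrightarrow> card {x \<in> {..<d} \<rightarrow>\<^sub>E {0..<int p}. all_dvd h F p x} * p ^ 2 \<le> C * p ^ d"
proof -
  obtain C where C: "\<And>p A. prime p \<Longrightarrow> finite A \<Longrightarrow> inj_on (\<lambda>a. a mod p) A \<Longrightarrow>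
    card {x \<in> {..<d} \<rightarrow>\<^sub>E A. \<forall>P\<in>F ` {..<h}. p dvd eval_poly P x} * card A ^ 2 \<le> C * card A ^ d"
    using card_common_zeros_mod[OF family coprime] by blast
  have "card {x \<in> {..<d} \<rightarrow>\<^sub>E {0..<int p}. all_dvd h F p x} * p ^ 2 \<le> C * p ^ d" if "prime p" for p
  proof -
    have "inj_on (\<lambda>a. a mod int p) {0..<int p}"
      by (rule inj_onI) simp
    then show ?thesis
      using C[of "int p" "{0..<int p}"] that unfolding all_dvd_iff_image by simp
  qed
  then show ?thesis
    by blast
qed

lemma gcd_density_mod_0_bound:
  "\<exists>C. \<forall>p. prime p \<longrightarrow> gcd_density_mod d h F p {0} \<le> C / real p ^ 2"
proof -
  obtain C where C: "\<And>p. prime p \<Longrightarrow> card {x \<in> {..<d} \<rightarrow>\<^sub>E {0..<int p}. all_dvd h F p x} * p ^ 2 \<le> C * p ^ d"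
    using card_common_zeros_residues by blast
  have "gcd_density_mod d h F p {0} \<le> real C / real p ^ 2" if p: "prime p" for p
  proof -
    let ?N = "card {x \<in> {..<d} \<rightarrow>\<^sub>E {0..<int p}. all_dvd h F p x}"
    have pos: "p > 0"
      using p prime_gt_0_nat by blast
    have "real ?N * real p ^ 2 \<le> real C * real p ^ d"
      using C[OF p] unfolding of_nat_power[symmetric] of_nat_mult[symmetric] of_nat_le_iff .
    moreover have "N / P \<le> c / q" if "N * q \<le> c * P" "P > 0" "q > 0" for N P c q :: real
      using that by (simp add: field_simps)
    ultimately show ?thesis
      unfolding gcd_density_mod_0_eq[OF pos] using pos by simp
  qed
  then show ?thesis by blast
qed

text \<open>
  Primes up to the side length \<open>m\<close> of the box are handled one by one through the count of common zeros
  modulo \<open>p\<close>, with \<open>\<Sum>p>M. 1 / p\<^sup>2 \<le> 1 / M\<close>; all the primes beyond \<open>m\<close> are handled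
  together by \<open>card_common_large_prime\<close>.
\<close>

lemma card_tail:
  "\<exists>C\<^sub>1 C\<^sub>2 :: real. \<forall>k\<ge>1. \<forall>M\<ge>1.
     card {x \<in> int_box d k. \<exists>p. prime p \<and> M < p \<and> all_dvd h F p x} \<le>
       (C\<^sub>1 / real M + C\<^sub>2 / real (2 * k + 1)) * real (2 * k + 1) ^ d"
proof -
  obtain C where C: "\<And>p. prime p \<Longrightarrow> card {x \<in> {..<d} \<rightarrow>\<^sub>E {0..<int p}. all_dvd h F p x} * p ^ 2 \<le> C * p ^ d"
    using card_common_zeros_residues by blast
  obtain C' where C': "\<And>k. k \<ge> 1 \<Longrightarrow>
    card {x \<in> {..<d} \<rightarrow>\<^sub>E {- int k..int k}. \<exists>p. prime p \<and> 2 * int k + 1 < p \<and> (\<forall>P\<in>F ` {..<h}. p dvd eval_poly P x)} *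
      (2 * k + 1) \<le> C' * (2 * k + 1) ^ d"
    using card_common_large_prime[OF family coprime] by blast
  show ?thesis
  proof (rule exI[of _ "real C * 2 ^ d"], rule exI[of _ "real C'"], intro allI impI)
    fix k M :: nat assume k: "k \<ge> 1" and M: "M \<ge> 1"
    define m where "m = 2 * k + 1"
    define B where "B = real m ^ d"
    have m: "real m > 0"
      by (simp add: m_def)
    let ?Z = "\<lambda>p. {x \<in> int_box d k. all_dvd h F p x}"
    let ?L = "{x \<in> int_box d k. \<exists>p. prime p \<and> m < p \<and> all_dvd h F p x}"
    let ?Ps = "{p \<in> {M<..m}. prime p}"
    have "{x \<in> int_box d k. \<exists>p. prime p \<and> M < p \<and> all_dvd h F p x} \<subseteq> (\<Union>p\<in>?Ps. ?Z p) \<union> ?L"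
    proof
      fix x assume "x \<in> {x \<in> int_box d k. \<exists>p. prime p \<and> M < p \<and> all_dvd h F p x}"
      then obtain p where "x \<in> int_box d k" "prime p" "M < p" "all_dvd h F p x"
        by blast
      then show "x \<in> (\<Union>p\<in>?Ps. ?Z p) \<union> ?L"
        by (cases "p \<le> m") auto
    qed
    then have "card {x \<in> int_box d k. \<exists>p. prime p \<and> M < p \<and> all_dvd h F p x} \<le> card ((\<Union>p\<in>?Ps. ?Z p) \<union> ?L)"
      by (intro card_mono) auto
    also have "\<dots> \<le> card (\<Union>p\<in>?Ps. ?Z p) + card ?L"
      by (rule card_Un_le)
    also have "card (\<Union>p\<in>?Ps. ?Z p) \<le> (\<Sum>p\<in>?Ps. card (?Z p))"
      by (rule card_UN_le) simp
    finally have "real (card {x \<in> int_box d k. \<exists>p. prime p \<and> M < p \<and> all_dvd h F p x}) \<le>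
        real ((\<Sum>p\<in>?Ps. card (?Z p)) + card ?L)"
      by (simp only: of_nat_le_iff)
    also have "\<dots> = (\<Sum>p\<in>?Ps. real (card (?Z p))) + real (card ?L)"
      by simp
    also have "(\<Sum>p\<in>?Ps. real (card (?Z p))) \<le> (\<Sum>p\<in>?Ps. real C * 2 ^ d / real p ^ 2 * B)"
    proof (rule sum_mono)
      fix p assume p: "p \<in> ?Ps"
      show "real (card (?Z p)) \<le> real C * 2 ^ d / real p ^ 2 * B"
        unfolding B_def m_def using p k
        by (intro card_common_zeros_int_box F C) (auto simp: m_def)
    qed
    also have "\<dots> \<le> (\<Sum>p\<in>{M<..m}. real C * 2 ^ d / real p ^ 2 * B)"
      by (intro sum_mono2) (auto simp: B_def)
    also have "\<dots> = real C * 2 ^ d * B * (\<Sum>p\<in>{M<..m}. 1 / real p ^ 2)"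
      by (simp add: sum_distrib_left mult_ac)
    also have "\<dots> \<le> real C * 2 ^ d * B * (1 / real M)"
      by (intro mult_left_mono sum_inverse_squares_tail M) (simp add: B_def)
    also have "real (card ?L) \<le> real C' / real m * B"
    proof -
      have "?L \<subseteq> {x \<in> {..<d} \<rightarrow>\<^sub>E {- int k..int k}. \<exists>p. prime p \<and> 2 * int k + 1 < p \<and> (\<forall>P\<in>F ` {..<h}. p dvd eval_poly P x)}"
      proof
        fix x assume "x \<in> ?L"
        then obtain p where p: "x \<in> int_box d k" "prime p" "m < p" "all_dvd h F p x"
          by blast
        then have "prime (int p)" "2 * int k + 1 < int p" "\<forall>P\<in>F ` {..<h}. int p dvd eval_poly P x"
          unfolding all_dvd_iff_image by (simp_all add: m_def)
        then show "x \<in> {x \<in> {..<d} \<rightarrow>\<^sub>E {- int k..int k}. \<exists>p. prime p \<and> 2 * int k + 1 < p \<and> (\<forall>P\<in>F ` {..<h}. p dvd eval_poly P x)}"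
          using p(1) unfolding int_box_def by blast
      qed
      then have "card ?L \<le> card {x \<in> {..<d} \<rightarrow>\<^sub>E {- int k..int k}. \<exists>p. prime p \<and> 2 * int k + 1 < p \<and> (\<forall>P\<in>F ` {..<h}. p dvd eval_poly P x)}"
        by (intro card_mono) auto
      then have "card ?L * m \<le> C' * m ^ d"
        using C'[OF k] unfolding m_def by (meson mult_right_mono order_trans zero_le)
      then have "real (card ?L) * real m \<le> real C' * B"
        unfolding B_def of_nat_power[symmetric] of_nat_mult[symmetric] of_nat_le_iff .
      then show ?thesis
        using m by (simp add: pos_le_divide_eq)
    qed
    finally have "real (card {x \<in> int_box d k. \<exists>p. prime p \<and> M < p \<and> all_dvd h F p x}) \<le>
        (real C * 2 ^ d / real M + real C' / real m) * B"
      by (simp add: algebra_simps)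
    then show "real (card {x \<in> int_box d k. \<exists>p. prime p \<and> M < p \<and> all_dvd h F p x}) \<le>
       (real C * 2 ^ d / real M + real C' / real (2 * k + 1)) * real (2 * k + 1) ^ d"
      by (simp only: m_def B_def)
  qed
qed

definition local_factor :: "nat \<Rightarrow> real" where
  "local_factor p = (if prime p then gcd_density_mod d h F p {1} else 1)"

lemma convergent_prod_local_factor: "convergent_prod local_factor"
proof -
  obtain C where C: "\<And>p. prime p \<Longrightarrow> gcd_density_mod d h F p {0} \<le> C / real p ^ 2"
    using gcd_density_mod_0_bound by blast
  have "summable (\<lambda>p. norm (local_factor p - 1))"
  proof (rule summable_comparison_test)
    show "summable (\<lambda>p. \<bar>C\<bar> * (1 / real p ^ 2))"
      using inverse_power_summable[of 2, where 'a = real] by (intro summable_mult) (simp add: inverse_eq_divide)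
    have "norm (norm (local_factor p - 1)) \<le> \<bar>C\<bar> * (1 / real p ^ 2)" for p
    proof (cases "prime p")
      case True
      have "0 \<le> gcd_density_mod d h F p {0}"
        by (simp add: gcd_density_mod_def)
      moreover have "C / real p ^ 2 \<le> \<bar>C\<bar> / real p ^ 2"
        by (intro divide_right_mono) auto
      ultimately show ?thesis
        using C[OF True] gcd_density_mod_1[OF True, of d h F] True by (simp add: local_factor_def)
    next
      case False
      then show ?thesis
        by (simp add: local_factor_def)
    qed
    then show "\<exists>N. \<forall>p\<ge>N. norm (norm (local_factor p - 1)) \<le> \<bar>C\<bar> * (1 / real p ^ 2)"
      by blast
  qed
  then show ?thesis
    by (intro abs_convergent_prod_imp_convergent_prod summable_imp_abs_convergent_prod)
qed

lemma density_small_primes: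
  "(\<lambda>k. card {x \<in> int_box d k. \<forall>p\<le>M. prime p \<longrightarrow> \<not> all_dvd h F p x} / real (2 * k + 1) ^ d) \<longlonglongrightarrow>
     (\<Prod>p\<le>M. local_factor p)"
proof -
  define Ps where "Ps = {p. prime p \<and> p \<le> M}"
  define Q where "Q = \<Prod>Ps"
  have Ps: "finite Ps" "\<And>p. p \<in> Ps \<Longrightarrow> prime p"
    by (auto simp: Ps_def)
  have Q: "Q > 0"
    unfolding Q_def using Ps by (auto intro!: prod_pos prime_gt_0_nat)
  let ?S = "\<lambda>x. \<forall>p\<in>Ps. \<not> all_dvd h F p x"
  have "(\<lambda>k. card {x \<in> int_box d k. ?S x} / real (2 * k + 1) ^ d) \<longlonglongrightarrow>
      card {r \<in> {..<d} \<rightarrow>\<^sub>E {0..<int Q}. ?S r} / of_int (int Q) ^ d"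
  proof (rule density_periodic)
    show "?S x = ?S y" if xy: "\<And>i. i < d \<Longrightarrow> x i mod int Q = y i mod int Q" for x y
    proof (intro ball_cong refl arg_cong[where f = Not] all_dvd_periodic)
      fix p i assume "p \<in> Ps" "i < d"
      then have "int p dvd int Q"
        unfolding Q_def int_dvd_int_iff using Ps by (intro dvd_prodI)
      then show "x i mod int p = y i mod int p"
        using xy[OF \<open>i < d\<close>] by (metis mod_mod_cancel)
    qed (rule F)
  qed (use Q in simp)
  also have "card {r \<in> {..<d} \<rightarrow>\<^sub>E {0..<int Q}. ?S r} / of_int (int Q) ^ d = (\<Prod>p\<in>Ps. local_factor p)"
  proof -
    have "real (card {r \<in> {..<d} \<rightarrow>\<^sub>E {0..<int Q}. ?S r}) =
        (\<Prod>p\<in>Ps. real (card {x \<in> {..<d} \<rightarrow>\<^sub>E {0..<int p}. \<not> all_dvd h F p x}))"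
      unfolding Q_def by (subst card_residues_no_prime[OF Ps F]) simp_all
    moreover have "real_of_int (int Q) ^ d = (\<Prod>p\<in>Ps. real p ^ d)"
      by (simp add: Q_def prod_power_distrib)
    ultimately show ?thesis
      by (simp add: local_factor_def gcd_density_mod_1_eq Ps(2) prod_dividef)
  qed
  also have "\<dots> = (\<Prod>p\<le>M. local_factor p)"
    by (rule prod.mono_neutral_left) (auto simp: Ps_def local_factor_def)
  also have "(\<lambda>k. card {x \<in> int_box d k. ?S x} / real (2 * k + 1) ^ d) =
      (\<lambda>k. card {x \<in> int_box d k. \<forall>p\<le>M. prime p \<longrightarrow> \<not> all_dvd h F p x} / real (2 * k + 1) ^ d)"
    by (intro ext arg_cong2[where f = "(/)"] arg_cong[where f = card] arg_cong[where f = real]) (auto simp: Ps_def)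
  finally show ?thesis .
qed

text \<open>
  The points with gcd 1 differ from those without prime factors up to \<open>M\<close> only by points counted in
  \<open>card_tail\<close>.  That error is small uniformly in \<open>k\<close> when \<open>M\<close> is large, which permits to
  exchange the limits in \<open>k\<close> and \<open>M\<close>.
\<close>

theorem density_tendsto: "gcd_density_upto d h F {1} \<longlonglongrightarrow> prodinf local_factor"
proof -
  obtain C\<^sub>1 C\<^sub>2 :: real where tail: "\<And>k M. k \<ge> 1 \<Longrightarrow> M \<ge> 1 \<Longrightarrow>
     card {x \<in> int_box d k. \<exists>p. prime p \<and> M < p \<and> all_dvd h F p x} \<le>
       (C\<^sub>1 / real M + C\<^sub>2 / real (2 * k + 1)) * real (2 * k + 1) ^ d"
    using card_tail by blast
  define D where "D = (\<lambda>M k. card {x \<in> int_box d k. \<forall>p\<le>M. prime p \<longrightarrow> \<not> all_dvd h F p x} / real (2 * k + 1) ^ d)"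
  have close: "\<bar>gcd_density_upto d h F {1} k - D M k\<bar> \<le> C\<^sub>1 / real M + C\<^sub>2 / real (2 * k + 1)"
    if k: "k \<ge> 1" and M: "M \<ge> 1" for k M
  proof -
    let ?G = "{x \<in> int_box d k. gcd_value h F x \<in> {1}}"
    let ?S = "{x \<in> int_box d k. \<forall>p\<le>M. prime p \<longrightarrow> \<not> all_dvd h F p x}"
    let ?T = "{x \<in> int_box d k. \<exists>p. prime p \<and> M < p \<and> all_dvd h F p x}"
    define B where "B = real (2 * k + 1) ^ d"
    have B: "B > 0"
      by (simp add: B_def)
    have "?G \<subseteq> ?S" "?S \<subseteq> ?G \<union> ?T"
      by (auto simp: gcd_value_eq_1_iff not_le) (meson not_le)
    then have "card ?G \<le> card ?S" "card ?S \<le> card (?G \<union> ?T)"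
      by (auto intro!: card_mono)
    then have "card ?G \<le> card ?S" "card ?S \<le> card ?G + card ?T"
      using card_Un_le[of ?G ?T] by linarith+
    then have "\<bar>real (card ?G) - real (card ?S)\<bar> \<le> real (card ?T)"
      by linarith
    also have "\<dots> \<le> (C\<^sub>1 / real M + C\<^sub>2 / real (2 * k + 1)) * B"
      unfolding B_def using tail[OF k M] .
    finally have "\<bar>real (card ?G) - real (card ?S)\<bar> / B \<le> C\<^sub>1 / real M + C\<^sub>2 / real (2 * k + 1)"
      using B by (simp only: pos_divide_le_eq)
    then show ?thesis
      unfolding gcd_density_upto_eq D_def B_def[symmetric]
      using B by (simp add: diff_divide_distrib[symmetric])
  qed
  show ?thesis
  proof (rule LIMSEQ_I)
    fix \<epsilon> :: real assume \<epsilon>: "\<epsilon> > 0"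
    define \<delta> where "\<delta> = \<epsilon> / 4"
    have \<delta>: "\<delta> > 0" and \<epsilon>_eq: "\<epsilon> = 4 * \<delta>"
      using \<epsilon> by (simp_all add: \<delta>_def)
    have "(\<lambda>M. \<Prod>p\<le>M. local_factor p) \<longlonglongrightarrow> prodinf local_factor"
      by (rule convergent_prod_LIMSEQ[OF convergent_prod_local_factor])
    then have "\<forall>\<^sub>F M in sequentially. \<bar>(\<Prod>p\<le>M. local_factor p) - prodinf local_factor\<bar> < \<delta>"
      using \<delta> by (simp add: tendsto_iff dist_real_def)
    moreover have "\<forall>\<^sub>F M in sequentially. \<bar>C\<^sub>1 / real M\<bar> < \<delta>"
      using lim_const_over_n[of C\<^sub>1] \<delta> by (simp add: tendsto_iff dist_real_def)
    ultimately have "\<forall>\<^sub>F M in sequentially. \<bar>(\<Prod>p\<le>M. local_factor p) - prodinf local_factor\<bar> < \<delta> \<and>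
        \<bar>C\<^sub>1 / real M\<bar> < \<delta> \<and> M \<ge> 1"
      using eventually_ge_at_top[of "1::nat"] by eventually_elim auto
    then obtain M where M: "\<bar>(\<Prod>p\<le>M. local_factor p) - prodinf local_factor\<bar> < \<delta>"
        "\<bar>C\<^sub>1 / real M\<bar> < \<delta>" "M \<ge> 1"
      by (auto simp: eventually_sequentially)
    have "\<forall>\<^sub>F k in sequentially. \<bar>D M k - (\<Prod>p\<le>M. local_factor p)\<bar> < \<delta>"
      using density_small_primes[of M] \<delta> unfolding D_def by (simp add: tendsto_iff dist_real_def)
    moreover have "\<forall>\<^sub>F k in sequentially. \<bar>C\<^sub>2 / real (2 * k + 1)\<bar> < \<delta>"
      using tendsto_divide_side_length[of C\<^sub>2] \<delta> by (simp add: tendsto_iff dist_real_def)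
    ultimately have "\<forall>\<^sub>F k in sequentially. norm (gcd_density_upto d h F {1} k - prodinf local_factor) < \<epsilon>"
      using eventually_ge_at_top[of "1::nat"]
    proof eventually_elim
      case (elim k)
      then show ?case
        using close[OF elim(3) M(3)] M \<epsilon>_eq unfolding real_norm_def by linarith
    qed
    then show "\<exists>k0. \<forall>k\<ge>k0. norm (gcd_density_upto d h F {1} k - prodinf local_factor) < \<epsilon>"
      by (simp add: eventually_sequentially)
  qed
qed

lemma gcd_density_eq: "gcd_density d h F {1} = prodinf local_factor"
  unfolding gcd_density_def by (rule limI[OF density_tendsto])

end

lemma gcd_density_mod_1_eq_0_iff:
  assumes p: "prime p" and F: "\<And>j. j < h \<Longrightarrow> F j \<in> polys d"
  shows "gcd_density_mod d h F p {1} = 0 \<longleftrightarrow>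
    (\<forall>x \<in> {..<d} \<rightarrow>\<^sub>E (UNIV :: int set). \<forall>j<h. int p dvd eval_poly (F j) x)"
proof -
  have pos: "int p > 0"
    using prime_gt_0_nat[OF p] by simp
  let ?N = "{x \<in> {..<d} \<rightarrow>\<^sub>E {0..<int p}. \<not> all_dvd h F p x}"
  have "finite ?N"
    by (rule finite_subset[of _ "{..<d} \<rightarrow>\<^sub>E {0..<int p}"]) auto
  then have "gcd_density_mod d h F p {1} = 0 \<longleftrightarrow> ?N = {}"
    unfolding gcd_density_mod_1_eq[OF p] using pos by simp
  also have "\<dots> \<longleftrightarrow> (\<forall>x \<in> {..<d} \<rightarrow>\<^sub>E (UNIV :: int set). all_dvd h F p x)"
  proof
    assume N: "?N = {}"
    show "\<forall>x \<in> {..<d} \<rightarrow>\<^sub>E (UNIV :: int set). all_dvd h F p x"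
    proof
      fix x :: "nat \<Rightarrow> int"
      define r where "r = (\<lambda>i\<in>{..<d}. x i mod int p)"
      have "r \<in> {..<d} \<rightarrow>\<^sub>E {0..<int p}"
        unfolding r_def using pos by (simp add: restrict_PiE_iff)
      then have "all_dvd h F p r"
        using N by blast
      moreover have "all_dvd h F p x \<longleftrightarrow> all_dvd h F p r"
        by (rule all_dvd_periodic[OF F]) (simp_all add: r_def)
      ultimately show "all_dvd h F p x"
        by simp
    qed
  next
    assume all: "\<forall>x \<in> {..<d} \<rightarrow>\<^sub>E (UNIV :: int set). all_dvd h F p x"
    show "?N = {}"
    proof (rule equals0I)
      fix x assume "x \<in> ?N"
      then have "x \<in> {..<d} \<rightarrow>\<^sub>E UNIV" "\<not> all_dvd h F p x"
        using subsetD[OF PiE_mono[of "{..<d}" "\<lambda>_. {0..<int p}" "\<lambda>_. UNIV"]] by simp_all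
      then show False
        using all by blast
    qed
  qed
  finally show ?thesis
    by (simp only: all_dvd_def)
qed

section \<open>Families with a common factor\<close>

lemma clear_denominators:
  obtains N :: int and P where "N \<noteq> 0" "rat_poly P = const_poly (rat_of_int N) * p"
proof -
  have "\<exists>N P. N \<noteq> 0 \<and> rat_poly P = const_poly (rat_of_int N) * p"
  proof (induction p rule: mpoly_induct)
    case (const c)
    obtain a b where ab: "quotient_of c = (a, b)"
      by (cases "quotient_of c")
    have b: "b \<noteq> 0" "c = rat_of_int a / rat_of_int b"
      using quotient_of_denom_pos[OF ab] quotient_of_div[OF ab] by auto
    have "rat_poly (const_poly a) = const_poly (rat_of_int b * c)"
      using b by (simp del: const_poly_hom)
    then have "rat_poly (const_poly a) = const_poly (rat_of_int b) * const_poly c"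
      by (simp only: const_poly_hom)
    then show ?case
      using b(1) by blast
  next
    case (var i)
    show ?case
      by (intro exI[of _ 1] exI[of _ "var i"]) simp
  next
    case (add p q)
    then obtain M P N Q where *: "M \<noteq> 0" "rat_poly P = const_poly (rat_of_int M) * p"
      "N \<noteq> 0" "rat_poly Q = const_poly (rat_of_int N) * q"
      by blast
    have "rat_poly (const_poly N * P + const_poly M * Q) = const_poly (rat_of_int (M * N)) * (p + q)"
      by (simp add: *(2,4) algebra_simps)
    then show ?case
      using *(1,3) by (metis mult_eq_0_iff)
  next
    case (mult p q)
    then obtain M P N Q where *: "M \<noteq> 0" "rat_poly P = const_poly (rat_of_int M) * p"
      "N \<noteq> 0" "rat_poly Q = const_poly (rat_of_int N) * q"
      by blast
    have "rat_poly (P * Q) = const_poly (rat_of_int (M * N)) * (p * q)"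
      by (simp add: *(2,4) algebra_simps)
    then show ?case
      using *(1,3) by (metis mult_eq_0_iff)
  qed
  then show ?thesis
    using that by blast
qed

lemma common_factor_over_int:
  assumes "\<not> rel_prime_over_Q d h F" "0 < h" "\<And>j. j < h \<Longrightarrow> F j \<noteq> 0"
  obtains G N where "G \<in> polys d" "\<And>c. G \<noteq> const_poly c" "N \<noteq> 0"
    "\<And>x. eval_poly G x dvd N * gcd_value h F x"
proof -
  obtain g H where g: "g \<in> polys d" "\<And>j. j < h \<Longrightarrow> rat_poly (F j) = g * H j"
    "\<not> (\<exists>H\<in>polys d. g * H = 1)"
    using assms(1) unfolding rel_prime_over_Q_def by metis
  have g0: "g \<noteq> 0"
    using g(2)[of 0] assms(2,3) by auto
  obtain a G where G: "a \<noteq> 0" "rat_poly G = const_poly (rat_of_int a) * g"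
    using clear_denominators .
  have "\<forall>j. \<exists>b K. b \<noteq> 0 \<and> rat_poly K = const_poly (rat_of_int b) * H j"
    using clear_denominators by metis
  then obtain b K where K: "\<And>j. b j \<noteq> 0" "\<And>j. rat_poly (K j) = const_poly (rat_of_int (b j)) * H j"
    by metis
  define N where "N = a * (\<Prod>j<h. b j)"
  have GP: "G \<in> polys d"
    using G(2) g(1) by (simp flip: rat_poly_in_polys_iff)
  have nonconst: "G \<noteq> const_poly c" for c
  proof
    assume c: "G = const_poly c"
    have "const_poly (rat_of_int c) = const_poly (rat_of_int a) * g"
      using G(2) by (simp add: c)
    moreover have "c \<noteq> 0"
      using calculation g0 G(1) by auto
    ultimately have "g * const_poly (rat_of_int a / rat_of_int c) = 1"
    proof -
      have "g * const_poly (rat_of_int a / rat_of_int c) =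
          (const_poly (rat_of_int a) * g) * const_poly (1 / rat_of_int c)"
        by (simp add: divide_inverse mult_ac)
      also have "\<dots> = const_poly (rat_of_int c * (1 / rat_of_int c))"
        by (simp only: const_poly_hom \<open>const_poly (rat_of_int c) = const_poly (rat_of_int a) * g\<close>[symmetric])
      also have "\<dots> = 1"
        using \<open>c \<noteq> 0\<close> by simp
      finally show ?thesis .
    qed
    then show False
      using g(3) const_in_polys by blast
  qed
  have dvd: "eval_poly G x dvd N * eval_poly (F j) x" if j: "j < h" for x j
  proof -
    have "rat_poly (const_poly (a * b j) * F j) = rat_poly (G * K j)"
      by (simp add: g(2)[OF j] G(2) K(2) mult_ac)
    then have "const_poly (a * b j) * F j = G * K j"
      by (simp only: rat_poly_eq_iff)
    then have "eval_poly (const_poly (a * b j) * F j) x = eval_poly (G * K j) x"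
      by simp
    then have "a * b j * eval_poly (F j) x = eval_poly G x * eval_poly (K j) x"
      by (simp del: const_poly_hom)
    moreover have "a * b j dvd N"
      unfolding N_def using j by (intro mult_dvd_mono) auto
    ultimately show ?thesis
      by (metis dvd_triv_left dvd_trans mult_dvd_mono dvd_refl)
  qed
  have "eval_poly G x dvd N * gcd_value h F x" for x
  proof -
    have "eval_poly G x dvd Gcd ((*) N ` (\<lambda>j. eval_poly (F j) x) ` {..<h})"
      using dvd by (auto intro!: Gcd_greatest)
    also have "\<dots> = normalize (N * gcd_value h F x)"
      by (simp add: Gcd_mult gcd_value_def)
    finally show ?thesis
      by simp
  qed
  moreover have "N \<noteq> 0"
    using G(1) K(1) by (simp add: N_def)
  ultimately show ?thesis
    using that GP nonconst by blast
qed

text \<open>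
  If the gcd is 1 then \<open>G x\<close> divides \<open>N\<close> and takes one of finitely many values \<open>v\<close>.  The product of
  the polynomials \<open>G - v\<close> is nonzero, since \<open>G\<close> is not constant, and Schwartz-Zippel bounds its
  zeros in the box.
\<close>

theorem density_common_factor:
  assumes "\<not> rel_prime_over_Q d h F" "0 < h" "\<And>j. j < h \<Longrightarrow> F j \<noteq> 0"
  shows "gcd_density_upto d h F {1} \<longlonglongrightarrow> 0"
proof -
  obtain G N where G: "G \<in> polys d" "\<And>c. G \<noteq> const_poly c" "N \<noteq> 0"
    "\<And>x. eval_poly G x dvd N * gcd_value h F x"
    using common_factor_over_int[OF assms] by blast
  define V where "V = {- \<bar>N\<bar>..\<bar>N\<bar>}"
  define R where "R = (\<Prod>v\<in>V. G - const_poly v)"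
  have "R \<in> polys d"
    unfolding R_def by (intro prod_in_polys diff_in_polys G(1) const_in_polys)
  moreover have "R \<noteq> 0"
    unfolding R_def V_def using G(2) by simp
  ultimately obtain C where C: "\<And>q A. (q = 0 \<or> prime q) \<Longrightarrow> finite A \<Longrightarrow> inj_on (\<lambda>a. a mod q) A \<Longrightarrow>
    card {y \<in> {..<d} \<rightarrow>\<^sub>E A. q dvd eval_poly R y} * card A \<le> C * card A ^ d"
    using card_zeros_mod by blast
  have bound: "norm (gcd_density_upto d h F {1} k) \<le> real C / real (2 * k + 1)" for k
  proof -
    let ?A = "{- int k..int k}"
    let ?G = "{x \<in> int_box d k. gcd_value h F x \<in> {1}}"
    have "?G \<subseteq> {y \<in> {..<d} \<rightarrow>\<^sub>E ?A. 0 dvd eval_poly R y}"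
    proof
      fix x assume x: "x \<in> ?G"
      then have "eval_poly G x dvd N"
        using G(4)[of x] by simp
      then have "\<bar>eval_poly G x\<bar> \<le> \<bar>N\<bar>"
        by (rule dvd_imp_le_int[OF G(3)])
      then have "eval_poly G x \<in> V"
        by (auto simp: V_def)
      then have "eval_poly R x = 0"
        unfolding R_def by (auto simp: V_def intro!: prod_zero)
      then show "x \<in> {y \<in> {..<d} \<rightarrow>\<^sub>E ?A. 0 dvd eval_poly R y}"
        using x by (simp add: int_box_def)
    qed
    then have "card ?G \<le> card {y \<in> {..<d} \<rightarrow>\<^sub>E ?A. 0 dvd eval_poly R y}"
      by (intro card_mono) auto
    then have "card ?G * (2 * k + 1) \<le> card {y \<in> {..<d} \<rightarrow>\<^sub>E ?A. 0 dvd eval_poly R y} * (2 * k + 1)"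
      by (rule mult_right_mono) simp
    also have "2 * k + 1 = card ?A"
      by simp
    also have "card {y \<in> {..<d} \<rightarrow>\<^sub>E ?A. 0 dvd eval_poly R y} * card ?A \<le> C * card ?A ^ d"
      by (rule C) (auto simp: inj_on_def)
    also have "card ?A = 2 * k + 1"
      by simp
    finally have "real (card ?G) * real (2 * k + 1) \<le> real C * real (2 * k + 1) ^ d"
      unfolding of_nat_power[symmetric] of_nat_mult[symmetric] of_nat_le_iff .
    moreover have "n / B \<le> c / b" if "n * b \<le> c * B" "B > 0" "b > 0" for n b c B :: real
      using that by (simp add: field_simps)
    ultimately have "card ?G / real (2 * k + 1) ^ d \<le> real C / real (2 * k + 1)"
      by simp
    then show ?thesis
      unfolding gcd_density_upto_eq by simp
  qed
  show ?thesis
    by (rule Lim_null_comparison[OF always_eventually[OF allI[OF bound]] tendsto_divide_side_length])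
qed

section \<open>The density of coprime values\<close>

theorem theorem2p12:
  fixes d h :: nat and F :: "nat \<Rightarrow> int mpoly"
  assumes "0 < d" and "0 < h"
    and "\<And>j. j < h \<Longrightarrow> F j \<in> polys d"
    and "\<And>j. j < h \<Longrightarrow> F j \<noteq> 0"
  shows
    "(\<not> rel_prime_over_Q d h F \<longrightarrow>
        convergent (gcd_density_upto d h F {1}) \<and> gcd_density d h F {1} = 0) \<and>
     (rel_prime_over_Q d h F \<longrightarrow>
        (convergent (gcd_density_upto d h F {1}) \<and>
         (\<lambda>p. if prime p then gcd_density_mod d h F p {1} else 1) has_prod gcd_density d h F {1}) \<and>
        (\<lambda>p. gcd_density_mod d h F p {0})
          \<in> O[inf sequentially (principal {p. prime p})](\<lambda>p. 1 / real p ^ 2) \<and>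
        (gcd_density d h F {1} = 0 \<longleftrightarrow> (\<exists>p. prime p \<and> gcd_density_mod d h F p {1} = 0)) \<and>
        (gcd_density d h F {1} = 0 \<longleftrightarrow>
           (\<exists>p. prime p \<and>
              (\<forall>x \<in> {..<d} \<rightarrow>\<^sub>E (UNIV :: int set). \<forall>j<h. int p dvd eval_poly (F j) x))))"
proof (intro conjI impI)
  assume nc: "\<not> rel_prime_over_Q d h F"
  have lim: "gcd_density_upto d h F {1} \<longlonglongrightarrow> 0"
    using density_common_factor[OF nc assms(2,4)] .
  then show "convergent (gcd_density_upto d h F {1})"
    by (auto simp: convergent_def)
  show "gcd_density d h F {1} = 0"
    unfolding gcd_density_def by (rule limI[OF lim])
next
  assume "rel_prime_over_Q d h F"
  then interpret coprime_family d h F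
    using assms(3) by unfold_locales (simp_all add: rel_prime_over_Q_iff_coprime_in)
  show "convergent (gcd_density_upto d h F {1})"
    using density_tendsto by (auto simp: convergent_def)
  have lf: "(\<lambda>p. if prime p then gcd_density_mod d h F p {1} else 1) = local_factor"
    by (simp add: fun_eq_iff local_factor_def)
  have prod: "local_factor has_prod gcd_density d h F {1}"
    unfolding gcd_density_eq by (rule convergent_prod_has_prod[OF convergent_prod_local_factor])
  then show "(\<lambda>p. if prime p then gcd_density_mod d h F p {1} else 1) has_prod gcd_density d h F {1}"
    unfolding lf .
  obtain C where C: "\<And>p. prime p \<Longrightarrow> gcd_density_mod d h F p {0} \<le> C / real p ^ 2"
    using gcd_density_mod_0_bound by blast
  show "(\<lambda>p. gcd_density_mod d h F p {0}) \<in> O[inf sequentially (principal {p. prime p})](\<lambda>p. 1 / real p ^ 2)"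
  proof (rule bigoI[of _ C])
    have "norm (gcd_density_mod d h F p {0}) \<le> C * norm (1 / real p ^ 2)" if "prime p" for p
    proof -
      have "0 \<le> gcd_density_mod d h F p {0}"
        by (simp add: gcd_density_mod_def)
      then show ?thesis
        using C[OF that] by simp
    qed
    then show "\<forall>\<^sub>F p in inf sequentially (principal {p. prime p}).
        norm (gcd_density_mod d h F p {0}) \<le> C * norm (1 / real p ^ 2)"
      by (simp add: eventually_inf_principal)
  qed
  have "gcd_density d h F {1} = 0 \<longleftrightarrow> (\<exists>p. local_factor p = 0)"
    using has_prod_eq_0_iff[OF prod] by (metis rangeE rangeI)
  also have "\<dots> \<longleftrightarrow> (\<exists>p. prime p \<and> gcd_density_mod d h F p {1} = 0)"
    by (auto simp: local_factor_def)
  finally show zero: "gcd_density d h F {1} = 0 \<longleftrightarrow> (\<exists>p. prime p \<and> gcd_density_mod d h F p {1} = 0)" .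
  show "gcd_density d h F {1} = 0 \<longleftrightarrow>
      (\<exists>p. prime p \<and> (\<forall>x \<in> {..<d} \<rightarrow>\<^sub>E (UNIV :: int set). \<forall>j<h. int p dvd eval_poly (F j) x))"
    unfolding zero
    by (intro arg_cong[where f = Ex] ext conj_cong refl gcd_density_mod_1_eq_0_iff assms(3))
qed

end
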